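(* Let $\mathcal G$ be a connected and compact metric graph with vertex set $\mathsf V$ and edge set $\mathsf E$, a (possibly empty) set $\mathsf V_D\subset\mathsf V$ of Dirichlet vertices, each of degree one, real coupling constants $(\alpha_{\mathsf v})_{\mathsf v\in\mathsf V\setminus\mathsf V_D}$, and real numbers $(q_{\mathsf e})_{\mathsf e\in\mathsf E}$. Let $H$ be the operator acting on each edge $\mathsf e$ as $\psi\mapsto-\frac{\mathrm d^2}{\mathrm dx_{\mathsf e}^2}\psi+q_{\mathsf e}\psi$, with Dirichlet conditions at the vertices in $\mathsf V_D$ and $\delta$-coupling conditions with constants $\alpha_{\mathsf v}$ at all other vertices (where $\alpha_{\mathsf v}=0$ means standard conditions). Then: (a) If $\mathcal G$ is a tree and $\mathsf V_D=\emptyset$, there exist a strictly increasing infinite sequence $(\lambda_k)_{k\in\mathbb N}$ of eigenvalues of $H$ of multiplicity one and a sequence $(\psi_k)_{k\in\mathbb N}$ of corresponding eigenfunctions such that no $\psi_k$ vanishes at any vertex of $\mathcal G$. (b) If $\mathsf V_D\neq\emptyset$, there exist a strictly increasing infinite sequence $(\lambda_k)_{k\in\mathbb N}$ of eigenvalues of $H$ and a sequence $(\psi_k)_{k\in\mathbb N}$ of corresponding eigenfunctions with full support, i.e. no $\psi_k$ vanishes identically on any edge of $\mathcal G$.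
   Context: Metric graphs: a compact metric graph $\mathcal G=(\mathsf G,\ell)$ consists of a finite combinatorial graph $\mathsf G$ with vertex set $\mathsf V$ and non-empty edge set $\mathsf E$ (without loops; parallel edges allowed) in which each edge $\mathsf e$ is identified with an interval $[0,\ell_{\mathsf e}]$, $\ell_{\mathsf e}\in(0,\infty)$; the endpoints $0$ and $\ell_{\mathsf e}$ are identified with the initial and the terminal vertex of $\mathsf e$. It is connected (a tree) if $\mathsf G$ is. $\mathsf E_{\mathsf v}$ denotes the set of edges incident to $\mathsf v$, and the degree of $\mathsf v$ is the number of these edges. Domain of $H$: functions $f\in L^2(\mathcal G)=\bigoplus_{\mathsf e}L^2(0,\ell_{\mathsf e})$ that are edgewise in the Sobolev space $H^2(0,\ell_{\mathsf e})$ and satisfy: at each Dirichlet vertex $f(\mathsf v)=0$; at each vertex with $\delta$-coupling condition with constant $\alpha_{\mathsf v}\in\mathbb R$, $f$ is continuous at $\mathsf v$ and $\sum_{\mathsf e\in\mathsf E_{\mathsf v}}\partial_{\mathsf e}f(\mathsf v)=\alpha_{\mathsf v}f(\mathsf v)$, where $\partial_{\mathsf e}f(\mathsf v)$ is the outward derivative, i.e. $-f_{\mathsf e}'(0)$ if $\mathsf v$ is the initial vertex of $\mathsf e$ and $f_{\mathsf e}'(\ell_{\mathsf e})$ if $\mathsf v$ is the terminal vertex. $H$ is self-adjoint with purely discrete spectrum, bounded from below. *)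

theory Defs
  imports
    "Graph_Theory.Digraph_Component"
    "HOL-Library.Function_Algebras"
    "HOL-Analysis.Analysis"
begin

section \<open>Metric graphs\<close>

text \<open>
  A finite multigraph without loops is given by an orientation of its edges, i.e. as a digraph
  with finitely many arcs, parallel arcs being allowed. The arc \<open>e\<close> is identified with the interval
  from \<open>0\<close> to \<open>len e\<close>, where \<open>0\<close> is the initial vertex \<open>tail G e\<close> and \<open>len e\<close> the terminal
  vertex \<open>head G e\<close>.
\<close>

locale compact_metric_graph = fin_digraph G + loopfree_digraph G
  for G :: "('v, 'e) pre_digraph" (structure) +
  fixes len :: "'e \<Rightarrow> real"
  assumes arcs_nonempty: "arcs G \<noteq> {}"
    and len_pos: "e \<in> arcs G \<Longrightarrow> 0 < len e"

definition incident_arcs :: "('v, 'e) pre_digraph \<Rightarrow> 'v \<Rightarrow> 'e set" where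
  "incident_arcs G v = in_arcs G v \<union> out_arcs G v"

definition vertex_degree :: "('v, 'e) pre_digraph \<Rightarrow> 'v \<Rightarrow> nat" where
  "vertex_degree G v = card (incident_arcs G v)"

text \<open>
  The library's \<^const>\<open>forest\<close> only excludes directed cycles, so it does not express that the
  underlying undirected multigraph is acyclic. Instead, every arc is doubled so that it can be
  traversed in both directions, and cycles in which no edge is used twice are excluded.
  (A pair of parallel edges does form such a cycle.)
\<close>

definition both_directions :: "('v, 'e) pre_digraph \<Rightarrow> ('v, 'e \<times> bool) pre_digraph" where
  "both_directions G =
     \<lparr>verts = verts G, arcs = arcs G \<times> UNIV,
      tail = (\<lambda>(e, b). if b then tail G e else head G e),
      head = (\<lambda>(e, b). if b then head G e else tail G e)\<rparr>"

definition undirected_tree :: "('v, 'e) pre_digraph \<Rightarrow> bool" where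
  "undirected_tree G \<longleftrightarrow>
     Digraph_Component.connected G \<and>
     \<not> (\<exists>p. pre_digraph.cycle (both_directions G) p \<and> distinct (map fst p))"

section \<open>Sobolev spaces on an interval\<close>

definition L2_on :: "real \<Rightarrow> (real \<Rightarrow> complex) \<Rightarrow> bool" where
  "L2_on l f \<longleftrightarrow>
     f \<in> borel_measurable (lebesgue_on {0<..<l}) \<and>
     integrable (lebesgue_on {0<..<l}) (\<lambda>x. (cmod (f x))\<^sup>2)"

text \<open>
  Test functions are compactly supported \<open>C\<^sup>1\<close> functions, as in Brezis' treatment of Sobolev spaces
  in one dimension; smooth test functions give the same weak derivatives.
\<close>

definition test_function :: "real \<Rightarrow> (real \<Rightarrow> real) \<Rightarrow> bool" where
  "test_function l \<phi> \<longleftrightarrow>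
     \<phi> C1_differentiable_on UNIV \<and> closure {x. \<phi> x \<noteq> 0} \<subseteq> {0<..<l}"

text \<open>
  Square integrability is part of the definition: the integral of a non-integrable function
  is \<open>0\<close> by convention, so the integral identity alone would be meaningless.
\<close>

definition weak_deriv :: "real \<Rightarrow> (real \<Rightarrow> complex) \<Rightarrow> (real \<Rightarrow> complex) \<Rightarrow> bool" where
  "weak_deriv l f g \<longleftrightarrow>
     L2_on l f \<and> L2_on l g \<and>
     (\<forall>\<phi>. test_function l \<phi> \<longrightarrow>
        (LINT x|lebesgue_on {0<..<l}. deriv \<phi> x *\<^sub>R f x) =
        - (LINT x|lebesgue_on {0<..<l}. \<phi> x *\<^sub>R g x))"

definition sobolev_H1 :: "real \<Rightarrow> (real \<Rightarrow> complex) \<Rightarrow> bool" where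
  "sobolev_H1 l f \<longleftrightarrow> (\<exists>g. weak_deriv l f g)"

definition sobolev_H2 :: "real \<Rightarrow> (real \<Rightarrow> complex) \<Rightarrow> bool" where
  "sobolev_H2 l f \<longleftrightarrow> (\<exists>g. weak_deriv l f g \<and> sobolev_H1 l g)"

section \<open>Vertex conditions\<close>

text \<open>
  A function on the metric graph has type \<open>'e \<Rightarrow> real \<Rightarrow> complex\<close>. In the next two definitions, \<open>v\<close>
  is meant to be an endpoint of the arc \<open>e\<close>; there are no loops, so the endpoint determines the
  end of the interval. The derivatives are one-sided.
\<close>

definition end_value ::
  "('v, 'e) pre_digraph \<Rightarrow> ('e \<Rightarrow> real) \<Rightarrow> ('e \<Rightarrow> real \<Rightarrow> complex) \<Rightarrow> 'e \<Rightarrow> 'v \<Rightarrow> complex" where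
  "end_value G len f e v = (if v = tail G e then f e 0 else f e (len e))"

definition outward_deriv ::
  "('v, 'e) pre_digraph \<Rightarrow> ('e \<Rightarrow> real) \<Rightarrow> ('e \<Rightarrow> real \<Rightarrow> complex) \<Rightarrow> 'e \<Rightarrow> 'v \<Rightarrow> complex" where
  "outward_deriv G len f e v =
     (if v = tail G e then - vector_derivative (f e) (at 0 within {0..len e})
      else vector_derivative (f e) (at (len e) within {0..len e}))"

definition vanishes_at ::
  "('v, 'e) pre_digraph \<Rightarrow> ('e \<Rightarrow> real) \<Rightarrow> ('e \<Rightarrow> real \<Rightarrow> complex) \<Rightarrow> 'v \<Rightarrow> bool" where
  "vanishes_at G len f v \<longleftrightarrow> (\<forall>e\<in>incident_arcs G v. end_value G len f e v = 0)"

definition delta_condition ::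
  "('v, 'e) pre_digraph \<Rightarrow> ('e \<Rightarrow> real) \<Rightarrow> real \<Rightarrow> ('e \<Rightarrow> real \<Rightarrow> complex) \<Rightarrow> 'v \<Rightarrow> bool" where
  "delta_condition G len a f v \<longleftrightarrow>
     (\<exists>c. (\<forall>e\<in>incident_arcs G v. end_value G len f e v = c) \<and>
          (\<Sum>e\<in>incident_arcs G v. outward_deriv G len f e v) = complex_of_real a * c)"

section \<open>The operator\<close>

text \<open>
  Elements of the domain are equivalence classes modulo null sets. Each is represented by the
  unique function that is continuous on every closed edge interval (such a representative exists
  for \<open>H\<^sup>2\<close> functions and is then continuously differentiable up to the endpoints) and zero outside
  of the graph.
\<close>

definition op_domain ::
  "('v, 'e) pre_digraph \<Rightarrow> ('e \<Rightarrow> real) \<Rightarrow> 'v set \<Rightarrow> ('v \<Rightarrow> real) \<Rightarrow>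
   ('e \<Rightarrow> real \<Rightarrow> complex) set" where
  "op_domain G len VD \<alpha> =
     {f. (\<forall>e x. e \<in> arcs G \<and> x \<in> {0..len e} \<or> f e x = 0) \<and>
         (\<forall>e\<in>arcs G. continuous_on {0..len e} (f e) \<and> sobolev_H2 (len e) (f e)) \<and>
         (\<forall>v\<in>VD. vanishes_at G len f v) \<and>
         (\<forall>v\<in>verts G - VD. delta_condition G len (\<alpha> v) f v)}"

text \<open>
  The graph of the operator \<open>H\<close>: \<open>H f = g\<close>, where \<open>g\<close> is determined up to null sets.
\<close>

definition op_maps ::
  "('v, 'e) pre_digraph \<Rightarrow> ('e \<Rightarrow> real) \<Rightarrow> 'v set \<Rightarrow> ('v \<Rightarrow> real) \<Rightarrow> ('e \<Rightarrow> real) \<Rightarrow>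
   ('e \<Rightarrow> real \<Rightarrow> complex) \<Rightarrow> ('e \<Rightarrow> real \<Rightarrow> complex) \<Rightarrow> bool" where
  "op_maps G len VD \<alpha> q f g \<longleftrightarrow>
     f \<in> op_domain G len VD \<alpha> \<and>
     (\<forall>e\<in>arcs G. \<exists>f' f''. weak_deriv (len e) (f e) f' \<and> weak_deriv (len e) f' f'' \<and>
        (AE x in lebesgue_on {0<..<len e}.
           g e x = - f'' x + complex_of_real (q e) * f e x))"

definition fun_scale :: "complex \<Rightarrow> ('e \<Rightarrow> real \<Rightarrow> complex) \<Rightarrow> 'e \<Rightarrow> real \<Rightarrow> complex" where
  "fun_scale z f = (\<lambda>e x. z * f e x)"

lemma vector_space_fun_scale: "vector_space fun_scale"
  by unfold_locales (auto simp: fun_scale_def fun_eq_iff algebra_simps)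

definition eigenspace ::
  "('v, 'e) pre_digraph \<Rightarrow> ('e \<Rightarrow> real) \<Rightarrow> 'v set \<Rightarrow> ('v \<Rightarrow> real) \<Rightarrow> ('e \<Rightarrow> real) \<Rightarrow>
   complex \<Rightarrow> ('e \<Rightarrow> real \<Rightarrow> complex) set" where
  "eigenspace G len VD \<alpha> q z = {f. op_maps G len VD \<alpha> q f (fun_scale z f)}"

definition eigenfunction ::
  "('v, 'e) pre_digraph \<Rightarrow> ('e \<Rightarrow> real) \<Rightarrow> 'v set \<Rightarrow> ('v \<Rightarrow> real) \<Rightarrow> ('e \<Rightarrow> real) \<Rightarrow>
   complex \<Rightarrow> ('e \<Rightarrow> real \<Rightarrow> complex) \<Rightarrow> bool" where
  "eigenfunction G len VD \<alpha> q z f \<longleftrightarrow> f \<in> eigenspace G len VD \<alpha> q z \<and> f \<noteq> 0"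

definition eigenvalue ::
  "('v, 'e) pre_digraph \<Rightarrow> ('e \<Rightarrow> real) \<Rightarrow> 'v set \<Rightarrow> ('v \<Rightarrow> real) \<Rightarrow> ('e \<Rightarrow> real) \<Rightarrow>
   complex \<Rightarrow> bool" where
  "eigenvalue G len VD \<alpha> q z \<longleftrightarrow> (\<exists>f. eigenfunction G len VD \<alpha> q z f)"

definition eigenvalue_multiplicity ::
  "('v, 'e) pre_digraph \<Rightarrow> ('e \<Rightarrow> real) \<Rightarrow> 'v set \<Rightarrow> ('v \<Rightarrow> real) \<Rightarrow> ('e \<Rightarrow> real) \<Rightarrow>
   complex \<Rightarrow> nat" where
  "eigenvalue_multiplicity G len VD \<alpha> q z = vector_space.dim fun_scale (eigenspace G len VD \<alpha> q z)"

end

theory Submission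
  imports Defs "HOL-Real_Asymp.Real_Asymp"
begin

text \<open>
  Write \<open>k = \<surd>\<lambda>\<close> and \<open>\<mu>\<^sub>e = \<surd>(k\<^sup>2 - q\<^sub>e)\<close>. By simultaneous Diophantine approximation there are
  arbitrarily large \<open>\<kappa>\<close> for which all \<open>\<kappa> len e\<close> are close to multiples of \<open>2 \<pi>\<close>. For bounded \<open>s\<close>, the
  eigenvalue equation at \<open>k = \<kappa> + s\<close> is then a small perturbation of the one at \<open>k = s\<close> for the
  graph without potential and without couplings, since both contribute only \<open>O(1/\<kappa>)\<close>. So the ground
  state of that graph reappears near every such \<open>\<kappa>\<close>, provided that it survives perturbations.

  With Dirichlet vertices the ground state has \<open>s > 0\<close> and all \<open>s len e < \<pi>\<close>. There the eigenvalue
  equation says that a quadratic form in the vertex values is degenerate. Its lowest value changes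
  sign on a window of \<open>s\<close>, hence vanishes for some \<open>k\<close>. As the off-diagonal coefficients are negative,
  the absolute value of a minimiser is again a minimiser, and by connectedness it is positive.

  On a tree without Dirichlet vertices the ground state is the constant function at \<open>s = 0\<close>, where
  the form degenerates. Instead, leaves are eliminated one after the other: for small phases a leaf
  only modifies the coupling constant of its neighbour. The coupling left at the last vertex changes
  sign with \<open>s\<close>, and at its zero the eigenfunction is unique and does not vanish at any vertex.
\<close>

section \<open>Weak solutions on an interval\<close>

text \<open>The two parts need different methods because \<open>m cot\<close> and
  \<open>m / sin\<close>, the coefficients of the quadratic form, have no limit at
  \<open>s = 0\<close>, where all sines vanish. Leaf elimination uses transfer relations instead, in
  which no sine is ever a denominator. Eliminating a leaf changes the total coupling by at least
  \<open>k / 4\<close> times the sine of the removed edge, in the direction of that sine; this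
  outweighs the fixed couplings once \<open>k\<close> is large. With Dirichlet vertices the rescaled
  form is positive at small \<open>s\<close>, where it tends to the discrete Dirichlet Laplacian
  with weights \<open>1 / len e\<close>. A negative value is forced by letting the phase of the
  longest edge approach \<open>pi\<close>, where its cotangent tends to minus infinity. An edge with
  both ends in \<open>VD\<close> is out of reach of the vertex values; such a graph is a single
  interval and is solved explicitly. Multiplicity one concerns the full eigenspace, whose elements
  are a priori only weak solutions; this is the reason for the regularity argument.\<close>

lemma integrable_continuous_open_interval:
  fixes f :: "real \<Rightarrow> 'a::euclidean_space"
  assumes "continuous_on {0..l} f"
  shows "integrable (lebesgue_on {0<..<l}) f"
    and "(LINT x|lebesgue_on {0<..<l}. f x) = integral {0..l} f"
proof -
  have "f absolutely_integrable_on {0..l}"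
    using assms by (simp add: absolutely_integrable_continuous_real)
  then have "f absolutely_integrable_on {0<..<l}"
    by (rule set_integrable_subset) auto
  then show int: "integrable (lebesgue_on {0<..<l}) f"
    by (subst integrable_restrict_space) (auto simp: set_integrable_def)
  then have "(LINT x|lebesgue_on {0<..<l}. f x) = integral {0<..<l} f"
    by (simp add: lebesgue_integral_eq_integral)
  then show "(LINT x|lebesgue_on {0<..<l}. f x) = integral {0..l} f"
    by (simp add: integral_open_interval_real)
qed

lemma integral_eq_on_superset:
  fixes f :: "real \<Rightarrow> 'a::banach"
  assumes "S \<subseteq> T" "\<And>x. x \<in> T - S \<Longrightarrow> f x = 0"
  shows "integral T f = integral S f"
proof -
  have "integral S f = integral UNIV (\<lambda>x. if x \<in> S then f x else 0)"
    by (rule integral_restrict_UNIV[symmetric])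
  also have "(\<lambda>x. if x \<in> S then f x else 0) = (\<lambda>x. if x \<in> T then f x else 0)"
    by (rule ext) (use assms in auto)
  finally show ?thesis by (simp add: integral_restrict_UNIV)
qed

lemma test_functionD:
  assumes "test_function l \<phi>"
  shows "(\<phi> has_field_derivative deriv \<phi> x) (at x)"
    and "continuous_on A (deriv \<phi>)" "continuous_on A \<phi>"
    and "x \<le> 0 \<or> l \<le> x \<Longrightarrow> \<phi> x = 0"
proof -
  obtain D where D: "\<And>x. (\<phi> has_vector_derivative D x) (at x)" "continuous_on UNIV D"
    using assms unfolding test_function_def C1_differentiable_on_def by auto
  have D': "(\<phi> has_field_derivative D x) (at x)" for x
    using D(1) by (simp add: has_real_derivative_iff_has_vector_derivative)
  then have eq: "deriv \<phi> = D"
    by (auto intro!: DERIV_imp_deriv)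
  show "(\<phi> has_field_derivative deriv \<phi> x) (at x)"
    unfolding eq by (rule D')
  show "continuous_on A (deriv \<phi>)"
    unfolding eq using D(2) continuous_on_subset by blast
  show "continuous_on A \<phi>"
    using D' by (meson DERIV_isCont continuous_at_imp_continuous_on)
  have "{x. \<phi> x \<noteq> 0} \<subseteq> {0<..<l}"
    using assms closure_subset[of "{x. \<phi> x \<noteq> 0}"] unfolding test_function_def by (elim conjE) (rule subset_trans)
  then show "x \<le> 0 \<or> l \<le> x \<Longrightarrow> \<phi> x = 0"
    by auto
qed

lemma L2_on_continuous:
  assumes "continuous_on {0..l} f"
  shows "L2_on l f"
  unfolding L2_on_def
proof
  show "f \<in> borel_measurable (lebesgue_on {0<..<l})"
    using integrable_continuous_open_interval(1)[OF assms] by (rule borel_measurable_integrable)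
  show "integrable (lebesgue_on {0<..<l}) (\<lambda>x. (cmod (f x))\<^sup>2)"
    by (intro integrable_continuous_open_interval continuous_intros assms)
qed

lemma weak_deriv_C1:
  assumes "0 < l" "continuous_on {0..l} f'"
    and "\<And>x. x \<in> {0..l} \<Longrightarrow> (f has_vector_derivative f' x) (at x within {0..l})"
  shows "weak_deriv l f f'"
proof -
  have contf: "continuous_on {0..l} f"
    using assms(3) continuous_on_vector_derivative by blast
  have "(LINT x|lebesgue_on {0<..<l}. deriv \<phi> x *\<^sub>R f x) =
        - (LINT x|lebesgue_on {0<..<l}. \<phi> x *\<^sub>R f' x)" if t: "test_function l \<phi>" for \<phi>
  proof -
    have "((\<lambda>x. \<phi> x *\<^sub>R f' x + deriv \<phi> x *\<^sub>R f x) has_integral (\<phi> l *\<^sub>R f l - \<phi> 0 *\<^sub>R f 0)) {0..l}"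
    proof (rule fundamental_theorem_of_calculus)
      fix x assume x: "x \<in> {0..l}"
      have "(\<phi> has_field_derivative deriv \<phi> x) (at x within {0..l})"
        using test_functionD(1)[OF t] by (rule has_field_derivative_at_within)
      then show "((\<lambda>x. \<phi> x *\<^sub>R f x) has_vector_derivative \<phi> x *\<^sub>R f' x + deriv \<phi> x *\<^sub>R f x)
            (at x within {0..l})"
        using assms(3)[OF x] by (rule has_vector_derivative_scaleR)
    qed (use assms in simp)
    then have "integral {0..l} (\<lambda>x. \<phi> x *\<^sub>R f' x + deriv \<phi> x *\<^sub>R f x) = 0"
      using test_functionD(4)[OF t] by (simp add: integral_unique)
    moreover have c: "continuous_on {0..l} (\<lambda>x. \<phi> x *\<^sub>R f' x)" "continuous_on {0..l} (\<lambda>x. deriv \<phi> x *\<^sub>R f x)"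
      by (intro continuous_intros assms contf test_functionD[OF t])+
    ultimately have "integral {0..l} (\<lambda>x. \<phi> x *\<^sub>R f' x) + integral {0..l} (\<lambda>x. deriv \<phi> x *\<^sub>R f x) = 0"
      by (simp add: integral_add integrable_continuous_real)
    then show ?thesis
      using c by (simp add: integrable_continuous_open_interval(2) add_eq_0_iff2)
  qed
  then show ?thesis
    unfolding weak_deriv_def using L2_on_continuous contf assms(2) by blast
qed

section \<open>Continuous weak solutions of the edge equation are sinusoids\<close>

lemma sinusoid_eq_0_imp:
  fixes A B \<mu> :: real
  assumes "a < b" "0 < \<mu>" "\<And>x. x \<in> {a<..<b} \<Longrightarrow> A * cos (\<mu> * x) + B * sin (\<mu> * x) = 0"
  shows "A = 0 \<and> B = 0"
proof -
  define x where "x = (a + b) / 2"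
  have x: "x \<in> {a<..<b}" using assms(1) by (auto simp: x_def)
  have "((\<lambda>x. A * cos (\<mu> * x) + B * sin (\<mu> * x)) has_field_derivative
      \<mu> * (- A * sin (\<mu> * x) + B * cos (\<mu> * x))) (at x)"
    by (auto intro!: derivative_eq_intros simp: algebra_simps)
  moreover have "((\<lambda>x. A * cos (\<mu> * x) + B * sin (\<mu> * x)) has_field_derivative 0) (at x)"
    by (rule has_field_derivative_transform_within_open[where f="\<lambda>_. 0" and S="{a<..<b}"])
      (use x assms(3) in auto)
  ultimately have "\<mu> * (- A * sin (\<mu> * x) + B * cos (\<mu> * x)) = 0"
    by (rule DERIV_unique)
  then have 1: "- A * sin (\<mu> * x) + B * cos (\<mu> * x) = 0"
    using assms(2) by simp
  have 2: "A * cos (\<mu> * x) + B * sin (\<mu> * x) = 0"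
    using assms(3) x by simp
  \<comment> \<open>Function and scaled derivative at \<open>x\<close> are the pair
    \<open>(A, B)\<close> rotated by the angle \<open>\<mu> * x\<close>, which preserves the sum of
    squares.\<close>
  have "A\<^sup>2 + B\<^sup>2 = (A\<^sup>2 + B\<^sup>2) * ((cos (\<mu> * x))\<^sup>2 + (sin (\<mu> * x))\<^sup>2)"
    by simp
  also have "\<dots> = (- A * sin (\<mu> * x) + B * cos (\<mu> * x))\<^sup>2 + (A * cos (\<mu> * x) + B * sin (\<mu> * x))\<^sup>2"
    by (simp only: power2_eq_square) algebra
  also have "\<dots> = 0" using 1 2 by simp
  finally show ?thesis by (simp add: sum_power2_eq_zero_iff)
qed

text \<open>Variation of constants produces the test function \<open>\<phi>\<close> with \<open>\<phi>'' + \<mu>\<^sup>2 \<phi> = \<psi>\<close>;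
  the orthogonality assumptions say exactly that its support is compact.\<close>

lemma weak_solution_orthogonal:
  fixes f :: "real \<Rightarrow> complex"
  assumes \<mu>: "0 < \<mu>" and cont: "continuous_on {0..l} f"
    and w1: "weak_deriv l f f'" and w2: "weak_deriv l f' f''"
    and eq: "AE x in lebesgue_on {0<..<l}. f'' x = - (complex_of_real (\<mu>\<^sup>2)) * f x"
    and ab: "0 < a" "a < b" "b < l"
    and \<psi>: "continuous_on UNIV \<psi>" "\<And>x. x \<notin> {a<..<b} \<Longrightarrow> \<psi> x = 0"
    and orth: "integral {a..b} (\<lambda>x. \<psi> x * cos (\<mu> * x)) = 0" "integral {a..b} (\<lambda>x. \<psi> x * sin (\<mu> * x)) = 0"
  shows "integral {a..b} (\<lambda>x. \<psi> x *\<^sub>R f x) = 0"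
proof -
  \<comment> \<open>The primitive of \<open>\<psi> * h\<close> normalised at \<open>a\<close>
    vanishes left of \<open>a\<close> because \<psi> does, and right of \<open>b\<close> because of
    the orthogonality.\<close>
  have ex: "\<exists>F. (\<forall>x. (F has_field_derivative \<psi> x * h x) (at x)) \<and> (\<forall>x. x \<notin> {a<..<b} \<longrightarrow> F x = 0)"
    if h: "continuous_on UNIV h" and h0: "integral {a..b} (\<lambda>x. \<psi> x * h x) = 0" for h
  proof -
    have "\<exists>F. \<forall>x::real. -\<infinity> < ereal x \<longrightarrow> ereal x < \<infinity> \<longrightarrow> (F has_vector_derivative \<psi> x * h x) (at x)"
      using h \<psi>(1) by (intro einterval_antiderivative) (auto simp: continuous_on_eq_continuous_at)
    then obtain F where F: "\<And>x. (F has_vector_derivative \<psi> x * h x) (at x)" by auto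
    have int: "((\<lambda>x. \<psi> x * h x) has_integral (F y - F x)) {x..y}" if "x \<le> y" for x y
      using F that by (intro fundamental_theorem_of_calculus) (auto intro: has_vector_derivative_at_within)
    have zero: "F y = F x" if "x \<le> y" "y \<le> a \<or> b \<le> x" for x y
    proof -
      have "((\<lambda>x. \<psi> x * h x) has_integral 0) {x..y}"
        by (rule has_integral_is_0) (use that \<psi>(2) in auto)
      then have "F y - F x = 0" using int[OF that(1)] by (rule has_integral_unique[symmetric])
    then show ?thesis by simp
    qed
    have "F b = F a" using int[of a b] h0 ab by (simp add: has_integral_iff)
    then have "F x - F a = 0" if "x \<notin> {a<..<b}" for x
      using zero[of x a] zero[of b x] that by (cases "x \<le> a") auto
    moreover have "((\<lambda>x. F x - F a) has_field_derivative \<psi> x * h x) (at x)" for x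
      using F[of x] by (auto intro!: derivative_eq_intros simp: has_real_derivative_iff_has_vector_derivative[symmetric])
    ultimately show ?thesis by blast
  qed
  obtain c where c: "\<And>x. (c has_field_derivative \<psi> x * cos (\<mu> * x)) (at x)" "\<And>x. x \<notin> {a<..<b} \<Longrightarrow> c x = 0"
  proof -
    have "continuous_on UNIV (\<lambda>x. cos (\<mu> * x))" by (intro continuous_intros)
    from ex[OF this orth(1)] show ?thesis using that by blast
  qed
  obtain s where s: "\<And>x. (s has_field_derivative \<psi> x * sin (\<mu> * x)) (at x)" "\<And>x. x \<notin> {a<..<b} \<Longrightarrow> s x = 0"
  proof -
    have "continuous_on UNIV (\<lambda>x. sin (\<mu> * x))" by (intro continuous_intros)
    from ex[OF this orth(2)] show ?thesis using that by blast
  qed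
  define \<phi> where "\<phi> x = (sin (\<mu> * x) * c x - cos (\<mu> * x) * s x) / \<mu>" for x
  define \<phi>' where "\<phi>' x = cos (\<mu> * x) * c x + sin (\<mu> * x) * s x" for x
  have contc: "continuous_on A c" "continuous_on A s" for A
    using c(1) s(1) by (meson DERIV_isCont continuous_at_imp_continuous_on)+
  have cont\<phi>: "continuous_on A \<phi>" "continuous_on A \<phi>'" for A
    unfolding \<phi>_def \<phi>'_def using \<mu> by (auto intro!: continuous_intros contc)
  have d\<phi>: "(\<phi> has_field_derivative \<phi>' x) (at x)" for x
    unfolding \<phi>_def \<phi>'_def using \<mu>
    by (auto intro!: derivative_eq_intros c s simp: field_simps)
  have d\<phi>': "(\<phi>' has_field_derivative \<psi> x - \<mu>\<^sup>2 * \<phi> x) (at x)" for x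
  proof -
    let ?c = "cos (\<mu> * x)" and ?s = "sin (\<mu> * x)"
    have "(\<phi>' has_field_derivative (\<psi> x * ?c * ?c + \<psi> x * ?s * ?s) - \<mu> * (?s * c x - ?c * s x)) (at x)"
      unfolding \<phi>'_def by (auto intro!: derivative_eq_intros c s simp: algebra_simps)
    moreover have "\<psi> x * ?c * ?c + \<psi> x * ?s * ?s = \<psi> x * (?c\<^sup>2 + ?s\<^sup>2)"
      by (simp only: power2_eq_square distrib_left mult.assoc)
    moreover have "\<mu>\<^sup>2 * \<phi> x = \<mu> * (?s * c x - ?c * s x)"
      unfolding \<phi>_def using \<mu> by (simp add: power2_eq_square)
    ultimately show ?thesis by simp
  qed
  have supp: "closure {x. g x \<noteq> 0} \<subseteq> {0<..<l}" if "\<And>x. x \<notin> {a<..<b} \<Longrightarrow> g x = 0" for g :: "real \<Rightarrow> real"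
  proof -
    have "{x. g x \<noteq> 0} \<subseteq> {a<..<b}" using that by blast
    then have "{x. g x \<noteq> 0} \<subseteq> {a..b}"
      by (rule subset_trans) auto
    then have "closure {x. g x \<noteq> 0} \<subseteq> {a..b}" by (simp add: closure_minimal)
    then show ?thesis using ab by force
  qed
  have t\<phi>: "test_function l \<phi>"
    unfolding test_function_def C1_differentiable_on_def
    using d\<phi> cont\<phi>(2)[of UNIV] supp[of \<phi>] c(2) s(2)
    by (auto simp: has_real_derivative_iff_has_vector_derivative \<phi>_def)
  have t\<phi>': "test_function l \<phi>'"
    unfolding test_function_def C1_differentiable_on_def
  proof (intro conjI exI ballI)
    show "(\<phi>' has_vector_derivative \<psi> x - \<mu>\<^sup>2 * \<phi> x) (at x)" for x
      using d\<phi>' by (simp add: has_real_derivative_iff_has_vector_derivative)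
    show "continuous_on UNIV (\<lambda>x. \<psi> x - \<mu>\<^sup>2 * \<phi> x)"
      by (intro continuous_intros \<psi> cont\<phi>)
    show "closure {x. \<phi>' x \<noteq> 0} \<subseteq> {0<..<l}"
      by (rule supp) (use c(2) s(2) in \<open>auto simp: \<phi>'_def\<close>)
  qed
  let ?L = "lebesgue_on {0<..<l}"
  have derivs: "deriv \<phi> = \<phi>'" "deriv \<phi>' = (\<lambda>x. \<psi> x - \<mu>\<^sup>2 * \<phi> x)"
    using d\<phi> d\<phi>' by (auto intro!: DERIV_imp_deriv)
  have cf: "continuous_on {0..l} (\<lambda>x. \<phi> x *\<^sub>R f x)" "continuous_on {0..l} (\<lambda>x. \<psi> x *\<^sub>R f x)"
    using \<psi>(1) by (auto intro!: continuous_intros cont cont\<phi> intro: continuous_on_subset)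
  \<comment> \<open>\<open>\<phi>'\<close> is the test function for \<open>w1\<close> and \<phi> the
    one for \<open>w2\<close>; together they move both derivatives from \<open>f\<close> onto
    \<phi>.\<close>
  have "(LINT x|?L. (\<psi> x - \<mu>\<^sup>2 * \<phi> x) *\<^sub>R f x) = - (LINT x|?L. \<phi>' x *\<^sub>R f' x)"
    using w1 t\<phi>' derivs unfolding weak_deriv_def by metis
  also have "\<dots> = (LINT x|?L. \<phi> x *\<^sub>R f'' x)"
    using w2 t\<phi> derivs unfolding weak_deriv_def by (metis minus_minus)
  also have "\<dots> = (LINT x|?L. - (\<mu>\<^sup>2) *\<^sub>R (\<phi> x *\<^sub>R f x))"
  proof (rule integral_cong_AE)
    have [measurable]: "f'' \<in> borel_measurable ?L" using w2 by (auto simp: weak_deriv_def L2_on_def)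
    have [measurable]: "f \<in> borel_measurable ?L" using w1 by (auto simp: weak_deriv_def L2_on_def)
    have [measurable]: "\<phi> \<in> borel_measurable ?L"
      using integrable_continuous_open_interval(1)[OF cont\<phi>(1)] by (rule borel_measurable_integrable)
    show "(\<lambda>x. \<phi> x *\<^sub>R f'' x) \<in> borel_measurable ?L" by measurable
    show "(\<lambda>x. - (\<mu>\<^sup>2) *\<^sub>R (\<phi> x *\<^sub>R f x)) \<in> borel_measurable ?L" by measurable
    show "AE x in ?L. \<phi> x *\<^sub>R f'' x = - (\<mu>\<^sup>2) *\<^sub>R (\<phi> x *\<^sub>R f x)"
      using eq by eventually_elim (simp add: scaleR_conv_of_real)
  qed
  also have "\<dots> = - (\<mu>\<^sup>2) *\<^sub>R (LINT x|?L. \<phi> x *\<^sub>R f x)"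
    by (rule integral_scaleR_right)
  also have "(LINT x|?L. (\<psi> x - \<mu>\<^sup>2 * \<phi> x) *\<^sub>R f x)
     = (LINT x|?L. \<psi> x *\<^sub>R f x) - \<mu>\<^sup>2 *\<^sub>R (LINT x|?L. \<phi> x *\<^sub>R f x)"
    using integrable_continuous_open_interval(1)[OF cf(1)] integrable_continuous_open_interval(1)[OF cf(2)]
    by (simp add: scaleR_diff_left scaleR_scaleR[symmetric] del: scaleR_scaleR)
  finally have "(LINT x|?L. \<psi> x *\<^sub>R f x) = 0" by simp
  then have "integral {0..l} (\<lambda>x. \<psi> x *\<^sub>R f x) = 0"
    using integrable_continuous_open_interval(2)[OF cf(2)] by simp
  moreover have "integral {0..l} (\<lambda>x. \<psi> x *\<^sub>R f x) = integral {a..b} (\<lambda>x. \<psi> x *\<^sub>R f x)"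
    using ab \<psi>(2) by (intro integral_eq_on_superset) auto
  ultimately show ?thesis by simp
qed


text \<open>Subtract from \<open>g\<close> its projection onto the span of cosine and sine in a
  weighted inner product. The weight times the remainder \<open>d\<close> is an admissible \<psi>,
  so \<open>d\<close> is orthogonal to \<open>g\<close> as well, hence to itself.\<close>

lemma weak_solution_sinusoid_on:
  fixes g :: "real \<Rightarrow> real"
  assumes \<mu>: "0 < \<mu>" and ab: "a < b" and g: "continuous_on {a..b} g"
    and orth: "\<And>\<psi>. continuous_on UNIV \<psi> \<Longrightarrow> (\<And>x. x \<notin> {a<..<b} \<Longrightarrow> \<psi> x = 0) \<Longrightarrow>
       integral {a..b} (\<lambda>x. \<psi> x * cos (\<mu> * x)) = 0 \<Longrightarrow> integral {a..b} (\<lambda>x. \<psi> x * sin (\<mu> * x)) = 0 \<Longrightarrow>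
       integral {a..b} (\<lambda>x. \<psi> x * g x) = 0"
  shows "\<exists>A B. \<forall>x\<in>{a<..<b}. g x = A * cos (\<mu> * x) + B * sin (\<mu> * x)"
proof -
  \<comment> \<open>This weight is positive inside and vanishes at both ends, so its product with a
    continuous function extends continuously by zero.\<close>
  define w where "w x = max 0 ((x - a) * (b - x))" for x :: real
  have w0: "w x = 0" if "x \<notin> {a<..<b}" for x
  proof -
    have "x \<le> a \<and> x \<le> b \<or> a \<le> x \<and> b \<le> x" using that ab by auto
    then have "(x - a) * (b - x) \<le> 0" by (auto simp: mult_nonneg_nonpos mult_nonpos_nonneg)
    then show ?thesis by (simp add: w_def)
  qed
  have wpos: "w x > 0" if "x \<in> {a<..<b}" for x
    using that by (auto simp: w_def)
  have contw: "continuous_on A w" for A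
    unfolding w_def by (intro continuous_intros)
  define ip where "ip f h = integral {a..b} (\<lambda>x. w x * f x * h x)" for f h :: "real \<Rightarrow> real"
  have int: "(\<lambda>x. w x * f x * h x) integrable_on {a..b}"
    if "continuous_on {a..b} f" "continuous_on {a..b} h" for f h
    by (intro integrable_continuous_real continuous_intros contw that)
  have ip_commute: "ip f h = ip h f" for f h
    unfolding ip_def by (simp add: mult_ac)
  have ip_lin: "ip (\<lambda>x. f1 x - c * f2 x) h = ip f1 h - c * ip f2 h"
    if "continuous_on {a..b} f1" "continuous_on {a..b} f2" "continuous_on {a..b} h" for f1 f2 h c
  proof -
    have "ip (\<lambda>x. f1 x - c * f2 x) h = integral {a..b} (\<lambda>x. w x * f1 x * h x - c * (w x * f2 x * h x))"
      unfolding ip_def by (simp add: algebra_simps)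
    also have "\<dots> = ip f1 h - c * ip f2 h"
      unfolding ip_def using int[OF that(1,3)] int[OF that(2,3)]
      by (subst integral_diff) (auto intro: integrable_on_mult_right)
    finally show ?thesis .
  qed
  have ip_self: "f x = 0" if "ip f f = 0" "continuous_on {a..b} f" "x \<in> {a<..<b}" for f x
  proof -
    have "\<forall>x\<in>cbox a b. w x * f x * f x = 0"
    proof (rule integral_cbox_eq_0_iff[THEN iffD1])
      show "continuous_on (cbox a b) (\<lambda>x. w x * f x * f x)"
        using that(2) unfolding cbox_interval by (intro continuous_intros contw)
      show "integral (cbox a b) (\<lambda>x. w x * f x * f x) = 0"
        using that by (simp add: ip_def)
    qed (use ab in \<open>auto simp: w_def mult.assoc\<close>)
    then have "w x * f x * f x = 0" using that(3) by simp
    then show ?thesis using wpos[OF that(3)] by simp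
  qed
  define u where "u x = cos (\<mu> * x)" for x
  define s where "s x = sin (\<mu> * x)" for x
  have cu: "continuous_on A u" "continuous_on A s" for A
    unfolding u_def s_def by (intro continuous_intros)+
  have indep: "ip f f \<noteq> 0" if "f = (\<lambda>x. A * u x + B * s x)" "A \<noteq> 0 \<or> B \<noteq> 0" for f A B
  proof
    assume "ip f f = 0"
    moreover have "continuous_on {a..b} f"
      unfolding that(1) by (intro continuous_intros cu)
    ultimately have "A * cos (\<mu> * x) + B * sin (\<mu> * x) = 0" if "x \<in> {a<..<b}" for x
      using ip_self[of f x] that \<open>f = _\<close> by (simp add: u_def s_def)
    then show False using sinusoid_eq_0_imp[OF ab \<mu>, of A B] that(2) by blast
  qed
  have uu: "ip u u \<noteq> 0" by (rule indep[where A=1 and B=0]) auto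
  \<comment> \<open>Gram-Schmidt: \<open>v\<close> is the part of the sine orthogonal to the
    cosine.\<close>
  define c where "c = ip s u / ip u u"
  define v where "v x = s x - c * u x" for x
  have cv: "continuous_on A v" for A
    unfolding v_def by (intro continuous_intros cu)
  have vv: "ip v v \<noteq> 0" by (rule indep[where A="-c" and B=1]) (auto simp: v_def)
  have vu: "ip v u = 0"
    unfolding v_def using ip_lin[of s u u c] cu uu by (simp add: c_def)
  define A where "A = ip g u / ip u u"
  define B where "B = ip g v / ip v v"
  define d1 where "d1 x = g x - A * u x" for x
  define d where "d x = d1 x - B * v x" for x
  have cd1: "continuous_on {a..b} d1" unfolding d1_def by (intro continuous_intros cu g)
  have cd: "continuous_on {a..b} d" unfolding d_def by (intro continuous_intros cd1 cv)
  have d1u: "ip d1 u = 0" and d1v: "ip d1 v = ip g v"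
    unfolding d1_def using ip_lin[of g u u A] ip_lin[of g u v A] uu vu ip_commute[of u v] cu cv g
    by (simp_all add: A_def)
  have du: "ip d u = 0" and dv: "ip d v = 0"
    unfolding d_def using ip_lin[of d1 v u B] ip_lin[of d1 v v B] vv vu d1u d1v cu cv cd1
    by (simp_all add: B_def)
  have "s = (\<lambda>x. v x - (- c) * u x)" by (auto simp: v_def)
  then have ds: "ip s d = 0"
    using ip_lin[of v u d "-c"] cu cv cd du dv ip_commute by simp
  \<comment> \<open>Clamping the argument extends \<open>d\<close> continuously from
    \<open>{a..b}\<close> to the whole line; the values outside are killed by
    \<open>w\<close>.\<close>
  define \<psi> where "\<psi> x = w x * d (max a (min b x))" for x
  have \<psi>: "\<psi> x = w x * d x" if "x \<in> {a..b}" for x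
    using that by (simp add: \<psi>_def)
  have \<psi>_ip: "integral {a..b} (\<lambda>x. \<psi> x * h x) = ip d h" for h
    unfolding ip_def by (rule integral_cong) (simp add: \<psi>)
  have "integral {a..b} (\<lambda>x. \<psi> x * g x) = 0"
  proof (rule orth)
    show "continuous_on UNIV \<psi>"
      unfolding \<psi>_def
      by (intro continuous_intros contw continuous_on_compose2[OF cd]) (use ab in auto)
    show "\<psi> x = 0" if "x \<notin> {a<..<b}" for x using w0[OF that] by (simp add: \<psi>_def)
  qed (use \<psi>_ip du ds ip_commute in \<open>simp_all add: u_def[symmetric] s_def[symmetric]\<close>)
  then have dg: "ip g d = 0" using \<psi>_ip ip_commute by simp
  have "ip d d = ip d1 d - B * ip v d"
    using ip_lin[OF cd1 cv cd, of B] by (simp only: d_def[abs_def, symmetric])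
  also have "ip d1 d = ip g d - A * ip u d"
    unfolding d1_def using ip_lin[of g u d A] g cu cd by simp
  finally have "ip d d = 0" using dg du dv ip_commute by simp
  then have "d x = 0" if "x \<in> {a<..<b}" for x
    using ip_self cd that by blast
  then have "g x = (A - B * c) * cos (\<mu> * x) + B * sin (\<mu> * x)" if "x \<in> {a<..<b}" for x
    using that by (fastforce simp: d_def d1_def v_def u_def s_def algebra_simps)
  then show ?thesis by blast
qed

text \<open>Compactly supported test functions see only intervals strictly inside the edge. The
  coefficients found there agree with those on the middle third by \<open>sinusoid_eq_0_imp\<close>,
  and continuity reaches the endpoints.\<close>

lemma locally_sinusoid_imp_sinusoid:
  fixes g :: "real \<Rightarrow> real"
  assumes \<mu>: "0 < \<mu>" and l: "0 < l" and g: "continuous_on {0..l} g"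
    and loc: "\<And>a b. 0 < a \<Longrightarrow> a < b \<Longrightarrow> b < l \<Longrightarrow>
        \<exists>A B. \<forall>x\<in>{a<..<b}. g x = A * cos (\<mu> * x) + B * sin (\<mu> * x)"
  shows "\<exists>A B. \<forall>x\<in>{0..l}. g x = A * cos (\<mu> * x) + B * sin (\<mu> * x)"
proof -
  obtain A B where AB: "\<And>x. x \<in> {l/3<..<2*l/3} \<Longrightarrow> g x = A * cos (\<mu> * x) + B * sin (\<mu> * x)"
    using loc[of "l/3" "2*l/3"] l by auto
  have 1: "g x - (A * cos (\<mu> * x) + B * sin (\<mu> * x)) = 0" if x: "x \<in> {0<..<l}" for x
  proof -
    \<comment> \<open>This interval contains both \<open>x\<close> and the middle third.\<close>
    define a where "a = min (l/3) (x/2)"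
    define b where "b = max (2*l/3) ((x+l)/2)"
    have ab: "0 < a" "a < b" "b < l" "x \<in> {a<..<b}" "{l/3<..<2*l/3} \<subseteq> {a<..<b}"
      using x l by (auto simp: a_def b_def less_max_iff_disj)
    obtain A' B' where AB': "\<And>x. x \<in> {a<..<b} \<Longrightarrow> g x = A' * cos (\<mu> * x) + B' * sin (\<mu> * x)"
      using loc[OF ab(1-3)] by auto
    have "A' - A = 0 \<and> B' - B = 0"
    proof (rule sinusoid_eq_0_imp[OF _ \<mu>])
      fix y assume y: "y \<in> {l/3<..<2*l/3}"
      then show "(A' - A) * cos (\<mu> * y) + (B' - B) * sin (\<mu> * y) = 0"
        using AB[OF y] AB'[of y] ab(5) by (auto simp: algebra_simps)
    qed (use l in simp)
    then show ?thesis using AB'[OF ab(4)] by simp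
  qed
  have "g x - (A * cos (\<mu> * x) + B * sin (\<mu> * x)) = 0" if "x \<in> closure {0<..<l}" for x
  proof (rule continuous_constant_on_closure[OF _ _ that])
    show "continuous_on (closure {0<..<l}) (\<lambda>x. g x - (A * cos (\<mu> * x) + B * sin (\<mu> * x)))"
      using l g by (auto intro!: continuous_intros)
  qed (use 1 in auto)
  then show ?thesis using l by (intro exI[of _ A] exI[of _ B]) auto
qed

text \<open>Real and imaginary part are treated separately; as bounded linear maps they commute with
  the integral. Existence of eigenfunctions is shown with explicit waves, so this serves only to
  bound the multiplicity from above.\<close>

lemma weak_solution_sinusoid:
  fixes f :: "real \<Rightarrow> complex"
  assumes \<mu>: "0 < \<mu>" and l: "0 < l" and cont: "continuous_on {0..l} f"
    and w1: "weak_deriv l f f'" and w2: "weak_deriv l f' f''"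
    and eq: "AE x in lebesgue_on {0<..<l}. f'' x = - (complex_of_real (\<mu>\<^sup>2)) * f x"
  shows "\<exists>A B. \<forall>x\<in>{0..l}. f x = A * of_real (cos (\<mu> * x)) + B * of_real (sin (\<mu> * x))"
proof -
  have *: "\<exists>A B. \<forall>x\<in>{0..l}. p (f x) = A * cos (\<mu> * x) + B * sin (\<mu> * x)"
    if p: "bounded_linear p" for p :: "complex \<Rightarrow> real"
  proof (rule locally_sinusoid_imp_sinusoid[OF \<mu> l])
    interpret bounded_linear p by fact
    show c: "continuous_on {0..l} (\<lambda>x. p (f x))"
      using cont by (rule continuous_on)
    fix a b :: real assume ab: "0 < a" "a < b" "b < l"
    show "\<exists>A B. \<forall>x\<in>{a<..<b}. p (f x) = A * cos (\<mu> * x) + B * sin (\<mu> * x)"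
    proof (rule weak_solution_sinusoid_on[OF \<mu> ab(2)])
      show "continuous_on {a..b} (\<lambda>x. p (f x))"
        using c by (rule continuous_on_subset) (use ab in auto)
      fix \<psi> :: "real \<Rightarrow> real"
      assume \<psi>: "continuous_on UNIV \<psi>" "\<And>x. x \<notin> {a<..<b} \<Longrightarrow> \<psi> x = 0"
        "integral {a..b} (\<lambda>x. \<psi> x * cos (\<mu> * x)) = 0" "integral {a..b} (\<lambda>x. \<psi> x * sin (\<mu> * x)) = 0"
      have "continuous_on {a..b} (\<lambda>x. \<psi> x *\<^sub>R f x)"
        using \<psi>(1) cont ab by (intro continuous_intros) (auto intro: continuous_on_subset)
      then have "integral {a..b} (p \<circ> (\<lambda>x. \<psi> x *\<^sub>R f x)) = p (integral {a..b} (\<lambda>x. \<psi> x *\<^sub>R f x))"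
        by (intro integral_linear[OF _ p] integrable_continuous_real)
      also have "\<dots> = 0"
        using weak_solution_orthogonal[OF \<mu> cont w1 w2 eq ab \<psi>] by (simp add: zero)
      finally show "integral {a..b} (\<lambda>x. \<psi> x * p (f x)) = 0"
        by (simp add: o_def scaleR)
    qed
  qed
  obtain A1 B1 where 1: "\<forall>x\<in>{0..l}. Re (f x) = A1 * cos (\<mu> * x) + B1 * sin (\<mu> * x)"
    using *[OF bounded_linear_Re] by blast
  obtain A2 B2 where 2: "\<forall>x\<in>{0..l}. Im (f x) = A2 * cos (\<mu> * x) + B2 * sin (\<mu> * x)"
    using *[OF bounded_linear_Im] by blast
  show ?thesis
    by (rule exI[of _ "Complex A1 A2"], rule exI[of _ "Complex B1 B2"])
      (use 1 2 in \<open>auto simp: complex_eq_iff\<close>)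
qed

section \<open>Eigenfunctions and their vertex data\<close>

text \<open>The cutoff to zero is the normalisation demanded by \<open>op_domain\<close>, so that
  members of an eigenspace can be compared by plain equality.\<close>

definition edge_wave ::
  "('v, 'e) pre_digraph \<Rightarrow> ('e \<Rightarrow> real) \<Rightarrow> ('e \<Rightarrow> real) \<Rightarrow> ('e \<Rightarrow> complex) \<Rightarrow> ('e \<Rightarrow> complex) \<Rightarrow> 'e \<Rightarrow> real \<Rightarrow> complex"
where
  "edge_wave G len \<mu> u b = (\<lambda>e x. if e \<in> arcs G \<and> x \<in> {0..len e}
      then u e * of_real (cos (\<mu> e * x)) + b e * of_real (sin (\<mu> e * x)) else 0)"

text \<open>\<open>p\<close>, \<open>q\<close> are the values at the two ends of an edge and \<open>P\<close>, \<open>Q\<close> the outward derivatives there;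
  \<open>C\<close> and \<open>S\<close> are cosine and sine of the frequency \<open>m\<close> times the length.\<close>

definition edge_transfer :: "real \<Rightarrow> real \<Rightarrow> real \<Rightarrow> complex \<Rightarrow> complex \<Rightarrow> complex \<Rightarrow> complex \<Rightarrow> bool" where
  "edge_transfer m C S p P q Q \<longleftrightarrow>
     of_real m * q = of_real m * of_real C * p - of_real S * P \<and>
     Q = - (of_real m * of_real S * p) - of_real C * P"

text \<open>An eigenfunction encoded by finitely many numbers. Continuity is built in, as \<phi>
  depends on the vertex only. The outward derivatives \<open>D e v\<close> are kept as unknowns of
  their own because solving for them would require division by the sines.\<close>

definition discrete_mode ::
  "('v, 'e) pre_digraph \<Rightarrow> ('e \<Rightarrow> real) \<Rightarrow> 'v set \<Rightarrow> ('v \<Rightarrow> real) \<Rightarrow> ('e \<Rightarrow> real) \<Rightarrow>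
   ('v \<Rightarrow> complex) \<Rightarrow> ('e \<Rightarrow> 'v \<Rightarrow> complex) \<Rightarrow> bool" where
  "discrete_mode G len VD \<alpha> \<mu> \<phi> D \<longleftrightarrow>
     (\<forall>e\<in>arcs G. edge_transfer (\<mu> e) (cos (\<mu> e * len e)) (sin (\<mu> e * len e))
        (\<phi> (tail G e)) (D e (tail G e)) (\<phi> (head G e)) (D e (head G e))) \<and>
     (\<forall>v\<in>VD. \<phi> v = 0) \<and>
     (\<forall>v\<in>verts G - VD. (\<Sum>e\<in>incident_arcs G v. D e v) = of_real (\<alpha> v) * \<phi> v)"

text \<open>The data at the initial vertex determine the wave. The sine coefficient carries a minus
  sign because the outward derivative there is \<open>- f'(0)\<close>.\<close>

definition mode_wave ::
  "('v, 'e) pre_digraph \<Rightarrow> ('e \<Rightarrow> real) \<Rightarrow> ('e \<Rightarrow> real) \<Rightarrow> ('v \<Rightarrow> complex) \<Rightarrow> ('e \<Rightarrow> 'v \<Rightarrow> complex) \<Rightarrow>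
   'e \<Rightarrow> real \<Rightarrow> complex" where
  "mode_wave G len \<mu> \<phi> D =
     edge_wave G len \<mu> (\<lambda>e. \<phi> (tail G e)) (\<lambda>e. - D e (tail G e) / of_real (\<mu> e))"

lemma sinusoid_has_vector_derivative:
  "((\<lambda>x. u * of_real (cos (m * x)) + b * of_real (sin (m * x))) has_vector_derivative
     (b * of_real m) * of_real (cos (m * x)) + (- u * of_real m) * of_real (sin (m * x))) (at x within X)"
  for u b :: complex
  by (auto intro!: derivative_eq_intros has_vector_derivative_of_real simp: algebra_simps
      has_real_derivative_iff_has_vector_derivative[symmetric])

lemma mem_incident_arcs:
  "e \<in> incident_arcs G v \<longleftrightarrow> e \<in> arcs G \<and> (v = tail G e \<or> v = head G e)"
  by (auto simp: incident_arcs_def)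

context compact_metric_graph
begin

lemma finite_incident_arcs: "finite (incident_arcs G v)"
  by (rule finite_subset[OF _ finite_arcs]) (auto simp: mem_incident_arcs)

lemma edge_wave_on:
  assumes "e \<in> arcs G" "x \<in> {0..len e}"
  shows "edge_wave G len \<mu> u b e x = u e * of_real (cos (\<mu> e * x)) + b e * of_real (sin (\<mu> e * x))"
  using assms by (simp add: edge_wave_def)

lemma edge_wave_has_vector_derivative:
  assumes "e \<in> arcs G" "x \<in> {0..len e}"
  shows "(edge_wave G len \<mu> u b e has_vector_derivative
      (b e * of_real (\<mu> e)) * of_real (cos (\<mu> e * x)) + (- u e * of_real (\<mu> e)) * of_real (sin (\<mu> e * x)))
      (at x within {0..len e})"
  by (rule has_vector_derivative_transform[OF assms(2) _ sinusoid_has_vector_derivative])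
    (use assms in \<open>auto simp: edge_wave_on\<close>)

lemma vector_derivative_edge_wave:
  assumes "e \<in> arcs G" "x \<in> {0..len e}"
  shows "vector_derivative (edge_wave G len \<mu> u b e) (at x within {0..len e}) =
      (b e * of_real (\<mu> e)) * of_real (cos (\<mu> e * x)) + (- u e * of_real (\<mu> e)) * of_real (sin (\<mu> e * x))"
  by (rule vector_derivative_within_closed_interval[OF len_pos[OF assms(1)] assms(2)
        edge_wave_has_vector_derivative[OF assms]])

lemma weak_deriv_edge_wave:
  assumes e: "e \<in> arcs G"
  shows "weak_deriv (len e) (edge_wave G len \<mu> u b e)
           (edge_wave G len \<mu> (\<lambda>e. b e * of_real (\<mu> e)) (\<lambda>e. - u e * of_real (\<mu> e)) e)"
proof (rule weak_deriv_C1)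
  show "0 < len e" using e by (rule len_pos)
  show "continuous_on {0..len e} (edge_wave G len \<mu> (\<lambda>e. b e * of_real (\<mu> e)) (\<lambda>e. - u e * of_real (\<mu> e)) e)"
    using edge_wave_has_vector_derivative[OF e] by (rule continuous_on_vector_derivative)
  show "(edge_wave G len \<mu> u b e has_vector_derivative
      edge_wave G len \<mu> (\<lambda>e. b e * of_real (\<mu> e)) (\<lambda>e. - u e * of_real (\<mu> e)) e x) (at x within {0..len e})"
    if "x \<in> {0..len e}" for x
    unfolding edge_wave_on[OF e that] by (rule edge_wave_has_vector_derivative[OF e that])
qed

lemma end_value_edge_wave:
  assumes "e \<in> arcs G"
  shows "end_value G len (edge_wave G len \<mu> u b) e (tail G e) = u e"
    and "end_value G len (edge_wave G len \<mu> u b) e (head G e) =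
      u e * of_real (cos (\<mu> e * len e)) + b e * of_real (sin (\<mu> e * len e))"
  using assms no_loops[OF assms] len_pos[OF assms] by (auto simp: end_value_def edge_wave_on)

lemma outward_deriv_edge_wave:
  assumes "e \<in> arcs G"
  shows "outward_deriv G len (edge_wave G len \<mu> u b) e (tail G e) = - (b e * of_real (\<mu> e))"
    and "outward_deriv G len (edge_wave G len \<mu> u b) e (head G e) =
      (b e * of_real (\<mu> e)) * of_real (cos (\<mu> e * len e)) + (- u e * of_real (\<mu> e)) * of_real (sin (\<mu> e * len e))"
  using assms no_loops[OF assms] len_pos[OF assms]
  by (auto simp: outward_deriv_def vector_derivative_edge_wave)

lemma mode_wave_ends:
  assumes mode: "discrete_mode G len VD \<alpha> \<mu> \<phi> D" and pos: "\<And>e. e \<in> arcs G \<Longrightarrow> 0 < \<mu> e"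
    and e: "e \<in> incident_arcs G v"
  shows "end_value G len (mode_wave G len \<mu> \<phi> D) e v = \<phi> v"
    and "outward_deriv G len (mode_wave G len \<mu> \<phi> D) e v = D e v"
proof -
  have e': "e \<in> arcs G" and v: "v = tail G e \<or> v = head G e"
    using e by (auto simp: mem_incident_arcs)
  have tr: "edge_transfer (\<mu> e) (cos (\<mu> e * len e)) (sin (\<mu> e * len e))
        (\<phi> (tail G e)) (D e (tail G e)) (\<phi> (head G e)) (D e (head G e))"
    using mode e' unfolding discrete_mode_def by blast
  show "end_value G len (mode_wave G len \<mu> \<phi> D) e v = \<phi> v"
    using v tr pos[OF e'] unfolding mode_wave_def edge_transfer_def
    by (auto simp: end_value_edge_wave[OF e'] field_simps)
  have "- D e (tail G e) / of_real (\<mu> e) * of_real (\<mu> e) = - D e (tail G e)"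
    using pos[OF e'] by simp
  then show "outward_deriv G len (mode_wave G len \<mu> \<phi> D) e v = D e v"
    using v tr unfolding mode_wave_def edge_transfer_def
    by (auto simp: outward_deriv_edge_wave[OF e'] simp del: times_divide_eq_left)
qed

lemma mode_wave_eigenspace:
  assumes mode: "discrete_mode G len VD \<alpha> \<mu> \<phi> D" and VD: "VD \<subseteq> verts G"
    and \<mu>: "\<And>e. e \<in> arcs G \<Longrightarrow> 0 < \<mu> e \<and> (\<mu> e)\<^sup>2 = z - q e"
  shows "mode_wave G len \<mu> \<phi> D \<in> eigenspace G len VD \<alpha> q (of_real z)"
proof -
  define u where "u = (\<lambda>e. \<phi> (tail G e))"
  define b where "b = (\<lambda>e. - D e (tail G e) / of_real (\<mu> e))"
  have f: "mode_wave G len \<mu> \<phi> D = edge_wave G len \<mu> u b"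
    by (simp add: mode_wave_def u_def b_def)
  have pos: "\<And>e. e \<in> arcs G \<Longrightarrow> 0 < \<mu> e" using \<mu> by blast
  note ends = mode_wave_ends[OF mode pos]
  let ?f' = "edge_wave G len \<mu> (\<lambda>e. b e * of_real (\<mu> e)) (\<lambda>e. - u e * of_real (\<mu> e))"
  let ?f'' = "edge_wave G len \<mu> (\<lambda>e. - u e * of_real (\<mu> e) * of_real (\<mu> e)) (\<lambda>e. - (b e * of_real (\<mu> e)) * of_real (\<mu> e))"
  have w1: "weak_deriv (len e) (edge_wave G len \<mu> u b e) (?f' e)" if "e \<in> arcs G" for e
    using that by (rule weak_deriv_edge_wave)
  have w2: "weak_deriv (len e) (?f' e) (?f'' e)" if "e \<in> arcs G" for e
    using that by (rule weak_deriv_edge_wave)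
  have "edge_wave G len \<mu> u b \<in> op_domain G len VD \<alpha>"
    unfolding op_domain_def
  proof (intro CollectI conjI allI ballI)
    show "e \<in> arcs G \<and> x \<in> {0..len e} \<or> edge_wave G len \<mu> u b e x = 0" for e x
      by (auto simp: edge_wave_def)
    show "continuous_on {0..len e} (edge_wave G len \<mu> u b e)" if "e \<in> arcs G" for e
      using edge_wave_has_vector_derivative[OF that] by (rule continuous_on_vector_derivative)
    show "sobolev_H2 (len e) (edge_wave G len \<mu> u b e)" if "e \<in> arcs G" for e
      unfolding sobolev_H2_def sobolev_H1_def using w1[OF that] w2[OF that] by blast
    show "vanishes_at G len (edge_wave G len \<mu> u b) v" if "v \<in> VD" for v
      unfolding vanishes_at_def f[symmetric] using ends(1) mode that by (auto simp: discrete_mode_def)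
    show "delta_condition G len (\<alpha> v) (edge_wave G len \<mu> u b) v" if "v \<in> verts G - VD" for v
      unfolding delta_condition_def f[symmetric]
      by (intro exI[of _ "\<phi> v"]) (use ends mode that in \<open>auto simp: discrete_mode_def\<close>)
  qed
  moreover have "fun_scale (of_real z) (edge_wave G len \<mu> u b) e x =
      - ?f'' e x + of_real (q e) * edge_wave G len \<mu> u b e x" if "e \<in> arcs G" for e x
  proof -
    have "of_real z = (of_real (\<mu> e) * of_real (\<mu> e) + of_real (q e) :: complex)"
      using \<mu>[OF that] by (simp add: power2_eq_square flip: of_real_mult of_real_add)
    then show ?thesis
      by (auto simp: fun_scale_def edge_wave_def algebra_simps)
  qed
  ultimately show ?thesis
    unfolding eigenspace_def op_maps_def f using w1 w2 by fastforce
qed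

lemma eigenspace_imp_mode:
  assumes f: "f \<in> eigenspace G len VD \<alpha> q (of_real z)" and VD: "VD \<subseteq> verts G"
    and \<mu>: "\<And>e. e \<in> arcs G \<Longrightarrow> 0 < \<mu> e \<and> (\<mu> e)\<^sup>2 = z - q e"
  shows "\<exists>\<phi> D. discrete_mode G len VD \<alpha> \<mu> \<phi> D \<and> f = mode_wave G len \<mu> \<phi> D"
proof -
  have maps: "op_maps G len VD \<alpha> q f (fun_scale (of_real z) f)" using f by (simp add: eigenspace_def)
  then have dom: "f \<in> op_domain G len VD \<alpha>" by (simp add: op_maps_def)
  have "\<exists>A B. \<forall>x\<in>{0..len e}. f e x = A * of_real (cos (\<mu> e * x)) + B * of_real (sin (\<mu> e * x))"
    if e: "e \<in> arcs G" for e
  proof -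
    obtain f' f'' where w: "weak_deriv (len e) (f e) f'" "weak_deriv (len e) f' f''"
      and ae: "AE x in lebesgue_on {0<..<len e}. fun_scale (of_real z) f e x = - f'' x + of_real (q e) * f e x"
      using maps e unfolding op_maps_def by blast
    have z: "of_real z = (of_real ((\<mu> e)\<^sup>2) + of_real (q e) :: complex)"
      using \<mu>[OF e] by (simp flip: of_real_add)
    from ae have "AE x in lebesgue_on {0<..<len e}. f'' x = - (complex_of_real ((\<mu> e)\<^sup>2)) * f e x"
      by eventually_elim (simp only: fun_scale_def z, algebra)
    moreover have "continuous_on {0..len e} (f e)"
      using dom e by (simp add: op_domain_def)
    ultimately show ?thesis
      using weak_solution_sinusoid w \<mu>[OF e] len_pos[OF e] by blast
  qed
  then obtain u b where ub: "\<And>e x. e \<in> arcs G \<Longrightarrow> x \<in> {0..len e} \<Longrightarrow>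
      f e x = u e * of_real (cos (\<mu> e * x)) + b e * of_real (sin (\<mu> e * x))"
    by metis
  have fw: "f = edge_wave G len \<mu> u b"
  proof (intro ext)
    fix e x
    show "f e x = edge_wave G len \<mu> u b e x"
    proof (cases "e \<in> arcs G \<and> x \<in> {0..len e}")
      case True
      then show ?thesis using ub by (simp add: edge_wave_def)
    next
      case False
      moreover have "\<forall>e x. e \<in> arcs G \<and> x \<in> {0..len e} \<or> f e x = 0"
        using dom unfolding op_domain_def by blast
      ultimately have "f e x = 0" by blast
      then show ?thesis using False by (auto simp: edge_wave_def)
    qed
  qed
  define D where "D = outward_deriv G len f"
  \<comment> \<open>One constant per vertex, zero at Dirichlet vertices, covers both kinds of vertex
    condition and becomes the value \<phi>.\<close>
  have "\<exists>c. (\<forall>e\<in>incident_arcs G v. end_value G len f e v = c) \<and> (v \<in> VD \<longrightarrow> c = 0) \<and>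
      (v \<notin> VD \<longrightarrow> (\<Sum>e\<in>incident_arcs G v. D e v) = of_real (\<alpha> v) * c)" if "v \<in> verts G" for v
    using dom that unfolding op_domain_def vanishes_at_def delta_condition_def D_def
    by (cases "v \<in> VD") auto
  then obtain \<phi> where \<phi>: "\<And>v e. v \<in> verts G \<Longrightarrow> e \<in> incident_arcs G v \<Longrightarrow> end_value G len f e v = \<phi> v"
    "\<And>v. v \<in> verts G \<Longrightarrow> v \<in> VD \<Longrightarrow> \<phi> v = 0"
    "\<And>v. v \<in> verts G \<Longrightarrow> v \<notin> VD \<Longrightarrow> (\<Sum>e\<in>incident_arcs G v. D e v) = of_real (\<alpha> v) * \<phi> v"
    by metis
  have ends: "\<phi> (tail G e) = u e" "\<phi> (head G e) = u e * of_real (cos (\<mu> e * len e)) + b e * of_real (sin (\<mu> e * len e))"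
    "D e (tail G e) = - (b e * of_real (\<mu> e))"
    "D e (head G e) = (b e * of_real (\<mu> e)) * of_real (cos (\<mu> e * len e)) + (- u e * of_real (\<mu> e)) * of_real (sin (\<mu> e * len e))"
    if "e \<in> arcs G" for e
    using \<phi>(1)[of "tail G e" e] \<phi>(1)[of "head G e" e] that
    by (simp_all add: fw D_def end_value_edge_wave outward_deriv_edge_wave mem_incident_arcs)
  have "discrete_mode G len VD \<alpha> \<mu> \<phi> D"
    unfolding discrete_mode_def edge_transfer_def using \<phi> VD by (auto simp: ends algebra_simps)
  moreover have "f = mode_wave G len \<mu> \<phi> D"
    unfolding fw mode_wave_def edge_wave_def using \<mu> by (force simp: fun_eq_iff ends)
  ultimately show ?thesis by blast
qed

text \<open>In \<open>uniq\<close> proportionality is asked for at initial vertices only, since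
  these data already fix the wave on each edge.\<close>

lemma mode_wave_simple_eigenvalue:
  assumes mode: "discrete_mode G len VD \<alpha> \<mu> \<phi> D" and VD: "VD \<subseteq> verts G"
    and \<mu>: "\<And>e. e \<in> arcs G \<Longrightarrow> 0 < \<mu> e \<and> (\<mu> e)\<^sup>2 = z - q e"
    and nz: "mode_wave G len \<mu> \<phi> D \<noteq> 0"
    and uniq: "\<And>\<phi>' D'. discrete_mode G len VD \<alpha> \<mu> \<phi>' D' \<Longrightarrow>
       \<exists>c. \<forall>e\<in>arcs G. \<phi>' (tail G e) = c * \<phi> (tail G e) \<and> D' e (tail G e) = c * D e (tail G e)"
  shows "eigenvalue_multiplicity G len VD \<alpha> q (of_real z) = 1"
proof -
  interpret V: vector_space fun_scale by (rule vector_space_fun_scale)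
  let ?\<psi> = "mode_wave G len \<mu> \<phi> D"
  have "\<exists>c. f = fun_scale c ?\<psi>" if f: "f \<in> eigenspace G len VD \<alpha> q (of_real z)" for f
  proof -
    obtain \<phi>' D' where m: "discrete_mode G len VD \<alpha> \<mu> \<phi>' D'" "f = mode_wave G len \<mu> \<phi>' D'"
      using eigenspace_imp_mode[OF f VD \<mu>] by blast
    obtain c where "\<forall>e\<in>arcs G. \<phi>' (tail G e) = c * \<phi> (tail G e) \<and> D' e (tail G e) = c * D e (tail G e)"
      using uniq[OF m(1)] by blast
    then have "f = fun_scale c ?\<psi>"
      unfolding m(2) by (auto simp: fun_eq_iff mode_wave_def edge_wave_def fun_scale_def algebra_simps)
    then show ?thesis by blast
  qed
  then have "eigenspace G len VD \<alpha> q (of_real z) \<subseteq> V.span {?\<psi>}"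
    using V.span_breakdown_eq V.span_singleton by blast
  moreover have "{?\<psi>} \<subseteq> eigenspace G len VD \<alpha> q (of_real z)"
    using mode_wave_eigenspace[OF mode VD \<mu>] by blast
  moreover have "V.independent {?\<psi>}" using nz by simp
  ultimately show ?thesis
    unfolding eigenvalue_multiplicity_def by (intro V.dim_unique) auto
qed

end

section \<open>Elimination of leaves on a tree\<close>

text \<open>Otherwise \<open>S\<close> would be closed under steps along arcs in either direction
  and contain everything reachable from it.\<close>

lemma connected_crossing_arc:
  assumes "Digraph_Component.connected G" "S \<subseteq> verts G" "S \<noteq> {}" "S \<noteq> verts G"
  shows "\<exists>e\<in>arcs G. (tail G e \<in> S) \<noteq> (head G e \<in> S)"
proof (rule ccontr)
  assume no: "\<not> ?thesis"
  obtain x y where x: "x \<in> S" "x \<in> verts G" and y: "y \<in> verts G" "y \<notin> S" using assms by blast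
  have "(x, y) \<in> rtrancl_on (verts G) (parcs (mk_symmetric G))"
    using assms(1) x y
    by (auto simp: Digraph_Component.connected_def strongly_connected_def reachable_def)
  then have "y \<in> S"
  proof (induction rule: rtrancl_on_induct)
    case (step y z)
    then show ?case using no by (auto simp: parcs_mk_symmetric)
  qed (use x in simp)
  then show False using y by simp
qed

section \<open>Trees built by attaching leaves\<close>

definition joins :: "('v, 'e) pre_digraph \<Rightarrow> 'e \<Rightarrow> 'v \<Rightarrow> 'v \<Rightarrow> bool" where
  "joins G e x y \<longleftrightarrow> tail G e = x \<and> head G e = y \<or> tail G e = y \<and> head G e = x"

text \<open>A derivation records an order in which leaves are attached; read backwards it is an
  elimination order. \<open>F\<close> need not contain all arcs between vertices of
  \<open>S\<close>.\<close>

inductive grown :: "('v, 'e) pre_digraph \<Rightarrow> 'v set \<Rightarrow> 'e set \<Rightarrow> bool" for G where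
  root: "r \<in> verts G \<Longrightarrow> grown G {r} {}"
| leaf: "grown G S F \<Longrightarrow> e \<in> arcs G \<Longrightarrow> x \<notin> S \<Longrightarrow> y \<in> S \<Longrightarrow> joins G e x y \<Longrightarrow>
    grown G (insert x S) (insert e F)"

lemma grown_ends:
  assumes "grown G S F" "e \<in> F"
  shows "e \<in> arcs G" "tail G e \<in> S" "head G e \<in> S"
  using assms by (induction) (auto simp: joins_def)

lemma grown_finite:
  assumes "grown G S F"
  shows "finite S" "finite F" "S \<noteq> {}"
  using assms by (induction) auto

context compact_metric_graph
begin

lemma grown_verts:
  assumes "grown G S F"
  shows "S \<subseteq> verts G"
  using assms by induction (auto simp: joins_def)

text \<open>A grown vertex set of maximal cardinality is everything, since a crossing arc would
  enlarge it.\<close>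

lemma exists_spanning_grown:
  assumes con: "Digraph_Component.connected G"
  shows "\<exists>F. grown G (verts G) F"
proof -
  have "verts G \<noteq> {}"
    using con by (auto simp: Digraph_Component.connected_def strongly_connected_def)
  then obtain r where "r \<in> verts G" by blast
  then have "\<exists>F. grown G {r} F" by (intro exI) (rule grown.root)
  moreover have "\<forall>S. (\<exists>F. grown G S F) \<longrightarrow> card S < Suc (card (verts G))"
    using grown_verts by (auto intro!: card_mono simp: less_Suc_eq_le)
  ultimately have "\<exists>S. (\<exists>F. grown G S F) \<and> (\<forall>S'. (\<exists>F. grown G S' F) \<longrightarrow> card S' \<le> card S)"
    by (rule Lattices_Big.ex_has_greatest_nat)
  then obtain S where S: "\<exists>F. grown G S F" and max: "\<And>S'. \<exists>F. grown G S' F \<Longrightarrow> card S' \<le> card S"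
    by blast
  obtain F where F: "grown G S F" using S by blast
  have "S = verts G"
  proof (rule ccontr)
    assume "S \<noteq> verts G"
    then obtain e where e: "e \<in> arcs G" "(tail G e \<in> S) \<noteq> (head G e \<in> S)"
      using connected_crossing_arc[OF con grown_verts[OF F] grown_finite(3)[OF F]] by blast
    then obtain x y where "joins G e x y" "x \<notin> S" "y \<in> S"
      unfolding joins_def by blast
    then have "grown G (insert x S) (insert e F)" using F e(1) by (intro leaf)
    then have "card (insert x S) \<le> card S" using max by blast
    then show False using \<open>x \<notin> S\<close> grown_finite(1)[OF F] by simp
  qed
  then show ?thesis using F by blast
qed

lemma both_directions_simps [simp]:
  "verts (both_directions G) = verts G" "arcs (both_directions G) = arcs G \<times> UNIV"
  "tail (both_directions G) (e, b) = (if b then tail G e else head G e)"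
  "head (both_directions G) (e, b) = (if b then head G e else tail G e)"
  by (auto simp: both_directions_def)

lemma wf_both_directions: "wf_digraph (both_directions G)"
  by unfold_locales auto

text \<open>The path is to be closed up to a cycle by an arc outside \<open>F\<close>, which
  requires distinct edges and distinct vertices. Confinement to \<open>S\<close> and
  \<open>F\<close> is part of the induction so that a newly attached leaf cannot occur on the path
  already.\<close>

lemma grown_simple_path:
  assumes "grown G S F" "u \<in> S" "w \<in> S"
  shows "\<exists>p. pre_digraph.cas (both_directions G) u p w \<and> fst ` set p \<subseteq> F \<and> distinct (map fst p) \<and>
     distinct (pre_digraph.awalk_verts (both_directions G) u p) \<and>
     set (pre_digraph.awalk_verts (both_directions G) u p) \<subseteq> S"
    (is "\<exists>p. ?P S F u p w")
  using assms
proof (induction arbitrary: u w)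
  case (root r)
  interpret B: wf_digraph "both_directions G" by (rule wf_both_directions)
  show ?case using root by (intro exI[of _ "[]"]) auto
next
  case (leaf S F e x y)
  interpret B: wf_digraph "both_directions G" by (rule wf_both_directions)
  have eF: "e \<notin> F" using grown_ends[OF leaf.hyps(1), of e] leaf.hyps by (auto simp: joins_def)
  have xy: "x \<noteq> y" using leaf.hyps by blast
  consider "u \<in> S" "w \<in> S" | "u = x" "w = x" | "u = x" "w \<in> S" | "u \<in> S" "w = x"
    using leaf.prems by blast
  then show ?case
  proof cases
    case 1
    then obtain p where "?P S F u p w" using leaf.IH by blast
    then show ?thesis by (intro exI[of _ p]) auto
  next
    case 2
    then show ?thesis by (intro exI[of _ "[]"]) auto
  next
    case 3
    obtain p where "?P S F y p w" using leaf.IH[OF leaf.hyps(4) 3(2)] by blast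
    \<comment> \<open>The Boolean is the direction in which \<open>e\<close> is traversed when
      leaving \<open>x\<close>.\<close>
    then show ?thesis using 3 leaf.hyps eF xy
      by (intro exI[of _ "(e, tail G e = x) # p"]) (auto simp: joins_def)
  next
    case 4
    obtain p where p: "?P S F u p y" using leaf.IH[OF 4(1) leaf.hyps(4)] by blast
    let ?q = "p @ [(e, tail G e = y)]"
    have last: "B.awlast u p = y" using p B.awlast_if_cas by blast
    have "B.cas u ?q x"
      using p last leaf.hyps(5) xy by (auto simp: joins_def)
    moreover from this have "B.awalk_verts u ?q = B.awalk_verts u p @ [x]"
      using B.awalk_verts_append_cas[of u p "[(e, tail G e = y)]" x] last leaf.hyps(5) xy
      by (auto simp: joins_def)
    ultimately show ?thesis using 4 p leaf.hyps eF
      by (intro exI[of _ ?q]) auto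
  qed
qed

text \<open>An arc missing from a spanning \<open>F\<close> would form, with the path in
  \<open>F\<close> from its head back to its tail, a cycle using no edge twice.\<close>

lemma tree_grown:
  assumes "undirected_tree G"
  shows "grown G (verts G) (arcs G)"
proof -
  interpret B: wf_digraph "both_directions G" by (rule wf_both_directions)
  obtain F where F: "grown G (verts G) F"
    using exists_spanning_grown assms unfolding undirected_tree_def by blast
  have "e \<in> F" if e: "e \<in> arcs G" for e
  proof (rule ccontr)
    assume eF: "e \<notin> F"
    obtain p where p: "B.cas (head G e) p (tail G e)" "fst ` set p \<subseteq> F" "distinct (map fst p)"
      "distinct (B.awalk_verts (head G e) p)"
      using grown_simple_path[OF F, of "head G e" "tail G e"] e by auto
    let ?p = "(e, True) # p"
    have "set p \<subseteq> arcs G \<times> UNIV" using p(2) grown_ends(1)[OF F] by force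
    then have "B.awalk (tail G e) ?p (tail G e)"
      using p(1) e by (simp add: B.awalk_def)
    then have "B.cycle ?p" unfolding B.cycle_def using p(4) by (intro exI[of _ "tail G e"]) simp
    moreover have "distinct (map fst ?p)" using p eF by auto
    ultimately show False using assms unfolding undirected_tree_def by blast
  qed
  then have "F = arcs G" using grown_ends(1)[OF F] by blast
  then show ?thesis using F by simp
qed

end

section \<open>Modes of a growing tree and the elimination of one leaf\<close>

text \<open>The vertex and edge conditions on a part of the graph. Frequencies, cosines and sines
  are independent parameters, since elimination is pure algebra based on
  \<open>c\<^sup>2 + s\<^sup>2 = 1\<close>; the couplings \<open>a\<close> are a parameter because
  elimination alters them.\<close>

definition partial_mode ::
  "('v, 'e) pre_digraph \<Rightarrow> ('e \<Rightarrow> real) \<Rightarrow> ('e \<Rightarrow> real) \<Rightarrow> ('e \<Rightarrow> real) \<Rightarrow> 'v set \<Rightarrow> 'e set \<Rightarrow> ('v \<Rightarrow> real) \<Rightarrow>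
   ('v \<Rightarrow> complex) \<Rightarrow> ('e \<Rightarrow> 'v \<Rightarrow> complex) \<Rightarrow> bool" where
  "partial_mode G m c s V F a \<phi> D \<longleftrightarrow>
     (\<forall>e\<in>F. edge_transfer (m e) (c e) (s e) (\<phi> (tail G e)) (D e (tail G e)) (\<phi> (head G e)) (D e (head G e))) \<and>
     (\<forall>v\<in>V. (\<Sum>e\<in>incident_arcs G v \<inter> F. D e v) = of_real (a v) * \<phi> v)"

text \<open>With outward derivatives at both ends the transfer matrix squares to
  \<open>c\<^sup>2 + s\<^sup>2\<close> times the identity, so the orientation of an edge is
  immaterial.\<close>

lemma edge_transfer_sym:
  assumes "edge_transfer m c s p P q Q" "c\<^sup>2 + s\<^sup>2 = 1"
  shows "edge_transfer m c s q Q p P"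
proof -
  have 1: "of_real c * of_real c + of_real s * of_real s = (1 :: complex)"
    using assms(2) by (simp add: power2_eq_square flip: of_real_mult of_real_add)
  show ?thesis
    using assms(1) 1 unfolding edge_transfer_def by (elim conjE, intro conjI; algebra)
qed

text \<open>At a leaf the vertex condition reads \<open>P = a * p\<close>, so both data at the far
  end are multiples of \<open>p\<close>; minus their quotient \<open>Q / q\<close> is the coupling
  handed to the neighbour.\<close>

lemma edge_transfer_leaf:
  assumes "m \<noteq> 0"
  shows "edge_transfer m c s p (of_real a * p) q Q \<longleftrightarrow>
    q = of_real (c - a * s / m) * p \<and> Q = - (of_real (m * s + a * c) * p)"
proof -
  have "of_real m * q = of_real m * of_real c * p - of_real s * (of_real a * p) \<longleftrightarrow> q = of_real (c - a * s / m) * p"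
    using assms by (simp add: field_simps)
  moreover have "- (of_real m * of_real s * p) - of_real c * (of_real a * p) = - (of_real (m * s + a * c) * p)"
    by (simp add: algebra_simps)
  ultimately show ?thesis by (simp only: edge_transfer_def)
qed

text \<open>Eliminating a leaf with coupling \<open>A\<close> adds \<open>(m s + A c) / d\<close> to the coupling at its neighbour.
  The last two bounds control how the total coupling of the tree changes, which fixes its sign
  at both ends of the \<open>k\<close>-interval.\<close>

lemma leaf_elimination_bounds:
  fixes k m c s A \<epsilon> :: real
  assumes "0 < k" "\<epsilon> \<le> 1/8" "\<bar>A\<bar> \<le> \<epsilon> * k" "\<bar>s\<bar> \<le> \<epsilon>" "1/2 \<le> c" "c\<^sup>2 + s\<^sup>2 = 1" "k/2 \<le> m" "m \<le> 2 * k"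
  defines "d \<equiv> c - A * s / m"
  shows "0 < d" "\<bar>(m * s + A * c) / d\<bar> \<le> 12 * \<epsilon> * k"
    and "0 \<le> s \<Longrightarrow> A + k / 4 * s \<le> (m * s + A * c) / d"
    and "s \<le> 0 \<Longrightarrow> (m * s + A * c) / d \<le> A + k / 4 * s"
proof -
  have m: "0 < m" using assms by linarith
  have \<epsilon>: "0 \<le> \<epsilon>" using assms(4) by linarith
  have "c\<^sup>2 \<le> 1" using assms(6) zero_le_power2[of s] by linarith
  then have c1: "c \<le> 1" using power2_le_imp_le[of c 1] by simp
  have "\<bar>A * s\<bar> \<le> (\<epsilon> * k) * \<epsilon>"
    unfolding abs_mult by (rule mult_mono) (use assms \<epsilon> in auto)
  also have "\<dots> \<le> (1/8 * k) * (1/8)"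
    by (intro mult_mono) (use assms \<epsilon> in auto)
  also have "\<dots> \<le> 1/4 * m" using assms(1,7) by simp
  finally have "\<bar>A * s / m\<bar> \<le> 1/4" using m by (simp add: abs_divide field_simps)
  then have "- (1/4) \<le> A * s / m \<and> A * s / m \<le> 1/4" by linarith
  then have d: "1/4 \<le> d" "d \<le> 2" using assms(5) c1 unfolding d_def by linarith+
  then show d0: "0 < d" by simp
  have "\<bar>m * s\<bar> \<le> (2 * k) * \<epsilon>" unfolding abs_mult by (rule mult_mono) (use assms m in auto)
  moreover have "\<bar>A * c\<bar> \<le> (\<epsilon> * k) * 1" unfolding abs_mult by (rule mult_mono) (use assms c1 \<epsilon> in auto)
  \<comment> \<open>The constant 12 is this 3 times the factor 4 from
    \<open>1/4 \<le> d\<close>.\<close>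
  ultimately have "\<bar>m * s + A * c\<bar> \<le> 3 * \<epsilon> * k" by (simp add: algebra_simps)
  moreover have "3 * \<epsilon> * k \<le> 12 * \<epsilon> * k * d"
    using mult_left_mono[OF d(1), of "12 * \<epsilon> * k"] \<epsilon> assms(1) by simp
  ultimately have "\<bar>m * s + A * c\<bar> \<le> 12 * \<epsilon> * k * d" by linarith
  then show "\<bar>(m * s + A * c) / d\<bar> \<le> 12 * \<epsilon> * k"
    using d0 by (simp add: abs_divide pos_divide_le_eq)
  \<comment> \<open>Isolating \<open>A\<close> shows that the change of coupling has the sign of
    \<open>s\<close>. Its factor is at least \<open>k / 4\<close> because
    \<open>m \<ge> k / 2\<close> and \<open>d \<le> 2\<close>.\<close>
  have eq: "(m * s + A * c) / d = A + s * (m + A\<^sup>2 / m) / d"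
    using d0 m unfolding d_def by (simp add: field_simps power2_eq_square)
  have "k / 4 * d \<le> k / 4 * 2" using d assms(1) by (intro mult_left_mono) auto
  also have "\<dots> \<le> m + A\<^sup>2 / m" using assms(7) m by (simp add: add_increasing2)
  finally have k: "k / 4 \<le> (m + A\<^sup>2 / m) / d" using d0 by (simp add: pos_le_divide_eq)
  show "0 \<le> s \<Longrightarrow> A + k / 4 * s \<le> (m * s + A * c) / d"
    using mult_left_mono[OF k, of s] unfolding eq by (simp add: mult_ac)
  show "s \<le> 0 \<Longrightarrow> (m * s + A * c) / d \<le> A + k / 4 * s"
    using mult_left_mono_neg[OF k, of s] unfolding eq by (simp add: mult_ac)
qed

context compact_metric_graph
begin

context
  fixes m c s :: "'e \<Rightarrow> real" and S F e x y a d
  assumes F: "finite F" "\<And>e. e \<in> F \<Longrightarrow> e \<in> arcs G \<and> tail G e \<in> S \<and> head G e \<in> S"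
    and e: "e \<in> arcs G" "joins G e x y" "x \<notin> S" "y \<in> S"
    and m: "m e \<noteq> 0" and cs: "(c e)\<^sup>2 + (s e)\<^sup>2 = 1"
    and d: "d \<noteq> 0" "d = c e - a x * s e / m e"
begin

lemma leaf_incident:
  "incident_arcs G x \<inter> insert e F = {e}"
  "incident_arcs G y \<inter> insert e F = insert e (incident_arcs G y \<inter> F)"
  "v \<in> S \<Longrightarrow> v \<noteq> y \<Longrightarrow> incident_arcs G v \<inter> insert e F = incident_arcs G v \<inter> F"
  "e \<notin> F"
  using F e by (auto simp: mem_incident_arcs joins_def)

lemma leaf_transfer_iff:
  "edge_transfer (m e) (c e) (s e) (\<phi> (tail G e)) (D (tail G e)) (\<phi> (head G e)) (D (head G e)) \<longleftrightarrow>
   edge_transfer (m e) (c e) (s e) (\<phi> x) (D x) (\<phi> y) (D y)"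
  using e(2) edge_transfer_sym cs unfolding joins_def by metis

text \<open>As \<open>d\<close> is nonzero, the derivative \<open>D e y\<close> is a real multiple
  of \<open>\<phi> y\<close> and can be moved to the right-hand side of the condition at
  \<open>y\<close>, where it acts as a coupling. The further conclusions express the data on
  \<open>e\<close> through \<open>\<phi> x\<close>, which carries uniqueness back to the larger
  tree.\<close>

lemma partial_mode_remove_leaf:
  assumes "partial_mode G m c s (insert x S) (insert e F) a \<phi> D"
  shows "partial_mode G m c s S F (a(y := a y + (m e * s e + a x * c e) / d)) \<phi> D"
    and "\<phi> y = of_real d * \<phi> x" "D e x = of_real (a x) * \<phi> x"
    and "D e y = - (of_real (m e * s e + a x * c e) * \<phi> x)"
proof -
  have vc: "(\<Sum>e\<in>incident_arcs G v \<inter> insert e F. D e v) = of_real (a v) * \<phi> v" if "v \<in> insert x S" for v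
    using assms that unfolding partial_mode_def by blast
  show Dx: "D e x = of_real (a x) * \<phi> x" using vc[of x] by (simp add: leaf_incident(1))
  have "edge_transfer (m e) (c e) (s e) (\<phi> x) (D e x) (\<phi> y) (D e y)"
    using assms leaf_transfer_iff[of \<phi> "D e"] unfolding partial_mode_def by blast
  then show y: "\<phi> y = of_real d * \<phi> x" and Dy: "D e y = - (of_real (m e * s e + a x * c e) * \<phi> x)"
    unfolding Dx using edge_transfer_leaf[OF m] d(2) by blast+
  have "(\<Sum>e\<in>incident_arcs G v \<inter> F. D e v) = of_real ((a(y := a y + (m e * s e + a x * c e) / d)) v) * \<phi> v"
    if v: "v \<in> S" for v
  proof (cases "v = y")
    case True
    have "D e y + (\<Sum>e\<in>incident_arcs G y \<inter> F. D e y) = of_real (a y) * \<phi> y"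
      using vc[of y] e(4) F(1) by (simp add: leaf_incident)
    moreover have "D e y = - (of_real ((m e * s e + a x * c e) / d) * \<phi> y)"
      using d(1) Dy y by simp
    ultimately show ?thesis using True by (simp add: algebra_simps add_eq_0_iff)
  next
    case False
    then show ?thesis using vc[of v] v leaf_incident(3) by simp
  qed
  then show "partial_mode G m c s S F (a(y := a y + (m e * s e + a x * c e) / d)) \<phi> D"
    using assms unfolding partial_mode_def by blast
qed

text \<open>The inverse construction: \<open>\<phi> y = d * \<phi> x\<close> forces the value at the
  new leaf, which is nonzero if \<open>\<phi> y\<close> is.\<close>

lemma partial_mode_add_leaf:
  assumes pm: "partial_mode G m c s S F (a(y := a y + (m e * s e + a x * c e) / d)) \<phi> D"
  shows "partial_mode G m c s (insert x S) (insert e F) a (\<phi>(x := \<phi> y / of_real d))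
     (D(e := (\<lambda>v. if v = x then of_real (a x) * (\<phi> y / of_real d)
         else - (of_real (m e * s e + a x * c e) * (\<phi> y / of_real d)))))"
    (is "partial_mode _ _ _ _ _ _ _ ?\<phi> ?D")
proof -
  have xy: "x \<noteq> y" using e by blast
  have "edge_transfer (m e) (c e) (s e) (\<phi> y / of_real d) (of_real (a x) * (\<phi> y / of_real d)) (\<phi> y)
      (- (of_real (m e * s e + a x * c e) * (\<phi> y / of_real d)))"
    unfolding edge_transfer_leaf[OF m] d(2)[symmetric] using d(1) by simp
  then have "edge_transfer (m e) (c e) (s e) (?\<phi> x) (?D e x) (?\<phi> y) (?D e y)"
    using xy by simp
  then have "edge_transfer (m e) (c e) (s e) (?\<phi> (tail G e)) (?D e (tail G e)) (?\<phi> (head G e)) (?D e (head G e))"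
    by (simp only: leaf_transfer_iff)
  moreover have "edge_transfer (m f) (c f) (s f) (?\<phi> (tail G f)) (?D f (tail G f)) (?\<phi> (head G f)) (?D f (head G f))"
    if "f \<in> F" for f
  proof -
    have "f \<noteq> e" "tail G f \<noteq> x" "head G f \<noteq> x" using that F e leaf_incident(4) by blast+
    then show ?thesis using pm that unfolding partial_mode_def by simp
  qed
  moreover have "(\<Sum>f\<in>incident_arcs G v \<inter> insert e F. ?D f v) = of_real (a v) * ?\<phi> v" if v: "v \<in> insert x S" for v
  proof -
    have same: "(\<Sum>f\<in>incident_arcs G v \<inter> F. ?D f v) = (\<Sum>f\<in>incident_arcs G v \<inter> F. D f v)" for v
      by (rule sum.cong) (use leaf_incident(4) in auto)
    consider "v = x" | "v = y" | "v \<in> S" "v \<noteq> x" "v \<noteq> y" using v by blast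
    then show ?thesis
    proof cases
      case 1
      then show ?thesis by (simp add: leaf_incident(1))
    next
      case 2
      have "(\<Sum>f\<in>incident_arcs G y \<inter> F. D f y) = of_real (a y + (m e * s e + a x * c e) / d) * \<phi> y"
        using pm e(4) unfolding partial_mode_def by fastforce
      then have "(\<Sum>f\<in>incident_arcs G y \<inter> insert e F. ?D f y) =
         - (of_real (m e * s e + a x * c e) * (\<phi> y / of_real d)) + of_real (a y + (m e * s e + a x * c e) / d) * \<phi> y"
        unfolding leaf_incident(2) using F(1) leaf_incident(4) xy same[of y] by simp
      also have "\<dots> = of_real (a y) * \<phi> y" by (simp add: algebra_simps add_divide_distrib)
      finally show ?thesis using 2 xy by simp
    next
      case 3
      then show ?thesis using pm same[of v] leaf_incident(3)[of v] unfolding partial_mode_def by simp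
    qed
  qed
  ultimately show ?thesis unfolding partial_mode_def by blast
qed

end

text \<open>Induction along the leaf order. The couplings depend on \<open>k\<close> because
  elimination produces such couplings. Each elimination multiplies their bound by at most 13, which
  \<open>13 ^ card F * \<epsilon> \<le> 1/8\<close> pays for in advance. \<open>neg\<close> and
  \<open>pos\<close> are the invariants that survive elimination and become the sign change at the
  last vertex.\<close>

lemma grown_mode:
  fixes m c s :: "'e \<Rightarrow> real \<Rightarrow> real"
  assumes grown: "grown G S F"
    and k: "0 < k1" "k1 \<le> k2"
    and cont: "\<And>e. e \<in> arcs G \<Longrightarrow> continuous_on {k1..k2} (m e)"
      "\<And>e. e \<in> arcs G \<Longrightarrow> continuous_on {k1..k2} (c e)"
      "\<And>e. e \<in> arcs G \<Longrightarrow> continuous_on {k1..k2} (s e)"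
    and m: "\<And>e k. e \<in> arcs G \<Longrightarrow> k \<in> {k1..k2} \<Longrightarrow> k / 2 \<le> m e k \<and> m e k \<le> 2 * k"
    and cs: "\<And>e k. e \<in> arcs G \<Longrightarrow> k \<in> {k1..k2} \<Longrightarrow> (c e k)\<^sup>2 + (s e k)\<^sup>2 = 1"
    and c: "\<And>e k. e \<in> arcs G \<Longrightarrow> k \<in> {k1..k2} \<Longrightarrow> 1/2 \<le> c e k"
    and sgn: "\<And>e. e \<in> arcs G \<Longrightarrow> s e k1 \<le> 0 \<and> 0 \<le> s e k2"
    and s: "\<And>e k. e \<in> arcs G \<Longrightarrow> k \<in> {k1..k2} \<Longrightarrow> \<bar>s e k\<bar> \<le> \<epsilon>"
    and \<epsilon>: "0 \<le> \<epsilon>" "13 ^ card F * \<epsilon> \<le> 1/8"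
    and acont: "\<And>v. v \<in> S \<Longrightarrow> continuous_on {k1..k2} (a v)"
    and a: "\<And>v k. v \<in> S \<Longrightarrow> k \<in> {k1..k2} \<Longrightarrow> \<bar>a v k\<bar> \<le> \<epsilon> * k"
    and neg: "(\<Sum>v\<in>S. a v k1) + k1 / 4 * (\<Sum>e\<in>F. s e k1) \<le> 0"
    and pos: "0 \<le> (\<Sum>v\<in>S. a v k2) + k2 / 4 * (\<Sum>e\<in>F. s e k2)"
  shows "\<exists>k\<in>{k1..k2}. \<exists>\<phi> D.
     partial_mode G (\<lambda>e. m e k) (\<lambda>e. c e k) (\<lambda>e. s e k) S F (\<lambda>v. a v k) \<phi> D \<and> (\<forall>v\<in>S. \<phi> v \<noteq> 0) \<and>
     (\<forall>\<phi>' D'. partial_mode G (\<lambda>e. m e k) (\<lambda>e. c e k) (\<lambda>e. s e k) S F (\<lambda>v. a v k) \<phi>' D' \<longrightarrow>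
        (\<exists>z. (\<forall>v\<in>S. \<phi>' v = z * \<phi> v) \<and>
           (\<forall>e\<in>F. D' e (tail G e) = z * D e (tail G e) \<and> D' e (head G e) = z * D e (head G e))))"
  using grown s \<epsilon> acont a neg pos
proof (induction arbitrary: a \<epsilon>)
  case (root r)
  \<comment> \<open>With one vertex and no edge a nonzero mode exists precisely where the remaining
    coupling vanishes.\<close>
  have "\<exists>k\<ge>k1. k \<le> k2 \<and> a r k = 0"
    using root k by (intro IVT') auto
  then obtain k where k: "k \<in> {k1..k2}" "a r k = 0" by auto
  show ?case
    by (rule bexI[OF _ k(1)], intro exI[of _ "\<lambda>_. 1"] exI[of _ "\<lambda>_ _. 0"])
      (auto simp: partial_mode_def k(2))
next
  case (leaf S F e x y)
  note fin = grown_finite[OF leaf.hyps(1)]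
  have ends: "f \<in> arcs G \<and> tail G f \<in> S \<and> head G f \<in> S" if "f \<in> F" for f
    using grown_ends[OF leaf.hyps(1) that] by blast
  have xy: "x \<noteq> y" and eF: "e \<notin> F" using leaf.hyps ends by (auto simp: joins_def)
  define d where "d k = c e k - a x k * s e k / m e k" for k
  define t where "t k = (m e k * s e k + a x k * c e k) / d k" for k
  define a' where "a' = a(y := (\<lambda>k. a y k + t k))"
  have "13 * (13 ^ card F * \<epsilon>) \<le> 1/8"
    using leaf.prems(3) eF fin(2) by (simp add: mult_ac)
  moreover have "\<epsilon> \<le> 13 ^ card F * \<epsilon>"
    using leaf.prems(2) mult_right_mono[OF one_le_power[of "13::real" "card F"]] by fastforce
  ultimately have eps: "13 ^ card F * (13 * \<epsilon>) \<le> 1/8" "\<epsilon> \<le> 1/8"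
    using leaf.prems(2) by (simp_all add: mult_ac)
  have bounds: "0 < d k" "\<bar>t k\<bar> \<le> 12 * \<epsilon> * k" "0 \<le> s e k \<Longrightarrow> a x k + k / 4 * s e k \<le> t k"
    "s e k \<le> 0 \<Longrightarrow> t k \<le> a x k + k / 4 * s e k" if k': "k \<in> {k1..k2}" for k
    unfolding t_def d_def
    by (rule leaf_elimination_bounds[of k \<epsilon> "a x k" "s e k" "c e k" "m e k"];
        use k' k eps leaf.prems(5)[of x k] leaf.prems(1)[OF leaf.hyps(2) k'] m[OF leaf.hyps(2) k'] c[OF leaf.hyps(2) k']
          cs[OF leaf.hyps(2) k'] in auto)+
  have mnz: "m e k \<noteq> 0" if "k \<in> {k1..k2}" for k
    using m[OF leaf.hyps(2) that] k that by auto
  have dcont: "continuous_on {k1..k2} d"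
    unfolding d_def by (intro continuous_intros cont leaf.hyps leaf.prems) (use mnz in auto)
  have tcont: "continuous_on {k1..k2} t"
    unfolding t_def using bounds(1) by (intro continuous_intros cont leaf.hyps leaf.prems dcont) force+
  have sum': "(\<Sum>v\<in>S. a' v k) = (\<Sum>v\<in>S. a v k) + t k" for k
    using fin(1) leaf.hyps(4) by (simp add: a'_def sum.remove[of S y])
  have IH: "\<exists>k\<in>{k1..k2}. \<exists>\<phi> D.
     partial_mode G (\<lambda>e. m e k) (\<lambda>e. c e k) (\<lambda>e. s e k) S F (\<lambda>v. a' v k) \<phi> D \<and> (\<forall>v\<in>S. \<phi> v \<noteq> 0) \<and>
     (\<forall>\<phi>' D'. partial_mode G (\<lambda>e. m e k) (\<lambda>e. c e k) (\<lambda>e. s e k) S F (\<lambda>v. a' v k) \<phi>' D' \<longrightarrow>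
        (\<exists>z. (\<forall>v\<in>S. \<phi>' v = z * \<phi> v) \<and>
           (\<forall>e\<in>F. D' e (tail G e) = z * D e (tail G e) \<and> D' e (head G e) = z * D e (head G e))))"
  proof (rule leaf.IH[where \<epsilon>="13 * \<epsilon>"])
    show "\<bar>s f k\<bar> \<le> 13 * \<epsilon>" if "f \<in> arcs G" "k \<in> {k1..k2}" for f k
      using leaf.prems(1)[OF that] leaf.prems(2) by linarith
    show "0 \<le> 13 * \<epsilon>" using leaf.prems(2) by simp
    show "13 ^ card F * (13 * \<epsilon>) \<le> 1/8" by (rule eps)
    show "continuous_on {k1..k2} (a' v)" if "v \<in> S" for v
      using that leaf.prems(4) tcont leaf.hyps(4) by (auto simp: a'_def intro!: continuous_intros)
    \<comment> \<open>Here 13 arises: 1 for the old coupling at \<open>y\<close> plus 12 for the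
      contribution \<open>t\<close> of the leaf.\<close>
    show "\<bar>a' v k\<bar> \<le> 13 * \<epsilon> * k" if v: "v \<in> S" and k': "k \<in> {k1..k2}" for v k
    proof -
      have av: "\<bar>a v k\<bar> \<le> \<epsilon> * k" using leaf.prems(5)[of v k] v k' by blast
      have "0 \<le> \<epsilon> * k" using leaf.prems(2) k k' by simp
      then show ?thesis using av bounds(2)[OF k'] by (auto simp: a'_def)
    qed
    \<comment> \<open>The totals lose \<open>a x + k / 4 * s e\<close> and gain \<open>t\<close>. At
      \<open>k1\<close>, where the sine is at most 0, the gain does not exceed the loss; at
      \<open>k2\<close> it is at least the loss.\<close>
    have "k1 \<in> {k1..k2}" "k2 \<in> {k1..k2}" using k by auto
    then show "(\<Sum>v\<in>S. a' v k1) + k1 / 4 * (\<Sum>e\<in>F. s e k1) \<le> 0"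
      "0 \<le> (\<Sum>v\<in>S. a' v k2) + k2 / 4 * (\<Sum>e\<in>F. s e k2)"
      using bounds(4)[of k1] bounds(3)[of k2] sgn[OF leaf.hyps(2)] leaf.prems(6,7) leaf.hyps(3) eF fin
      by (simp_all add: sum' distrib_left)
  qed
  then obtain k \<phi> D where k': "k \<in> {k1..k2}"
    and pm: "partial_mode G (\<lambda>e. m e k) (\<lambda>e. c e k) (\<lambda>e. s e k) S F (\<lambda>v. a' v k) \<phi> D"
    and nz: "\<And>v. v \<in> S \<Longrightarrow> \<phi> v \<noteq> 0"
    and uniq: "\<And>\<phi>' D'. partial_mode G (\<lambda>e. m e k) (\<lambda>e. c e k) (\<lambda>e. s e k) S F (\<lambda>v. a' v k) \<phi>' D' \<Longrightarrow>
        \<exists>z. (\<forall>v\<in>S. \<phi>' v = z * \<phi> v) \<and>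
           (\<forall>e\<in>F. D' e (tail G e) = z * D e (tail G e) \<and> D' e (head G e) = z * D e (head G e))"
    by metis
  have a': "(\<lambda>v. a' v k) = (\<lambda>v. a v k)(y := a y k + (m e k * s e k + a x k * c e k) / d k)"
    by (auto simp: a'_def t_def)
  have d: "d k \<noteq> 0" using bounds(1)[OF k'] by simp
  note step = fin(2) ends leaf.hyps(2,5,3,4) mnz[OF k'] cs[OF leaf.hyps(2) k'] d d_def
  define \<phi>1 where "\<phi>1 = \<phi>(x := \<phi> y / of_real (d k))"
  define D1 where "D1 = D(e := (\<lambda>v. if v = x then of_real (a x k) * (\<phi> y / of_real (d k))
         else - (of_real (m e k * s e k + a x k * c e k) * (\<phi> y / of_real (d k)))))"
  have pm1: "partial_mode G (\<lambda>e. m e k) (\<lambda>e. c e k) (\<lambda>e. s e k) (insert x S) (insert e F) (\<lambda>v. a v k) \<phi>1 D1"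
    unfolding \<phi>1_def D1_def by (rule partial_mode_add_leaf[OF step pm[unfolded a']])
  have uniq1: "\<exists>z. (\<forall>v\<in>insert x S. \<phi>' v = z * \<phi>1 v) \<and>
           (\<forall>e\<in>insert e F. D' e (tail G e) = z * D1 e (tail G e) \<and> D' e (head G e) = z * D1 e (head G e))"
    if pm': "partial_mode G (\<lambda>e. m e k) (\<lambda>e. c e k) (\<lambda>e. s e k) (insert x S) (insert e F) (\<lambda>v. a v k) \<phi>' D'" for \<phi>' D'
  proof -
    note r = partial_mode_remove_leaf[OF step pm']
    obtain z where z: "\<forall>v\<in>S. \<phi>' v = z * \<phi> v"
      "\<forall>e\<in>F. D' e (tail G e) = z * D e (tail G e) \<and> D' e (head G e) = z * D e (head G e)"
      using uniq r(1)[folded a'] by blast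
    have x: "\<phi>' x = z * (\<phi> y / of_real (d k))" using r(2) z(1) leaf.hyps(4) d by (simp add: field_simps)
    have "D' e x = z * D1 e x" "D' e y = z * D1 e y"
      using r(3,4) xy unfolding x D1_def by (simp_all add: mult_ac)
    then have "D' e (tail G e) = z * D1 e (tail G e) \<and> D' e (head G e) = z * D1 e (head G e)"
      using leaf.hyps(5) unfolding joins_def by blast
    moreover have "\<phi>' v = z * \<phi>1 v" if "v \<in> insert x S" for v
      using that x z(1) by (auto simp: \<phi>1_def)
    moreover have "D' f (tail G f) = z * D1 f (tail G f) \<and> D' f (head G f) = z * D1 f (head G f)" if "f \<in> F" for f
      using that z(2) eF by (auto simp: D1_def)
    ultimately show ?thesis by blast
  qed
  have "\<phi>1 v \<noteq> 0" if "v \<in> insert x S" for v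
    using that nz leaf.hyps(4) d by (auto simp: \<phi>1_def)
  then show ?case using k' pm1 uniq1 by blast
qed

end

section \<open>The quadratic form on the vertices\<close>

definition other_end :: "('v, 'e) pre_digraph \<Rightarrow> 'e \<Rightarrow> 'v \<Rightarrow> 'v" where
  "other_end G e v = (if v = tail G e then head G e else tail G e)"

text \<open>For \<open>a = m cot\<close> and \<open>b = m / sin\<close> of the edge phase this is
  the Dirichlet-to-Neumann form: \<open>a e * \<phi> v - b e * \<phi> w\<close> is the outward
  derivative at \<open>v\<close> of the sinusoid with the given end values. It is evaluated on
  \<phi> vanishing outside the set \<open>V\<close> of non-Dirichlet vertices.\<close>

definition graph_form ::
  "('v, 'e) pre_digraph \<Rightarrow> 'v set \<Rightarrow> ('e \<Rightarrow> real) \<Rightarrow> ('e \<Rightarrow> real) \<Rightarrow> ('v \<Rightarrow> real) \<Rightarrow> ('v \<Rightarrow> real) \<Rightarrow> real" where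
  "graph_form G V a b \<beta> \<phi> =
     (\<Sum>e\<in>arcs G. a e * ((\<phi> (tail G e))\<^sup>2 + (\<phi> (head G e))\<^sup>2) - 2 * b e * \<phi> (tail G e) * \<phi> (head G e))
     - (\<Sum>v\<in>V. \<beta> v * (\<phi> v)\<^sup>2)"

definition unit_vectors :: "'v set \<Rightarrow> ('v \<Rightarrow> real) set" where
  "unit_vectors V = {\<phi>. (\<forall>v. v \<notin> V \<longrightarrow> \<phi> v = 0) \<and> (\<Sum>v\<in>V. (\<phi> v)\<^sup>2) = 1}"

text \<open>By the Rayleigh principle, the smallest eigenvalue of the form on functions supported in
  \<open>V\<close>.\<close>

definition lowest_form_value ::
  "('v, 'e) pre_digraph \<Rightarrow> 'v set \<Rightarrow> ('e \<Rightarrow> real) \<Rightarrow> ('e \<Rightarrow> real) \<Rightarrow> ('v \<Rightarrow> real) \<Rightarrow> real" where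
  "lowest_form_value G V a b \<beta> = Inf (graph_form G V a b \<beta> ` unit_vectors V)"

lemma unit_vectors_abs_le_1:
  assumes "finite V" "\<phi> \<in> unit_vectors V"
  shows "\<bar>\<phi> v\<bar> \<le> 1"
proof (cases "v \<in> V")
  case True
  have "(\<phi> v)\<^sup>2 \<le> (\<Sum>v\<in>V. (\<phi> v)\<^sup>2)"
    by (rule member_le_sum) (use True assms in auto)
  then have "(\<phi> v)\<^sup>2 \<le> 1" using assms by (simp add: unit_vectors_def)
  then show ?thesis by (simp add: abs_square_le_1)
qed (use assms in \<open>auto simp: unit_vectors_def\<close>)

text \<open>A closed subset of the cube of all functions into \<open>{-1..1}\<close>, which is
  compact by Tychonoff even if the vertex type is infinite.\<close>

lemma compact_unit_vectors:
  assumes "finite V"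
  shows "compact (unit_vectors V)"
proof -
  have "compactin (product_topology (\<lambda>_. euclidean) UNIV) (PiE UNIV (\<lambda>_::'a. {-1..1::real}))"
    by (auto simp: compactin_PiE)
  then have "compact (PiE UNIV (\<lambda>_::'a. {-1..1::real}))"
    by (simp add: euclidean_product_topology)
  moreover have "closed (unit_vectors V)"
  proof -
    have "unit_vectors V = (\<Inter>v\<in>-V. {\<phi>. \<phi> v = 0}) \<inter> {\<phi>. (\<Sum>v\<in>V. (\<phi> v)\<^sup>2) = 1}"
      by (auto simp: unit_vectors_def)
    also have "closed \<dots>"
      by (intro closed_Int closed_INT ballI closed_Collect_eq continuous_intros continuous_on_product_coordinates)
    finally show ?thesis .
  qed
  moreover have "unit_vectors V \<subseteq> PiE UNIV (\<lambda>_. {-1..1})"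
    using unit_vectors_abs_le_1[OF assms] by (auto simp: abs_le_iff)
  ultimately show ?thesis
    by (metis compact_Int_closed inf.absorb_iff2)
qed

lemma graph_form_scale:
  "graph_form G V (\<lambda>e. r * a e) (\<lambda>e. r * b e) (\<lambda>v. r * \<beta> v) \<phi> = r * graph_form G V a b \<beta> \<phi>"
  by (simp add: graph_form_def right_diff_distrib sum_distrib_left mult_ac)

lemma graph_form_homogeneous:
  "graph_form G V a b \<beta> (\<lambda>v. r * \<phi> v) = r\<^sup>2 * graph_form G V a b \<beta> \<phi>"
  by (simp add: graph_form_def right_diff_distrib distrib_left sum_distrib_left power_mult_distrib power2_eq_square mult_ac)

context compact_metric_graph
begin

context
  fixes V :: "'v set"
  assumes V: "finite V" "V \<noteq> {}"
begin

lemma lowest_form_value_attained: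
  shows "\<exists>\<phi>\<in>unit_vectors V. graph_form G V a b \<beta> \<phi> = lowest_form_value G V a b \<beta>"
    and "\<phi> \<in> unit_vectors V \<Longrightarrow> lowest_form_value G V a b \<beta> \<le> graph_form G V a b \<beta> \<phi>"
proof -
  obtain v where v: "v \<in> V" using V by blast
  have "(\<lambda>w. if w = v then 1 else 0) \<in> unit_vectors V"
    using v V by (auto simp: unit_vectors_def if_distrib[where f="\<lambda>x. x\<^sup>2"] cong: if_cong)
  then have ne: "unit_vectors V \<noteq> {}" by blast
  have "continuous_on (unit_vectors V) (graph_form G V a b \<beta>)"
    unfolding graph_form_def
    by (rule continuous_on_subset[OF _ subset_UNIV], intro continuous_intros continuous_on_product_coordinates)
  then obtain \<phi>0 where \<phi>0: "\<phi>0 \<in> unit_vectors V"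
    "\<And>\<phi>. \<phi> \<in> unit_vectors V \<Longrightarrow> graph_form G V a b \<beta> \<phi>0 \<le> graph_form G V a b \<beta> \<phi>"
    using continuous_attains_inf[OF compact_unit_vectors[OF V(1)] ne] by blast
  have "lowest_form_value G V a b \<beta> = graph_form G V a b \<beta> \<phi>0"
    unfolding lowest_form_value_def by (rule cInf_eq_minimum) (use \<phi>0 in auto)
  then show "\<exists>\<phi>\<in>unit_vectors V. graph_form G V a b \<beta> \<phi> = lowest_form_value G V a b \<beta>"
    and "\<phi> \<in> unit_vectors V \<Longrightarrow> lowest_form_value G V a b \<beta> \<le> graph_form G V a b \<beta> \<phi>"
    using \<phi>0 by auto
qed

lemma lowest_form_value_scale:
  assumes "0 < r"
  shows "lowest_form_value G V (\<lambda>e. r * a e) (\<lambda>e. r * b e) (\<lambda>v. r * \<beta> v) = r * lowest_form_value G V a b \<beta>"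
    (is "?L = _")
proof (rule antisym)
  obtain \<phi> where "\<phi> \<in> unit_vectors V" "graph_form G V a b \<beta> \<phi> = lowest_form_value G V a b \<beta>"
    using lowest_form_value_attained(1) by blast
  then show "?L \<le> r * lowest_form_value G V a b \<beta>"
    using lowest_form_value_attained(2)[of \<phi> "\<lambda>e. r * a e"] by (metis graph_form_scale)
  obtain \<phi> where \<phi>: "\<phi> \<in> unit_vectors V" "?L = r * graph_form G V a b \<beta> \<phi>"
    using lowest_form_value_attained(1)[of "\<lambda>e. r * a e"] by (metis graph_form_scale)
  show "r * lowest_form_value G V a b \<beta> \<le> ?L"
    unfolding \<phi>(2) using assms by (intro mult_left_mono lowest_form_value_attained(2) \<phi>(1)) simp
qed

lemma graph_form_diff_le:
  assumes "\<phi> \<in> unit_vectors V"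
  shows "graph_form G V a b \<beta> \<phi> - graph_form G V a' b' \<beta>' \<phi> \<le>
    (\<Sum>e\<in>arcs G. 2 * \<bar>a e - a' e\<bar> + 2 * \<bar>b e - b' e\<bar>) + (\<Sum>v\<in>V. \<bar>\<beta> v - \<beta>' v\<bar>)"
proof -
  have \<phi>: "\<bar>\<phi> v\<bar> \<le> 1" for v using unit_vectors_abs_le_1[OF V(1) assms] .
  then have \<phi>2: "(\<phi> v)\<^sup>2 \<le> 1" for v by (simp add: abs_square_le_1)
  have ab: "\<bar>x * y\<bar> \<le> \<bar>x\<bar> * z" if "\<bar>y\<bar> \<le> z" for x y z :: real
    unfolding abs_mult using that by (intro mult_left_mono) auto
  have 1: "(a e - a' e) * ((\<phi> (tail G e))\<^sup>2 + (\<phi> (head G e))\<^sup>2) - 2 * (b e - b' e) * \<phi> (tail G e) * \<phi> (head G e)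
     \<le> 2 * \<bar>a e - a' e\<bar> + 2 * \<bar>b e - b' e\<bar>" for e
  proof -
    have "\<bar>(a e - a' e) * ((\<phi> (tail G e))\<^sup>2 + (\<phi> (head G e))\<^sup>2)\<bar> \<le> \<bar>a e - a' e\<bar> * 2"
      using \<phi>2[of "tail G e"] \<phi>2[of "head G e"] by (intro ab) simp
    moreover have "\<bar>\<phi> (tail G e) * \<phi> (head G e)\<bar> \<le> 1"
      using mult_mono[OF \<phi> \<phi>] by (simp add: abs_mult)
    then have "\<bar>(b e - b' e) * (\<phi> (tail G e) * \<phi> (head G e))\<bar> \<le> \<bar>b e - b' e\<bar> * 1"
      by (rule ab)
    moreover have "2 * (b e - b' e) * \<phi> (tail G e) * \<phi> (head G e) = 2 * ((b e - b' e) * (\<phi> (tail G e) * \<phi> (head G e)))"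
      by (simp only: mult.assoc)
    ultimately show ?thesis unfolding abs_le_iff by linarith
  qed
  have 2: "- (\<beta> v - \<beta>' v) * (\<phi> v)\<^sup>2 \<le> \<bar>\<beta> v - \<beta>' v\<bar>" for v
  proof -
    have "\<bar>(\<beta> v - \<beta>' v) * (\<phi> v)\<^sup>2\<bar> \<le> \<bar>\<beta> v - \<beta>' v\<bar> * 1" using \<phi>2[of v] by (intro ab) simp
    then show ?thesis unfolding abs_le_iff mult_minus_left mult_1_right by blast
  qed
  have "graph_form G V a b \<beta> \<phi> - graph_form G V a' b' \<beta>' \<phi> =
    (\<Sum>e\<in>arcs G. (a e - a' e) * ((\<phi> (tail G e))\<^sup>2 + (\<phi> (head G e))\<^sup>2) - 2 * (b e - b' e) * \<phi> (tail G e) * \<phi> (head G e))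
    + (\<Sum>v\<in>V. - (\<beta> v - \<beta>' v) * (\<phi> v)\<^sup>2)"
    unfolding graph_form_def
    by (simp add: sum_subtractf sum_negf algebra_simps sum.distrib)
  also have "\<dots> \<le> (\<Sum>e\<in>arcs G. 2 * \<bar>a e - a' e\<bar> + 2 * \<bar>b e - b' e\<bar>) + (\<Sum>v\<in>V. \<bar>\<beta> v - \<beta>' v\<bar>)"
    by (intro add_mono sum_mono 1 2)
  finally show ?thesis .
qed

text \<open>Testing the first form with a minimiser of the second. Used in both directions, this is
  Lipschitz dependence on the coefficients and replaces any continuity theory for
  eigenvalues.\<close>

lemma lowest_form_value_diff_le:
  "lowest_form_value G V a b \<beta> - lowest_form_value G V a' b' \<beta>' \<le>
    (\<Sum>e\<in>arcs G. 2 * \<bar>a e - a' e\<bar> + 2 * \<bar>b e - b' e\<bar>) + (\<Sum>v\<in>V. \<bar>\<beta> v - \<beta>' v\<bar>)"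
proof -
  obtain \<phi> where \<phi>: "\<phi> \<in> unit_vectors V" "graph_form G V a' b' \<beta>' \<phi> = lowest_form_value G V a' b' \<beta>'"
    using lowest_form_value_attained(1) by blast
  show ?thesis
    using lowest_form_value_attained(2)[OF \<phi>(1), of a b \<beta>] graph_form_diff_le[OF \<phi>(1), of a b \<beta> a' b' \<beta>'] \<phi>(2)
    by linarith
qed

lemma tendsto_lowest_form_value:
  assumes a: "\<And>e. e \<in> arcs G \<Longrightarrow> ((\<lambda>n. a n e) \<longlongrightarrow> a' e) X" and b: "\<And>e. e \<in> arcs G \<Longrightarrow> ((\<lambda>n. b n e) \<longlongrightarrow> b' e) X"
    and \<beta>: "\<And>v. v \<in> V \<Longrightarrow> ((\<lambda>n. \<beta> n v) \<longlongrightarrow> \<beta>' v) X"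
  shows "((\<lambda>n. lowest_form_value G V (a n) (b n) (\<beta> n)) \<longlongrightarrow> lowest_form_value G V a' b' \<beta>') X"
proof -
  let ?d = "\<lambda>n. (\<Sum>e\<in>arcs G. 2 * \<bar>a n e - a' e\<bar> + 2 * \<bar>b n e - b' e\<bar>) + (\<Sum>v\<in>V. \<bar>\<beta> n v - \<beta>' v\<bar>)"
  have "(?d \<longlongrightarrow> (\<Sum>e\<in>arcs G. 2 * \<bar>a' e - a' e\<bar> + 2 * \<bar>b' e - b' e\<bar>) + (\<Sum>v\<in>V. \<bar>\<beta>' v - \<beta>' v\<bar>)) X"
    by (intro tendsto_intros a b \<beta>)
  then have d: "(?d \<longlongrightarrow> 0) X" by simp
  have "((\<lambda>n. lowest_form_value G V (a n) (b n) (\<beta> n) - lowest_form_value G V a' b' \<beta>') \<longlongrightarrow> 0) X"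
  proof (rule Lim_null_comparison[OF always_eventually d], intro allI)
    fix n
    show "norm (lowest_form_value G V (a n) (b n) (\<beta> n) - lowest_form_value G V a' b' \<beta>') \<le> ?d n"
      using lowest_form_value_diff_le[of "a n" "b n" "\<beta> n" a' b' \<beta>']
        lowest_form_value_diff_le[of a' b' \<beta>' "a n" "b n" "\<beta> n"]
      by (simp add: abs_le_iff abs_minus_commute)
  qed
  then show ?thesis by (simp add: LIM_zero_iff)
qed

text \<open>The exact second-order expansion at one vertex. The linear term contains the vertex
  condition; at \<open>\<phi> = 0\<close> and \<open>t = 1\<close> the formula gives a diagonal
  entry.\<close>

lemma graph_form_perturb_vertex:
  assumes v: "v \<in> V"
  shows "graph_form G V a b \<beta> (\<phi>(v := \<phi> v + t)) = graph_form G V a b \<beta> \<phi> +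
    2 * t * ((\<Sum>e\<in>incident_arcs G v. a e * \<phi> v - b e * \<phi> (other_end G e v)) - \<beta> v * \<phi> v) +
    t\<^sup>2 * ((\<Sum>e\<in>incident_arcs G v. a e) - \<beta> v)"
proof -
  let ?q = "\<lambda>\<phi> e. a e * ((\<phi> (tail G e))\<^sup>2 + (\<phi> (head G e))\<^sup>2) - 2 * b e * \<phi> (tail G e) * \<phi> (head G e)"
  let ?\<psi> = "\<phi>(v := \<phi> v + t)"
  have "(\<Sum>e\<in>arcs G. ?q ?\<psi> e) - (\<Sum>e\<in>arcs G. ?q \<phi> e) = (\<Sum>e\<in>arcs G. ?q ?\<psi> e - ?q \<phi> e)"
    by (rule sum_subtractf[symmetric])
  also have "\<dots> = (\<Sum>e\<in>incident_arcs G v. ?q ?\<psi> e - ?q \<phi> e)"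
    by (rule sum.mono_neutral_right) (auto simp: mem_incident_arcs)
  also have "\<dots> = (\<Sum>e\<in>incident_arcs G v. 2 * t * (a e * \<phi> v - b e * \<phi> (other_end G e v)) + t\<^sup>2 * a e)"
  proof (rule sum.cong)
    fix e assume "e \<in> incident_arcs G v"
    then have e: "e \<in> arcs G" "v = tail G e \<or> v = head G e" by (auto simp: mem_incident_arcs)
    show "?q ?\<psi> e - ?q \<phi> e = 2 * t * (a e * \<phi> v - b e * \<phi> (other_end G e v)) + t\<^sup>2 * a e"
      using e(2) no_loops[OF e(1)] no_loops[OF e(1), symmetric]
      by (auto simp: other_end_def algebra_simps power2_eq_square)
  qed simp
  also have "\<dots> = 2 * t * (\<Sum>e\<in>incident_arcs G v. a e * \<phi> v - b e * \<phi> (other_end G e v)) + t\<^sup>2 * (\<Sum>e\<in>incident_arcs G v. a e)"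
    by (simp add: sum.distrib sum_distrib_left)
  finally have 1: "(\<Sum>e\<in>arcs G. ?q ?\<psi> e) = (\<Sum>e\<in>arcs G. ?q \<phi> e) +
    (2 * t * (\<Sum>e\<in>incident_arcs G v. a e * \<phi> v - b e * \<phi> (other_end G e v)) + t\<^sup>2 * (\<Sum>e\<in>incident_arcs G v. a e))"
    by linarith
  have "(\<Sum>w\<in>V. \<beta> w * (?\<psi> w)\<^sup>2) = \<beta> v * (\<phi> v + t)\<^sup>2 + (\<Sum>w\<in>V - {v}. \<beta> w * (\<phi> w)\<^sup>2)"
    using V v by (subst sum.remove[of V v]) auto
  also have "\<dots> = (\<Sum>w\<in>V. \<beta> w * (\<phi> w)\<^sup>2) + (2 * t * (\<beta> v * \<phi> v) + t\<^sup>2 * \<beta> v)"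
    using sum.remove[OF V(1) v, of "\<lambda>w. \<beta> w * (\<phi> w)\<^sup>2"] by (simp add: power2_eq_square algebra_simps)
  finally show ?thesis
    unfolding graph_form_def 1 by (simp add: algebra_simps)
qed

lemma graph_form_nonneg:
  assumes "0 \<le> lowest_form_value G V a b \<beta>" "\<And>v. v \<notin> V \<Longrightarrow> \<phi> v = 0"
  shows "0 \<le> graph_form G V a b \<beta> \<phi>"
proof (cases "(\<Sum>v\<in>V. (\<phi> v)\<^sup>2) = 0")
  case True
  then have "\<phi> v = 0" for v
    using assms(2) V(1) by (cases "v \<in> V") (auto simp: sum_nonneg_eq_0_iff)
  then show ?thesis by (simp add: graph_form_def)
next
  case False
  define r where "r = sqrt (\<Sum>v\<in>V. (\<phi> v)\<^sup>2)"
  have "0 < (\<Sum>v\<in>V. (\<phi> v)\<^sup>2)" using False by (simp add: sum_nonneg less_le)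
  then have r: "0 < r" "r\<^sup>2 = (\<Sum>v\<in>V. (\<phi> v)\<^sup>2)" by (simp_all add: r_def)
  have "(\<Sum>v\<in>V. (1 / r * \<phi> v)\<^sup>2) = (\<Sum>v\<in>V. (\<phi> v)\<^sup>2) / r\<^sup>2"
    by (simp add: power_mult_distrib power_divide sum_divide_distrib)
  then have "(\<lambda>v. 1 / r * \<phi> v) \<in> unit_vectors V"
    using r False assms(2) by (simp add: unit_vectors_def)
  from lowest_form_value_attained(2)[OF this, of a b \<beta>] assms(1)
  have "0 \<le> (1 / r)\<^sup>2 * graph_form G V a b \<beta> \<phi>" unfolding graph_form_homogeneous by linarith
  then show ?thesis using r(1) by (simp add: zero_le_mult_iff)
qed

text \<open>A null vector of a nonnegative form is a critical point, so the linear term of the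
  expansion vanishes.\<close>

lemma graph_form_stationary:
  assumes nonneg: "0 \<le> lowest_form_value G V a b \<beta>" and \<phi>: "\<And>v. v \<notin> V \<Longrightarrow> \<phi> v = 0"
    and null: "graph_form G V a b \<beta> \<phi> = 0" and v: "v \<in> V"
  shows "(\<Sum>e\<in>incident_arcs G v. a e * \<phi> v - b e * \<phi> (other_end G e v)) = \<beta> v * \<phi> v"
proof -
  define L where "L = (\<Sum>e\<in>incident_arcs G v. a e * \<phi> v - b e * \<phi> (other_end G e v)) - \<beta> v * \<phi> v"
  define M where "M = (\<Sum>e\<in>incident_arcs G v. a e) - \<beta> v"
  define n where "n = \<bar>M\<bar> + 1"
  have n: "0 < n" "M \<le> n" by (auto simp: n_def)
  have "0 \<le> 2 * t * L + t\<^sup>2 * M" for t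
    using graph_form_nonneg[OF nonneg, of "\<phi>(v := \<phi> v + t)"] \<phi> v null
    unfolding graph_form_perturb_vertex[OF v] L_def M_def by fastforce
  \<comment> \<open>This \<open>t\<close> minimises \<open>2 * t * L + t\<^sup>2 * n\<close>;
    replacing \<open>M\<close> by the larger \<open>n\<close> ensures a positive leading
    coefficient.\<close>
  from this[of "- L / n"] have "0 \<le> 2 * (- L / n) * L + (- L / n)\<^sup>2 * M" .
  also have "\<dots> \<le> 2 * (- L / n) * L + (- L / n)\<^sup>2 * n"
    using n by (intro add_left_mono mult_left_mono) auto
  also have "\<dots> = - (L\<^sup>2 / n)" using n by (simp add: field_simps power2_eq_square)
  finally have "L\<^sup>2 / n \<le> 0" by simp
  then have "L = 0" using n by (simp add: divide_le_0_iff)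
  then show ?thesis by (simp add: L_def)
qed

end

text \<open>A Perron-Frobenius argument. Zeros spread from a free vertex to its neighbours; the
  degree condition keeps Dirichlet vertices, where \<phi> must vanish, from separating the free
  ones.\<close>

lemma positive_null_vector:
  assumes con: "Digraph_Component.connected G" and VD: "VD \<subseteq> verts G"
    and deg: "\<And>v. v \<in> VD \<Longrightarrow> vertex_degree G v = 1" and ne: "verts G - VD \<noteq> {}"
    and low: "lowest_form_value G (verts G - VD) a b \<beta> = 0"
    and b: "\<And>e. e \<in> arcs G \<Longrightarrow> 0 < b e"
  shows "\<exists>\<phi>. (\<forall>v\<in>verts G - VD. 0 < \<phi> v) \<and> (\<forall>v. v \<notin> verts G - VD \<longrightarrow> \<phi> v = 0) \<and>
    (\<forall>v\<in>verts G - VD. (\<Sum>e\<in>incident_arcs G v. a e * \<phi> v - b e * \<phi> (other_end G e v)) = \<beta> v * \<phi> v)"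
proof -
  define V where "V = verts G - VD"
  have V: "finite V" "V \<noteq> {}" using ne by (auto simp: V_def)
  note low = low[folded V_def]
  obtain \<phi>0 where \<phi>0: "\<phi>0 \<in> unit_vectors V" "graph_form G V a b \<beta> \<phi>0 = 0"
    using lowest_form_value_attained(1)[OF V, of a b \<beta>] low by metis
  define \<phi> where "\<phi> v = \<bar>\<phi>0 v\<bar>" for v
  have \<phi>: "\<phi> \<in> unit_vectors V" using \<phi>0(1) by (simp add: unit_vectors_def \<phi>_def)
  have nn: "0 \<le> \<phi> v" for v by (simp add: \<phi>_def)
  have out: "\<phi> v = 0" if "v \<notin> V" for v using \<phi> that by (simp add: unit_vectors_def)
  have "graph_form G V a b \<beta> \<phi> \<le> graph_form G V a b \<beta> \<phi>0"
    unfolding graph_form_def \<phi>_def power2_abs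
  proof (intro diff_mono sum_mono order_refl)
    fix e assume "e \<in> arcs G"
    then have "b e * (\<phi>0 (tail G e) * \<phi>0 (head G e)) \<le> b e * (\<bar>\<phi>0 (tail G e)\<bar> * \<bar>\<phi>0 (head G e)\<bar>)"
      using b[of e] by (intro mult_left_mono) (auto simp flip: abs_mult)
    then show "2 * b e * \<bar>\<phi>0 (tail G e)\<bar> * \<bar>\<phi>0 (head G e)\<bar> \<ge> 2 * b e * \<phi>0 (tail G e) * \<phi>0 (head G e)"
      by (simp add: mult.assoc)
  qed
  then have null: "graph_form G V a b \<beta> \<phi> = 0"
    using graph_form_nonneg[OF V, of a b \<beta> \<phi>] low out \<phi>0(2) by simp
  have stat: "(\<Sum>e\<in>incident_arcs G v. a e * \<phi> v - b e * \<phi> (other_end G e v)) = \<beta> v * \<phi> v" if "v \<in> V" for v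
    using graph_form_stationary[OF V _ out null that] low by simp
  \<comment> \<open>At a free zero the stationarity equation reduces to a vanishing sum of
    nonnegative terms \<open>b e * \<phi> (other_end G e v)\<close>.\<close>
  have spread: "\<phi> (other_end G e v) = 0" if v: "v \<in> V" "\<phi> v = 0" and e: "e \<in> incident_arcs G v" for v e
  proof -
    have "(\<Sum>e\<in>incident_arcs G v. b e * \<phi> (other_end G e v)) = 0"
      using stat[OF v(1)] v(2) by (simp add: sum_negf)
    moreover have "0 \<le> b e * \<phi> (other_end G e v)" if "e \<in> incident_arcs G v" for e
      using that b[of e] nn by (simp add: mem_incident_arcs)
    ultimately have "b e * \<phi> (other_end G e v) = 0"
      using e finite_incident_arcs by (subst (asm) sum_nonneg_eq_0_iff) auto
    then show ?thesis using b[of e] e by (simp add: mem_incident_arcs)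
  qed
  have "\<exists>w\<in>V. \<phi> w \<noteq> 0"
  proof (rule ccontr)
    assume "\<not> ?thesis"
    then have "(\<Sum>v\<in>V. (\<phi> v)\<^sup>2) = 0" by simp
    then show False using \<phi> by (simp add: unit_vectors_def)
  qed
  then obtain w where w: "w \<in> V" "\<phi> w \<noteq> 0" by blast
  \<comment> \<open>Dirichlet vertices next to a nonzero value are included so that a crossing arc
    can leave \<open>S\<close> only towards a free zero. From such a Dirichlet vertex no arc leaves
    \<open>S\<close>, as its only arc leads to the nonzero value.\<close>
  define S where "S = {v\<in>verts G. \<phi> v \<noteq> 0 \<or> (v \<in> VD \<and> (\<exists>e\<in>incident_arcs G v. \<phi> (other_end G e v) \<noteq> 0))}"
  have "S = verts G"
  proof (rule ccontr)
    assume "S \<noteq> verts G"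
    moreover have "S \<noteq> {}" "S \<subseteq> verts G" using w by (auto simp: S_def V_def)
    ultimately obtain e where e: "e \<in> arcs G" "(tail G e \<in> S) \<noteq> (head G e \<in> S)"
      using connected_crossing_arc[OF con] by blast
    then obtain x y where xy: "x \<in> S" "y \<notin> S" "x \<in> verts G" "y \<in> verts G" "e \<in> incident_arcs G x"
      "e \<in> incident_arcs G y" "other_end G e x = y" "other_end G e y = x"
      by (cases "tail G e \<in> S") (auto simp: mem_incident_arcs other_end_def no_loops intro: that)
    have y0: "\<phi> y = 0" using xy by (auto simp: S_def)
    show False
    proof (cases "\<phi> x = 0")
      case True
      then obtain f where f: "x \<in> VD" "f \<in> incident_arcs G x" "\<phi> (other_end G f x) \<noteq> 0"
        using xy(1) by (auto simp: S_def)
      have "card (incident_arcs G x) = 1" using deg[OF f(1)] by (simp add: vertex_degree_def)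
      then have "f = e" using f(2) xy(5) by (metis card_1_singletonE singletonD)
      then show False using f(3) xy(7) y0 by simp
    next
      case False
      then have "y \<in> V" using xy by (auto simp: S_def V_def)
      then show False using spread[OF _ y0 xy(6)] xy(8) False by simp
    qed
  qed
  then have "0 < \<phi> v" if "v \<in> V" for v
    using that nn[of v] by (auto simp: S_def V_def less_le)
  then show ?thesis using stat out unfolding V_def by blast
qed

end

section \<open>Recurrence of the phases\<close>

lemma abs_sin_diff_le: "\<bar>sin x - sin y\<bar> \<le> \<bar>x - y\<bar>" for x y :: real
proof -
  have "\<bar>sin x - sin y\<bar> = 2 * \<bar>sin ((x - y) / 2)\<bar> * \<bar>cos ((x + y) / 2)\<bar>"
    by (simp add: sin_diff_sin abs_mult)
  also have "\<dots> \<le> 2 * \<bar>(x - y) / 2\<bar> * 1"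
    by (intro mult_mono abs_sin_x_le_abs_x abs_cos_le_one) auto
  finally show ?thesis by simp
qed

lemma abs_cos_diff_le: "\<bar>cos x - cos y\<bar> \<le> \<bar>x - y\<bar>" for x y :: real
  using abs_sin_diff_le[of "pi / 2 - x" "pi / 2 - y"] by (simp add: cos_sin_eq abs_minus_commute)

lemma simultaneous_recurrence:
  fixes l :: "'e \<Rightarrow> real"
  assumes "finite A"
  shows "\<exists>\<kappa> :: nat \<Rightarrow> real. filterlim \<kappa> at_top sequentially \<and>
    (\<forall>e\<in>A. (\<lambda>n. cos (\<kappa> n * l e)) \<longlonglongrightarrow> 1 \<and> (\<lambda>n. sin (\<kappa> n * l e)) \<longlonglongrightarrow> 0)"
proof -
  obtain h where h: "bij_betw h {0..<card A} A"
    using ex_bij_betw_nat_finite[OF assms] by blast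
  have "\<exists>\<kappa>\<ge>real n. \<exists>p. \<forall>e\<in>A. \<bar>\<kappa> * l e - 2 * pi * of_int (p e)\<bar> \<le> 2 * pi / real (Suc n)" for n
  proof -
    let ?N = "Suc n"
    \<comment> \<open>Dirichlet's theorem guarantees only \<open>q \<ge> 1\<close>. Multiplying the
      lengths by \<open>?N\<close> beforehand makes \<open>q * ?N\<close> a recurrence time that
      tends to infinity.\<close>
    obtain q p where q: "0 < q" and p: "\<And>i. i < card A \<Longrightarrow>
        \<bar>of_int q * (real ?N * l (h i) / (2 * pi)) - of_int (p i)\<bar> < 1 / real ?N"
      using Dirichlet_approx_simult[where N="?N" and n="card A" and \<theta>="\<lambda>i. real ?N * l (h i) / (2 * pi)"]
      by (metis zero_less_Suc)
    define p' where "p' e = p (inv_into {0..<card A} h e)" for e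
    show ?thesis
    proof (intro exI[of _ "of_int q * real ?N"] exI[of _ p'] conjI ballI)
      have "1 * real n \<le> of_int q * real ?N" using q by (intro mult_mono) auto
      then show "real n \<le> of_int q * real ?N" by simp
      fix e assume e: "e \<in> A"
      define i where "i = inv_into {0..<card A} h e"
      have i: "i < card A" "h i = e"
        using e h inv_into_into[of e h "{0..<card A}"] f_inv_into_f[of e h "{0..<card A}"]
        by (auto simp: i_def bij_betw_def)
      have "of_int q * real ?N * l e - 2 * pi * of_int (p' e) =
          2 * pi * (of_int q * (real ?N * l e / (2 * pi)) - of_int (p i))"
        by (simp add: p'_def i_def right_diff_distrib)
      then have "\<bar>of_int q * real ?N * l e - 2 * pi * of_int (p' e)\<bar> =
          2 * pi * \<bar>of_int q * (real ?N * l e / (2 * pi)) - of_int (p i)\<bar>"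
        by (simp only: abs_mult) simp
      also have "\<dots> \<le> 2 * pi * (1 / real ?N)"
        using p[OF i(1)] i(2) by (intro mult_left_mono) (auto intro: less_imp_le)
      finally show "\<bar>of_int q * real ?N * l e - 2 * pi * of_int (p' e)\<bar> \<le> 2 * pi / real ?N" by simp
    qed
  qed
  then obtain \<kappa> p where \<kappa>: "\<And>n. real n \<le> \<kappa> n"
    and p: "\<And>n e. e \<in> A \<Longrightarrow> \<bar>\<kappa> n * l e - 2 * pi * of_int (p n e)\<bar> \<le> 2 * pi / real (Suc n)"
    by metis
  have "filterlim \<kappa> at_top sequentially"
    by (rule filterlim_at_top_mono[OF filterlim_real_sequentially]) (use \<kappa> in auto)
  moreover have "(\<lambda>n. cos (\<kappa> n * l e)) \<longlonglongrightarrow> 1 \<and> (\<lambda>n. sin (\<kappa> n * l e)) \<longlonglongrightarrow> 0" if e: "e \<in> A" for e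
  proof -
    let ?x = "\<lambda>n. \<kappa> n * l e - 2 * pi * of_int (p n e)"
    have "(\<lambda>n. 2 * pi / real (Suc n)) \<longlonglongrightarrow> 0" by real_asymp
    then have x: "?x \<longlonglongrightarrow> 0"
      by (rule Lim_null_comparison[rotated]) (use p[OF e] in auto)
    have "cos (\<kappa> n * l e) = cos (?x n)" "sin (\<kappa> n * l e) = sin (?x n)" for n
      by (simp_all add: cos_diff sin_diff)
    then show ?thesis using tendsto_cos[OF x] tendsto_sin[OF x] by simp
  qed
  ultimately show ?thesis by blast
qed

definition edge_freq :: "('e \<Rightarrow> real) \<Rightarrow> 'e \<Rightarrow> real \<Rightarrow> real" where
  "edge_freq q e k = sqrt (k\<^sup>2 - q e)"

text \<open>Near a recurrence time \<open>\<kappa>\<close> the phases at wave number \<open>\<kappa> + s\<close> are those of the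
  potential-free graph at the low wave number \<open>s\<close>.\<close>

definition low_phase_approx ::
  "('e \<Rightarrow> real) \<Rightarrow> ('e \<Rightarrow> real) \<Rightarrow> real \<Rightarrow> real \<Rightarrow> real \<Rightarrow> 'e \<Rightarrow> bool" where
  "low_phase_approx len q r k s e \<longleftrightarrow>
     \<bar>sin (edge_freq q e k * len e) - sin (s * len e)\<bar> < r \<and>
     \<bar>cos (edge_freq q e k * len e) - cos (s * len e)\<bar> < r \<and>
     \<bar>edge_freq q e k / k - 1\<bar> < r \<and> q e < k\<^sup>2"

text \<open>From \<open>(k - \<mu>) * (k + \<mu>) = q e\<close> the potential shifts the frequency
  by at most \<open>\<bar>q e\<bar> / k\<close>. The addition theorems then separate \<kappa> from
  \<open>s\<close>, uniformly for \<open>s\<close> in the window.\<close>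

lemma low_phase_approx_eventually:
  fixes len :: "'e \<Rightarrow> real"
  assumes \<kappa>: "filterlim \<kappa> at_top sequentially"
    and c: "(\<lambda>n. cos (\<kappa> n * len e)) \<longlonglongrightarrow> 1" and s: "(\<lambda>n. sin (\<kappa> n * len e)) \<longlonglongrightarrow> 0" and r: "0 < r"
  shows "eventually (\<lambda>n. \<forall>s\<in>{s1..s2}. low_phase_approx len q r (\<kappa> n + s) s e) sequentially"
proof -
  \<comment> \<open>The first two entries give \<open>q e < k\<^sup>2\<close>, the third a phase
    shift below \<open>r/3\<close>, the last \<open>\<bar>\<mu> / k - 1\<bar> < r\<close>. The
    remaining \<open>2 * r / 3\<close> is left for the recurrence error.\<close>
  define K where "K = max 1 (max \<bar>q e\<bar> (max (3 * \<bar>q e * len e\<bar> / r) (\<bar>q e\<bar> / r)))"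
  have "eventually (\<lambda>n. K + \<bar>s1\<bar> < \<kappa> n) sequentially"
    using \<kappa> by (simp add: filterlim_at_top_dense)
  moreover have "eventually (\<lambda>n. dist (cos (\<kappa> n * len e)) 1 < r/3) sequentially"
    by (rule tendstoD[OF c]) (use r in simp)
  moreover have "eventually (\<lambda>n. dist (sin (\<kappa> n * len e)) 0 < r/3) sequentially"
    by (rule tendstoD[OF s]) (use r in simp)
  ultimately show ?thesis
  proof eventually_elim
    case (elim n)
    show ?case
    proof
      fix s assume s: "s \<in> {s1..s2}"
      define k where "k = \<kappa> n + s"
      define \<mu> where "\<mu> = edge_freq q e k"
      have k: "K < k" using elim(1) s by (auto simp: k_def)
      then have k': "1 < k" "\<bar>q e\<bar> < k" "3 * \<bar>q e * len e\<bar> / r < k" "\<bar>q e\<bar> / r < k"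
        by (simp_all add: K_def)
      have "k * 1 \<le> k * k" using k'(1) by (intro mult_left_mono) auto
      then have q: "q e < k\<^sup>2" using k'(2) by (simp add: power2_eq_square)
      have \<mu>: "0 \<le> \<mu>" "\<mu>\<^sup>2 = k\<^sup>2 - q e" using q by (simp_all add: \<mu>_def edge_freq_def)
      have "(k - \<mu>) * (k + \<mu>) = q e" using \<mu>(2) by (simp add: power2_eq_square algebra_simps)
      then have "\<bar>k - \<mu>\<bar> * (k + \<mu>) = \<bar>q e\<bar>" using \<mu>(1) k'(1) by (metis abs_mult abs_of_nonneg add_nonneg_nonneg less_imp_le less_trans zero_less_one)
      moreover have "\<bar>k - \<mu>\<bar> * k \<le> \<bar>k - \<mu>\<bar> * (k + \<mu>)" using \<mu>(1) by (intro mult_left_mono) auto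
      ultimately have d: "\<bar>k - \<mu>\<bar> * k \<le> \<bar>q e\<bar>" by simp
      have d2: "\<bar>\<mu> * len e - k * len e\<bar> < r/3"
      proof -
        have "\<bar>\<mu> * len e - k * len e\<bar> * k = (\<bar>k - \<mu>\<bar> * k) * \<bar>len e\<bar>"
          by (simp add: left_diff_distrib[symmetric] abs_mult abs_minus_commute mult_ac)
        also have "\<dots> \<le> \<bar>q e * len e\<bar>" using d by (simp add: abs_mult mult_right_mono)
        also have "\<dots> < r/3 * k" using k'(3) r by (simp add: field_simps)
        finally show ?thesis using k'(1) by simp
      qed
      have "\<bar>k - \<mu>\<bar> \<le> \<bar>k - \<mu>\<bar> * k" using k'(1) by (simp add: mult_le_cancel_left1)
      then have "\<bar>k - \<mu>\<bar> < r * k" using d k'(4) r by (simp add: field_simps)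
      moreover have "\<bar>\<mu> / k - 1\<bar> = \<bar>k - \<mu>\<bar> / k"
      proof -
        have "\<mu> / k - 1 = (\<mu> - k) / k" using k'(1) by (simp add: diff_divide_distrib)
        then show ?thesis using k'(1) by (simp add: abs_minus_commute)
      qed
      ultimately have m: "\<bar>\<mu> / k - 1\<bar> < r" using k'(1) by (simp add: pos_divide_less_eq)
      let ?s = "sin (\<kappa> n * len e)" and ?c = "cos (\<kappa> n * len e)"
      have cs: "\<bar>?c - 1\<bar> < r/3" "\<bar>?s\<bar> < r/3" using elim by (auto simp: dist_real_def)
      have le: "\<bar>x * y\<bar> \<le> \<bar>x\<bar>" if "\<bar>y\<bar> \<le> 1" for x y :: real
        using that by (simp add: abs_mult mult_left_le)
      have "sin (k * len e) - sin (s * len e) = ?s * cos (s * len e) + (?c - 1) * sin (s * len e)"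
        by (simp add: k_def distrib_right sin_add left_diff_distrib)
      then have s': "\<bar>sin (k * len e) - sin (s * len e)\<bar> < 2 * r / 3"
        using le[OF abs_cos_le_one, of ?s "s * len e"] le[OF abs_sin_le_one, of "?c - 1" "s * len e"] cs by linarith
      have "cos (k * len e) - cos (s * len e) = (?c - 1) * cos (s * len e) - ?s * sin (s * len e)"
        by (simp add: k_def distrib_right cos_add left_diff_distrib)
      then have c': "\<bar>cos (k * len e) - cos (s * len e)\<bar> < 2 * r / 3"
        using le[OF abs_cos_le_one, of "?c - 1" "s * len e"] le[OF abs_sin_le_one, of ?s "s * len e"] cs by linarith
      show "low_phase_approx len q r (\<kappa> n + s) s e"
        unfolding low_phase_approx_def k_def[symmetric] \<mu>_def[symmetric]
        using s' c' d2 m q abs_sin_diff_le[of "\<mu> * len e" "k * len e"] abs_cos_diff_le[of "\<mu> * len e" "k * len e"]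
        by linarith
    qed
  qed
qed

context compact_metric_graph
begin

text \<open>A single sequence \<kappa> serves all tolerances and windows, so limits along it can be
  taken before the tolerance is chosen.\<close>

lemma recurrence_windows:
  "\<exists>\<kappa> :: nat \<Rightarrow> real. filterlim \<kappa> at_top sequentially \<and> (\<forall>r s1 s2 q. 0 < r \<longrightarrow>
      eventually (\<lambda>n. \<forall>e\<in>arcs G. \<forall>s\<in>{s1..s2}. low_phase_approx len q r (\<kappa> n + s) s e) sequentially)"
proof -
  obtain \<kappa> :: "nat \<Rightarrow> real" where \<kappa>: "filterlim \<kappa> at_top sequentially"
    "\<And>e. e \<in> arcs G \<Longrightarrow> (\<lambda>n. cos (\<kappa> n * len e)) \<longlonglongrightarrow> 1 \<and> (\<lambda>n. sin (\<kappa> n * len e)) \<longlonglongrightarrow> 0"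
    using simultaneous_recurrence[OF finite_arcs, of len] by blast
  have "eventually (\<lambda>n. \<forall>e\<in>arcs G. \<forall>s\<in>{s1..s2}. low_phase_approx len q r (\<kappa> n + s) s e) sequentially"
    if "0 < r" for r s1 s2 q
    by (intro eventually_ball_finite[OF finite_arcs] ballI low_phase_approx_eventually)
      (use \<kappa> that in auto)
  then show ?thesis using \<kappa>(1) by blast
qed

lemma continuous_on_edge_freq: "continuous_on X (edge_freq q e)"
  unfolding edge_freq_def by (intro continuous_intros)

lemma edge_freq_pos: "q e < k\<^sup>2 \<Longrightarrow> 0 < edge_freq q e k \<and> (edge_freq q e k)\<^sup>2 = k\<^sup>2 - q e"
  by (simp add: edge_freq_def)

text \<open>Needed because \<open>vanishes_at\<close> would hold vacuously at an isolated
  vertex.\<close>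

lemma incident_arcs_nonempty:
  assumes con: "Digraph_Component.connected G" and v: "v \<in> verts G"
  shows "incident_arcs G v \<noteq> {}"
proof -
  obtain e where e: "e \<in> arcs G" using arcs_nonempty by blast
  have "{v} \<noteq> verts G" using no_loops[OF e] tail_in_verts[OF e] head_in_verts[OF e] by (metis singletonD)
  then obtain f where "f \<in> arcs G" "(tail G f \<in> {v}) \<noteq> (head G f \<in> {v})"
    using connected_crossing_arc[OF con, of "{v}"] v by blast
  then have "f \<in> incident_arcs G v" by (auto simp: mem_incident_arcs)
  then show ?thesis by blast
qed

text \<open>For a late recurrence time the interval from \<open>\<kappa> n - h\<close> to
  \<open>\<kappa> n + h\<close> satisfies the hypotheses of \<open>grown_mode\<close>; the constants
  below distribute the errors among them.\<close>

lemma tree_generic_eigenfunction: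
  assumes tree: "undirected_tree G"
  shows "\<exists>z>T. \<exists>\<psi>. eigenvalue_multiplicity G len {} \<alpha> q (of_real z) = 1 \<and>
    eigenfunction G len {} \<alpha> q (of_real z) \<psi> \<and> (\<forall>v\<in>verts G. \<not> vanishes_at G len \<psi> v)"
proof -
  have con: "Digraph_Component.connected G" using tree by (simp add: undirected_tree_def)
  obtain e0 where e0: "e0 \<in> arcs G" using arcs_nonempty by blast
  define L where "L = sum len (arcs G)"
  have L: "len e \<le> L" if "e \<in> arcs G" for e
    unfolding L_def by (rule member_le_sum) (use that len_pos in \<open>auto intro: less_imp_le\<close>)
  have L0: "0 < L" using L[OF e0] len_pos[OF e0] by linarith
  \<comment> \<open>Exactly the budget that \<open>grown_mode\<close> requires for all arcs.\<close>
  define \<epsilon> :: real where "\<epsilon> = 1 / (8 * 13 ^ card (arcs G))"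
  have \<epsilon>: "0 < \<epsilon>" "\<epsilon> \<le> 1/8" "13 ^ card (arcs G) * \<epsilon> \<le> 1/8" by (simp_all add: \<epsilon>_def)
  \<comment> \<open>Phases up to \<open>h * len e\<close> contribute at most
    \<open>\<epsilon> / 2\<close> to a sine; the other half is reserved for the tolerance
    \<open>r\<close>.\<close>
  define h where "h = \<epsilon> / (2 * L)"
  have h: "0 < h" using \<epsilon> L0 by (simp add: h_def)
  have hl: "0 < h * len e \<and> h * len e \<le> \<epsilon> / 2" if e: "e \<in> arcs G" for e
  proof
    have "h * len e \<le> h * L" using L[OF e] h by (intro mult_left_mono) auto
    also have "\<dots> = \<epsilon> / 2" using L0 by (simp add: h_def)
    finally show "h * len e \<le> \<epsilon> / 2" .
  qed (use h len_pos[OF e] in simp)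
  have sinpos: "0 < sin (h * len e)" if e: "e \<in> arcs G" for e
    by (rule sin_gt_zero) (use hl[OF e] \<epsilon> pi_gt3 in linarith)+
  \<comment> \<open>The second bound preserves the signs at the window ends, where the low phases
    are \<open>- h * len e\<close> and \<open>h * len e\<close>.\<close>
  define r where "r = Min (insert (\<epsilon> / 2) ((\<lambda>e. sin (h * len e) / 2) ` arcs G))"
  have r: "0 < r" "r \<le> \<epsilon> / 2" "\<And>e. e \<in> arcs G \<Longrightarrow> r \<le> sin (h * len e) / 2"
  proof -
    let ?R = "insert (\<epsilon> / 2) ((\<lambda>e. sin (h * len e) / 2) ` arcs G)"
    show "0 < r" unfolding r_def using \<epsilon> sinpos by (subst Min_gr_iff) auto
    have "r \<le> x" if "x \<in> ?R" for x unfolding r_def by (rule Min_le) (use that in auto)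
    then show "r \<le> \<epsilon> / 2" "\<And>e. e \<in> arcs G \<Longrightarrow> r \<le> sin (h * len e) / 2" by blast+
  qed
  obtain \<kappa> :: "nat \<Rightarrow> real" where \<kappa>: "filterlim \<kappa> at_top sequentially"
    and win: "\<And>r s1 s2 q. 0 < r \<Longrightarrow>
      eventually (\<lambda>n. \<forall>e\<in>arcs G. \<forall>s\<in>{s1..s2}. low_phase_approx len q r (\<kappa> n + s) s e) sequentially"
    using recurrence_windows by blast
  define A where "A = (\<Sum>v\<in>verts G. \<bar>\<alpha> v\<bar>)"
  \<comment> \<open>\<open>A / \<epsilon>\<close> makes all couplings at most
    \<open>\<epsilon> * k\<close>. The last entry lets the single edge \<open>e0\<close> outweigh
    the total coupling at both ends, as \<open>k / 4\<close> times half its sine exceeds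
    \<open>A\<close>.\<close>
  define K where "K = max 1 (max T (max (A / \<epsilon>) (8 * A / sin (h * len e0))))"
  have "eventually (\<lambda>n. K + h < \<kappa> n) sequentially"
    using \<kappa> by (simp add: filterlim_at_top_dense)
  then have "eventually (\<lambda>n. K + h < \<kappa> n \<and> (\<forall>e\<in>arcs G. \<forall>s\<in>{-h..h}. low_phase_approx len q r (\<kappa> n + s) s e)) sequentially"
    using win[OF r(1)] by (rule eventually_conj)
  then obtain n where n: "K + h < \<kappa> n"
    and win: "\<And>e s. e \<in> arcs G \<Longrightarrow> s \<in> {-h..h} \<Longrightarrow> low_phase_approx len q r (\<kappa> n + s) s e"
    by (auto simp: eventually_sequentially)
  define k1 where "k1 = \<kappa> n - h"
  define k2 where "k2 = \<kappa> n + h"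
  have gtK: "K < k" if "k \<in> {k1..k2}" for k using that n by (auto simp: k1_def)
  have appr: "low_phase_approx len q r k (k - \<kappa> n) e" if "e \<in> arcs G" "k \<in> {k1..k2}" for e k
    using win[of e "k - \<kappa> n"] that by (auto simp: k1_def k2_def)
  have K: "1 \<le> K" "T \<le> K" "A / \<epsilon> \<le> K" "8 * A / sin (h * len e0) \<le> K" by (simp_all add: K_def)
  have k12: "k1 \<in> {k1..k2}" "k2 \<in> {k1..k2}" "k1 \<le> k2" "0 < k1" "0 < k2"
    using h gtK[of k1] K(1) n by (auto simp: k1_def k2_def)
  have small: "\<bar>(k - \<kappa> n) * len e\<bar> \<le> \<epsilon> / 2" if "e \<in> arcs G" "k \<in> {k1..k2}" for e k
  proof -
    have "\<bar>(k - \<kappa> n) * len e\<bar> \<le> h * len e"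
      unfolding abs_mult using that len_pos[OF that(1)] by (intro mult_mono) (auto simp: k1_def k2_def)
    then show ?thesis using hl[OF that(1)] by linarith
  qed
  let ?m = "edge_freq q" and ?c = "\<lambda>e k. cos (edge_freq q e k * len e)" and ?s = "\<lambda>e k. sin (edge_freq q e k * len e)"
  have s1: "?s e k1 \<le> - sin (h * len e) / 2" and s2: "sin (h * len e) / 2 \<le> ?s e k2" if e: "e \<in> arcs G" for e
    using appr[OF e k12(1)] appr[OF e k12(2)] r(3)[OF e]
    by (auto simp: low_phase_approx_def k1_def k2_def abs_less_iff)
  have sums: "(\<Sum>e\<in>arcs G. ?s e k1) \<le> - sin (h * len e0) / 2" "sin (h * len e0) / 2 \<le> (\<Sum>e\<in>arcs G. ?s e k2)"
  proof -
    have "(\<Sum>e\<in>arcs G. - ?s e k1) \<ge> - ?s e0 k1" "(\<Sum>e\<in>arcs G. ?s e k2) \<ge> ?s e0 k2"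
      by (rule member_le_sum; use e0 s1 s2 sinpos in \<open>force\<close>)+
    then show "(\<Sum>e\<in>arcs G. ?s e k1) \<le> - sin (h * len e0) / 2" "sin (h * len e0) / 2 \<le> (\<Sum>e\<in>arcs G. ?s e k2)"
      using s1[OF e0] s2[OF e0] by (auto simp: sum_negf)
  qed
  have kA: "A \<le> k / 4 * (sin (h * len e0) / 2)" if "k \<in> {k1..k2}" for k
  proof -
    have "8 * A \<le> K * sin (h * len e0)" using K(4) sinpos[OF e0] by (simp add: pos_divide_le_eq)
    also have "\<dots> \<le> k * sin (h * len e0)"
      using gtK[OF that] sinpos[OF e0] by (intro mult_right_mono) auto
    finally show ?thesis by simp
  qed
  have sumA: "\<bar>\<Sum>v\<in>verts G. \<alpha> v\<bar> \<le> A" unfolding A_def by (rule sum_abs)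
  have "\<exists>k\<in>{k1..k2}. \<exists>\<phi> D.
     partial_mode G (\<lambda>e. ?m e k) (\<lambda>e. ?c e k) (\<lambda>e. ?s e k) (verts G) (arcs G) (\<lambda>v. \<alpha> v) \<phi> D \<and> (\<forall>v\<in>verts G. \<phi> v \<noteq> 0) \<and>
     (\<forall>\<phi>' D'. partial_mode G (\<lambda>e. ?m e k) (\<lambda>e. ?c e k) (\<lambda>e. ?s e k) (verts G) (arcs G) (\<lambda>v. \<alpha> v) \<phi>' D' \<longrightarrow>
        (\<exists>z. (\<forall>v\<in>verts G. \<phi>' v = z * \<phi> v) \<and>
           (\<forall>e\<in>arcs G. D' e (tail G e) = z * D e (tail G e) \<and> D' e (head G e) = z * D e (head G e))))"
  proof (rule grown_mode[OF tree_grown[OF tree], where a="\<lambda>v k. \<alpha> v" and \<epsilon>=\<epsilon>])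
    fix e assume e: "e \<in> arcs G"
    show "continuous_on {k1..k2} (?m e)" by (rule continuous_on_edge_freq)
    show "continuous_on {k1..k2} (?c e)" "continuous_on {k1..k2} (?s e)"
      by (intro continuous_intros continuous_on_edge_freq)+
    show "?s e k1 \<le> 0 \<and> 0 \<le> ?s e k2" using s1[OF e] s2[OF e] sinpos[OF e] by linarith
    fix k assume k: "k \<in> {k1..k2}"
    have k0: "0 < k" using gtK[OF k] K(1) by linarith
    have ap: "\<bar>?s e k - sin ((k - \<kappa> n) * len e)\<bar> < r" "\<bar>?c e k - cos ((k - \<kappa> n) * len e)\<bar> < r" "\<bar>?m e k / k - 1\<bar> < r"
      using appr[OF e k] by (auto simp: low_phase_approx_def)
    have "1/2 \<le> ?m e k / k \<and> ?m e k / k \<le> 2" using ap(3) r \<epsilon> by (auto simp: abs_less_iff)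
    then show "k / 2 \<le> ?m e k \<and> ?m e k \<le> 2 * k" using k0 by (simp add: field_simps)
    show "(?c e k)\<^sup>2 + (?s e k)\<^sup>2 = 1" by simp
    show "1/2 \<le> ?c e k"
      using ap(2) r(2) \<epsilon> small[OF e k] abs_cos_diff_le[of "(k - \<kappa> n) * len e" 0] unfolding cos_zero by linarith
    show "\<bar>?s e k\<bar> \<le> \<epsilon>"
      using ap(1) r(2) small[OF e k] abs_sin_x_le_abs_x[of "(k - \<kappa> n) * len e"] by linarith
  next
    fix v k assume v: "v \<in> verts G" and k: "k \<in> {k1..k2}"
    have "\<bar>\<alpha> v\<bar> \<le> A" unfolding A_def by (rule member_le_sum) (use v in auto)
    also have "A \<le> \<epsilon> * K" using K(3) \<epsilon>(1) by (simp add: field_simps)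
    also have "\<epsilon> * K \<le> \<epsilon> * k" using gtK[OF k] \<epsilon>(1) by (intro mult_left_mono) auto
    finally show "\<bar>\<alpha> v\<bar> \<le> \<epsilon> * k" .
  next
    have "k1 / 4 * (\<Sum>e\<in>arcs G. ?s e k1) \<le> k1 / 4 * (- sin (h * len e0) / 2)"
      using sums(1) k12 by (intro mult_left_mono) auto
    then show "(\<Sum>v\<in>verts G. \<alpha> v) + k1 / 4 * (\<Sum>e\<in>arcs G. ?s e k1) \<le> 0"
      using kA[OF k12(1)] sumA by (simp add: abs_le_iff)
    have "k2 / 4 * (sin (h * len e0) / 2) \<le> k2 / 4 * (\<Sum>e\<in>arcs G. ?s e k2)"
      using sums(2) k12 by (intro mult_left_mono) auto
    then show "0 \<le> (\<Sum>v\<in>verts G. \<alpha> v) + k2 / 4 * (\<Sum>e\<in>arcs G. ?s e k2)"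
      using kA[OF k12(2)] sumA by (simp add: abs_le_iff)
  qed (use k12 \<epsilon> in auto)
  then obtain k \<phi> D where k: "k \<in> {k1..k2}"
    and pm: "partial_mode G (\<lambda>e. ?m e k) (\<lambda>e. ?c e k) (\<lambda>e. ?s e k) (verts G) (arcs G) \<alpha> \<phi> D"
    and nz: "\<And>v. v \<in> verts G \<Longrightarrow> \<phi> v \<noteq> 0"
    and uniq: "\<And>\<phi>' D'. partial_mode G (\<lambda>e. ?m e k) (\<lambda>e. ?c e k) (\<lambda>e. ?s e k) (verts G) (arcs G) \<alpha> \<phi>' D' \<Longrightarrow>
        \<exists>z. (\<forall>v\<in>verts G. \<phi>' v = z * \<phi> v) \<and>
           (\<forall>e\<in>arcs G. D' e (tail G e) = z * D e (tail G e) \<and> D' e (head G e) = z * D e (head G e))"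
    by (elim bexE exE conjE) blast
  have inc: "incident_arcs G v \<inter> arcs G = incident_arcs G v" for v by (auto simp: mem_incident_arcs)
  have dm: "discrete_mode G len {} \<alpha> (\<lambda>e. ?m e k) \<phi>' D' \<longleftrightarrow>
     partial_mode G (\<lambda>e. ?m e k) (\<lambda>e. ?c e k) (\<lambda>e. ?s e k) (verts G) (arcs G) \<alpha> \<phi>' D'" for \<phi>' D'
    by (simp add: discrete_mode_def partial_mode_def inc)
  have mu: "0 < ?m e k \<and> (?m e k)\<^sup>2 = k\<^sup>2 - q e" if "e \<in> arcs G" for e
    using appr[OF that k] by (intro edge_freq_pos) (simp add: low_phase_approx_def)
  let ?\<psi> = "mode_wave G len (\<lambda>e. ?m e k) \<phi> D"
  have mode: "discrete_mode G len {} \<alpha> (\<lambda>e. ?m e k) \<phi> D" using pm by (simp add: dm)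
  have nv: "\<not> vanishes_at G len ?\<psi> v" if v: "v \<in> verts G" for v
  proof -
    obtain e where e: "e \<in> incident_arcs G v" using incident_arcs_nonempty[OF con v] by blast
    have "end_value G len ?\<psi> e v = \<phi> v" by (rule mode_wave_ends(1)[OF mode _ e]) (use mu in blast)
    then show ?thesis unfolding vanishes_at_def using e nz[OF v] by force
  qed
  have "?\<psi> \<noteq> 0"
  proof
    assume "?\<psi> = 0"
    then have "vanishes_at G len ?\<psi> (tail G e0)" by (simp add: vanishes_at_def end_value_def)
    then show False using nv[OF tail_in_verts[OF e0]] by blast
  qed
  moreover have "eigenvalue_multiplicity G len {} \<alpha> q (of_real (k\<^sup>2)) = 1"
  proof (rule mode_wave_simple_eigenvalue[OF mode _ mu \<open>?\<psi> \<noteq> 0\<close>])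
    fix \<phi>' D' assume "discrete_mode G len {} \<alpha> (\<lambda>e. ?m e k) \<phi>' D'"
    from uniq[OF this[unfolded dm]]
    show "\<exists>c. \<forall>e\<in>arcs G. \<phi>' (tail G e) = c * \<phi> (tail G e) \<and> D' e (tail G e) = c * D e (tail G e)"
      using tail_in_verts by blast
  qed simp
  moreover have "?\<psi> \<in> eigenspace G len {} \<alpha> q (of_real (k\<^sup>2))"
    by (rule mode_wave_eigenspace[OF mode _ mu]) auto
  moreover have "T < k\<^sup>2"
  proof -
    have "1 < k" "T < k" using gtK[OF k] K by linarith+
    moreover from this have "k * 1 < k * k" by (intro mult_strict_left_mono) auto
    ultimately show ?thesis unfolding power2_eq_square by linarith
  qed
  ultimately show ?thesis using nv unfolding eigenfunction_def by blast
qed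

end

section \<open>Full support with Dirichlet vertices\<close>

lemma cot_decreasing:
  fixes x y :: real
  assumes "0 < x" "x \<le> y" "y < pi"
  shows "cos y / sin y \<le> cos x / sin x"
proof -
  have s: "0 < sin x" "0 < sin y" using assms by (auto intro: sin_gt_zero)
  have "0 \<le> sin (y - x)" using assms by (intro sin_ge_zero) auto
  then show ?thesis using s by (simp add: sin_diff field_simps)
qed

context compact_metric_graph
begin

text \<open>This is the discrete Dirichlet Laplacian: zero energy forces equal values along every
  edge, hence the value 0 of a Dirichlet vertex everywhere.\<close>

lemma lowest_form_value_laplacian_pos:
  assumes con: "Digraph_Component.connected G" and VD: "VD \<subseteq> verts G" "VD \<noteq> {}" and ne: "verts G - VD \<noteq> {}"
  shows "0 < lowest_form_value G (verts G - VD) (\<lambda>e. 1 / len e) (\<lambda>e. 1 / len e) (\<lambda>v. 0)"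
proof -
  define V where "V = verts G - VD"
  have V: "finite V" "V \<noteq> {}" using ne by (auto simp: V_def)
  obtain \<phi> where \<phi>: "\<phi> \<in> unit_vectors V"
    "graph_form G V (\<lambda>e. 1 / len e) (\<lambda>e. 1 / len e) (\<lambda>v. 0) \<phi> =
     lowest_form_value G V (\<lambda>e. 1 / len e) (\<lambda>e. 1 / len e) (\<lambda>v. 0)"
    using lowest_form_value_attained(1)[OF V] by blast
  have out: "\<phi> v = 0" if "v \<notin> V" for v using \<phi>(1) that by (simp add: unit_vectors_def)
  have form: "graph_form G V (\<lambda>e. 1 / len e) (\<lambda>e. 1 / len e) (\<lambda>v. 0) \<phi> =
      (\<Sum>e\<in>arcs G. 1 / len e * (\<phi> (tail G e) - \<phi> (head G e))\<^sup>2)"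
    unfolding graph_form_def by (simp add: power2_diff diff_divide_distrib add_divide_distrib algebra_simps)
  have nonneg: "0 \<le> 1 / len e * (\<phi> (tail G e) - \<phi> (head G e))\<^sup>2" if "e \<in> arcs G" for e
    using len_pos[OF that] by simp
  have "graph_form G V (\<lambda>e. 1 / len e) (\<lambda>e. 1 / len e) (\<lambda>v. 0) \<phi> \<noteq> 0"
  proof
    assume "graph_form G V (\<lambda>e. 1 / len e) (\<lambda>e. 1 / len e) (\<lambda>v. 0) \<phi> = 0"
    then have "\<forall>e\<in>arcs G. 1 / len e * (\<phi> (tail G e) - \<phi> (head G e))\<^sup>2 = 0"
      unfolding form by (subst (asm) sum_nonneg_eq_0_iff) (use nonneg in auto)
    then have eq: "\<phi> (tail G e) = \<phi> (head G e)" if "e \<in> arcs G" for e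
      using that len_pos[OF that] by fastforce
    define S where "S = {v\<in>verts G. \<phi> v = 0}"
    have "S \<noteq> {}" using VD out by (auto simp: S_def V_def)
    moreover have "(tail G e \<in> S) = (head G e \<in> S)" if "e \<in> arcs G" for e
      using eq[OF that] that by (simp add: S_def)
    ultimately have "S = verts G"
      using connected_crossing_arc[OF con, of S] by (auto simp: S_def)
    then have "(\<Sum>v\<in>V. (\<phi> v)\<^sup>2) = 0" by (intro sum.neutral) (auto simp: S_def V_def)
    then show False using \<phi>(1) by (simp add: unit_vectors_def)
  qed
  moreover have "0 \<le> graph_form G V (\<lambda>e. 1 / len e) (\<lambda>e. 1 / len e) (\<lambda>v. 0) \<phi>"
    unfolding form by (intro sum_nonneg nonneg)
  ultimately show ?thesis using \<phi>(2) unfolding V_def by linarith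
qed

text \<open>As no sine vanishes, the end values determine the sinusoid on each edge, and
  stationarity of the form is the coupling condition for its outward derivatives.\<close>

lemma null_vector_mode:
  fixes m :: "'e \<Rightarrow> real"
  assumes s: "\<And>e. e \<in> arcs G \<Longrightarrow> sin (m e * len e) \<noteq> 0"
    and out: "\<And>v. v \<notin> verts G - VD \<Longrightarrow> \<phi> v = 0"
    and stat: "\<And>v. v \<in> verts G - VD \<Longrightarrow> (\<Sum>e\<in>incident_arcs G v.
       m e * cos (m e * len e) / sin (m e * len e) * \<phi> v - m e / sin (m e * len e) * \<phi> (other_end G e v)) = \<alpha> v * \<phi> v"
  shows "discrete_mode G len VD \<alpha> m (\<lambda>v. of_real (\<phi> v)) (\<lambda>e v. of_real
     (m e * cos (m e * len e) / sin (m e * len e) * \<phi> v - m e / sin (m e * len e) * \<phi> (other_end G e v)))"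
  unfolding discrete_mode_def
proof (intro conjI ballI)
  fix e assume e: "e \<in> arcs G"
  define p where "p = \<phi> (tail G e)"
  define r where "r = \<phi> (head G e)"
  define C where "C = cos (m e * len e)"
  define S where "S = sin (m e * len e)"
  define P where "P = m e * C / S * p - m e / S * r"
  define Q where "Q = m e * C / S * r - m e / S * p"
  have oe: "other_end G e (tail G e) = head G e" "other_end G e (head G e) = tail G e"
    using no_loops[OF e] by (auto simp: other_end_def)
  have S0: "S \<noteq> 0" using s[OF e] by (simp add: S_def)
  have "S * P = m e * C * p - m e * r" using S0 by (simp add: P_def field_simps)
  then have 1: "m e * r = m e * C * p - S * P" by simp
  have "S\<^sup>2 = 1 - C\<^sup>2" by (simp add: C_def S_def sin_squared_eq)
  then have 2: "Q = - (m e * S * p) - C * P"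
    using S0 by (simp add: P_def Q_def field_simps power2_eq_square) algebra
  have "edge_transfer (m e) C S (of_real p) (of_real P) (of_real r) (of_real Q)"
    unfolding edge_transfer_def using arg_cong[OF 1, of complex_of_real] arg_cong[OF 2, of complex_of_real]
    by simp
  then show "edge_transfer (m e) (cos (m e * len e)) (sin (m e * len e)) (of_real (\<phi> (tail G e)))
     (of_real (m e * cos (m e * len e) / sin (m e * len e) * \<phi> (tail G e) - m e / sin (m e * len e) * \<phi> (other_end G e (tail G e))))
     (of_real (\<phi> (head G e)))
     (of_real (m e * cos (m e * len e) / sin (m e * len e) * \<phi> (head G e) - m e / sin (m e * len e) * \<phi> (other_end G e (head G e))))"
    by (simp only: oe P_def Q_def C_def S_def p_def r_def)
next
  fix v assume "v \<in> verts G - VD"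
  from arg_cong[OF stat[OF this], of complex_of_real]
  show "(\<Sum>e\<in>incident_arcs G v. of_real (m e * cos (m e * len e) / sin (m e * len e) * \<phi> v
       - m e / sin (m e * len e) * \<phi> (other_end G e v))) = complex_of_real (\<alpha> v) * of_real (\<phi> v)"
    by simp
qed (use out in auto)

text \<open>By \<open>free\<close> every edge has an end outside \<open>VD\<close>, where the wave
  takes a positive value; this gives full support.\<close>

lemma full_support_eigenfunction:
  assumes con: "Digraph_Component.connected G" and VD: "VD \<subseteq> verts G" "VD \<noteq> {}"
    and deg: "\<And>v. v \<in> VD \<Longrightarrow> vertex_degree G v = 1"
    and free: "\<And>e. e \<in> arcs G \<Longrightarrow> tail G e \<notin> VD \<or> head G e \<notin> VD"
  shows "\<exists>z>T. \<exists>\<psi>. eigenfunction G len VD \<alpha> q (of_real z) \<psi> \<and> (\<forall>e\<in>arcs G. \<exists>x\<in>{0..len e}. \<psi> e x \<noteq> 0)"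
proof -
  define L where "L = Max (len ` arcs G)"
  have L: "len e \<le> L" if "e \<in> arcs G" for e unfolding L_def using that by simp
  have "L \<in> len ` arcs G" unfolding L_def by (rule Max_in) (use arcs_nonempty in auto)
  then obtain e0 where e0: "e0 \<in> arcs G" "len e0 = L" by blast
  have L0: "0 < L" using len_pos[OF e0(1)] e0(2) by simp
  obtain v0 where v0: "v0 \<in> verts G - VD" "e0 \<in> incident_arcs G v0"
    using free[OF e0(1)] e0(1) tail_in_verts[OF e0(1)] head_in_verts[OF e0(1)]
    unfolding mem_incident_arcs by blast
  define V where "V = verts G - VD"
  have V: "finite V" "V \<noteq> {}" using v0 by (auto simp: V_def)
  have v0V: "v0 \<in> V" using v0 by (simp add: V_def)
  let ?low = "lowest_form_value G V"

  \<comment> \<open>The factor \<open>s\<close> keeps the coefficients finite: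
    \<open>s cot (s l)\<close> and \<open>s / sin (s l)\<close> tend to \<open>1 / l\<close>. This
    yields the lower window end \<open>s1\<close>, taken below \<open>pi / (2 * L)\<close> so that
    it precedes \<open>s2\<close>.\<close>
  have "((\<lambda>s. ?low (\<lambda>e. s * (cos (s * len e) / sin (s * len e))) (\<lambda>e. s / sin (s * len e)) (\<lambda>v. 0)) \<longlongrightarrow>
      ?low (\<lambda>e. 1 / len e) (\<lambda>e. 1 / len e) (\<lambda>v. 0)) (at_right 0)"
  proof (rule tendsto_lowest_form_value[OF V])
    fix e assume "e \<in> arcs G"
    then have l: "0 < len e" by (rule len_pos)
    have "((\<lambda>s. s * (cos (s * len e) / sin (s * len e))) \<longlongrightarrow> inverse (len e)) (at_right 0)"
      using l by real_asymp
    then show "((\<lambda>s. s * (cos (s * len e) / sin (s * len e))) \<longlongrightarrow> 1 / len e) (at_right 0)"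
      by (simp add: inverse_eq_divide)
    have "((\<lambda>s. s / sin (s * len e)) \<longlongrightarrow> inverse (len e)) (at_right 0)"
      using l by real_asymp
    then show "((\<lambda>s. s / sin (s * len e)) \<longlongrightarrow> 1 / len e) (at_right 0)"
      by (simp add: inverse_eq_divide)
  qed simp
  then have "eventually (\<lambda>s. 0 < ?low (\<lambda>e. s * (cos (s * len e) / sin (s * len e))) (\<lambda>e. s / sin (s * len e)) (\<lambda>v. 0)) (at_right 0)"
    by (rule order_tendstoD(1)) (use lowest_form_value_laplacian_pos[OF con VD] V in \<open>simp add: V_def\<close>)
  moreover have "eventually (\<lambda>s. s \<in> {0<..<pi / (2 * L)}) (at_right 0)"
    by (rule eventually_at_right_real) (use L0 in simp)
  ultimately have "\<exists>s. 0 < ?low (\<lambda>e. s * (cos (s * len e) / sin (s * len e))) (\<lambda>e. s / sin (s * len e)) (\<lambda>v. 0)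
      \<and> s \<in> {0<..<pi / (2 * L)}"
    by (intro eventually_happens'[OF trivial_limit_at_right_real] eventually_conj)
  then obtain s1 where s1: "0 < s1" "s1 < pi / (2 * L)"
    and low1: "0 < ?low (\<lambda>e. s1 * (cos (s1 * len e) / sin (s1 * len e))) (\<lambda>e. s1 / sin (s1 * len e)) (\<lambda>v. 0)"
    by auto

  \<comment> \<open>At \<open>s2\<close> the longest edge has phase \<theta>, with cotangent
    \<open>- (B + 1)\<close>. The other cotangents at \<open>v0\<close> are at most their values
    \<open>cot0\<close> at \<open>pi / (2 * L) < s2\<close>, so \<open>B\<close> absorbs them and
    the sum is at most \<open>- 1\<close>. As \<open>\<theta> < pi\<close>, no edge reaches phase
    \<open>pi\<close>.\<close>
  define cot0 where "cot0 e = cos (pi / (2 * L) * len e) / sin (pi / (2 * L) * len e)" for e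
  define B where "B = (\<Sum>e\<in>incident_arcs G v0. \<bar>cot0 e\<bar>)"
  define \<theta> where "\<theta> = pi / 2 + arctan (B + 1)"
  define s2 where "s2 = \<theta> / L"
  have B: "0 \<le> B" by (simp add: B_def sum_nonneg)
  have \<theta>: "pi / 2 < \<theta>" "\<theta> < pi" using B arctan_ubound[of "B + 1"] by (auto simp: \<theta>_def)
  have s2: "pi / (2 * L) < s2" "s2 * L < pi" using \<theta> L0 by (simp_all add: s2_def field_simps)
  have range: "0 < s * len e \<and> s * len e < pi" if "e \<in> arcs G" "s \<in> {s1..s2}" for e s
  proof
    show "0 < s * len e" using that s1 len_pos by auto
    have "s * len e \<le> s2 * L" using that s1 L[OF that(1)] len_pos[OF that(1)] by (intro mult_mono) auto
    then show "s * len e < pi" using s2(2) by linarith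
  qed
  have cot2: "(\<Sum>e\<in>incident_arcs G v0. cos (s2 * len e) / sin (s2 * len e)) \<le> - 1"
  proof -
    have "cos (s2 * len e0) / sin (s2 * len e0) = - (B + 1)"
    proof -
      have "s2 * len e0 = arctan (B + 1) + pi / 2" using L0 by (simp add: s2_def e0(2) \<theta>_def)
      then have "cos (s2 * len e0) / sin (s2 * len e0) = - tan (arctan (B + 1))"
        by (simp add: cos_add sin_add tan_def)
      then show ?thesis by (simp add: tan_arctan)
    qed
    moreover have "cos (s2 * len e) / sin (s2 * len e) \<le> \<bar>cot0 e\<bar>" if "e \<in> incident_arcs G v0" for e
    proof -
      have e: "e \<in> arcs G" using that by (simp add: mem_incident_arcs)
      have "cos (s2 * len e) / sin (s2 * len e) \<le> cot0 e"
        unfolding cot0_def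
      proof (rule cot_decreasing)
        show "0 < pi / (2 * L) * len e" using L0 len_pos[OF e] by simp
        show "pi / (2 * L) * len e \<le> s2 * len e" using s2(1) len_pos[OF e] by (intro mult_right_mono) auto
        show "s2 * len e < pi" using range[OF e, of s2] s1 s2(1) by auto
      qed
      then show ?thesis by linarith
    qed
    then have "(\<Sum>e\<in>incident_arcs G v0 - {e0}. cos (s2 * len e) / sin (s2 * len e)) \<le> (\<Sum>e\<in>incident_arcs G v0 - {e0}. \<bar>cot0 e\<bar>)"
      by (intro sum_mono) auto
    moreover have "(\<Sum>e\<in>incident_arcs G v0 - {e0}. \<bar>cot0 e\<bar>) \<le> B"
      unfolding B_def by (intro sum_mono2 finite_incident_arcs) auto
    ultimately show ?thesis
      using sum.remove[OF finite_incident_arcs v0(2), of "\<lambda>e. cos (s2 * len e) / sin (s2 * len e)"] by linarith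
  qed

  obtain \<kappa> :: "nat \<Rightarrow> real" where \<kappa>: "filterlim \<kappa> at_top sequentially"
    and win: "\<And>r t1 t2 q. 0 < r \<Longrightarrow>
      eventually (\<lambda>n. \<forall>e\<in>arcs G. \<forall>s\<in>{t1..t2}. low_phase_approx len q r (\<kappa> n + s) s e) sequentially"
    using recurrence_windows by blast
  define A where "A e k = edge_freq q e k * cos (edge_freq q e k * len e) / sin (edge_freq q e k * len e)" for e k
  define W where "W e k = edge_freq q e k / sin (edge_freq q e k * len e)" for e k
  \<comment> \<open>Coefficients grow like the wave number, so division by it gives limits in which
    the couplings disappear. The free factor \<open>t\<close> is \<open>s1\<close> at the lower
    window end, to match the limit at small \<open>s\<close>, and 1 at the upper end.\<close>
  have lims: "(\<lambda>n. t / (\<kappa> n + s) * A e (\<kappa> n + s)) \<longlonglongrightarrow> t * (cos (s * len e) / sin (s * len e))"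
    "(\<lambda>n. t / (\<kappa> n + s) * W e (\<kappa> n + s)) \<longlonglongrightarrow> t / sin (s * len e)"
    "(\<lambda>n. t / (\<kappa> n + s) * c) \<longlonglongrightarrow> 0"
    if e: "e \<in> arcs G" and s: "s \<in> {s1..s2}" for e s t c
  proof -
    have ev: "eventually (\<lambda>n. low_phase_approx len q r (\<kappa> n + s) s e) sequentially" if "0 < r" for r
      using win[OF that, of s s q] by eventually_elim (use e in auto)
    have f: "(\<lambda>n. edge_freq q e (\<kappa> n + s) / (\<kappa> n + s)) \<longlonglongrightarrow> 1"
      by (rule tendstoI, drule ev, erule eventually_mono) (auto simp: low_phase_approx_def dist_real_def)
    have c: "(\<lambda>n. cos (edge_freq q e (\<kappa> n + s) * len e)) \<longlonglongrightarrow> cos (s * len e)"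
      by (rule tendstoI, drule ev, erule eventually_mono) (auto simp: low_phase_approx_def dist_real_def)
    have sn: "(\<lambda>n. sin (edge_freq q e (\<kappa> n + s) * len e)) \<longlonglongrightarrow> sin (s * len e)"
      by (rule tendstoI, drule ev, erule eventually_mono) (auto simp: low_phase_approx_def dist_real_def)
    have nz: "sin (s * len e) \<noteq> 0" using range[OF e s] sin_gt_zero[of "s * len e"] by auto
    have "(\<lambda>n. t * (edge_freq q e (\<kappa> n + s) / (\<kappa> n + s) * (cos (edge_freq q e (\<kappa> n + s) * len e) / sin (edge_freq q e (\<kappa> n + s) * len e))))
        \<longlonglongrightarrow> t * (1 * (cos (s * len e) / sin (s * len e)))"
      by (intro tendsto_intros f c sn nz)
    then show "(\<lambda>n. t / (\<kappa> n + s) * A e (\<kappa> n + s)) \<longlonglongrightarrow> t * (cos (s * len e) / sin (s * len e))"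
      by (simp add: A_def)
    have "(\<lambda>n. t * (edge_freq q e (\<kappa> n + s) / (\<kappa> n + s) / sin (edge_freq q e (\<kappa> n + s) * len e)))
        \<longlonglongrightarrow> t * (1 / sin (s * len e))"
      by (intro tendsto_intros f sn nz)
    then show "(\<lambda>n. t / (\<kappa> n + s) * W e (\<kappa> n + s)) \<longlonglongrightarrow> t / sin (s * len e)"
      by (simp add: W_def)
    have "filterlim (\<lambda>n. s + \<kappa> n) at_top sequentially"
      by (rule filterlim_tendsto_add_at_top[OF tendsto_const \<kappa>])
    then have "filterlim (\<lambda>n. \<kappa> n + s) at_top sequentially" by (simp add: add.commute)
    then have "(\<lambda>n. (t * c) / (\<kappa> n + s)) \<longlonglongrightarrow> 0"
      by (intro tendsto_divide_0[OF tendsto_const] filterlim_at_top_imp_at_infinity)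
    then show "(\<lambda>n. t / (\<kappa> n + s) * c) \<longlonglongrightarrow> 0" by simp
  qed
  have s12: "s1 \<in> {s1..s2}" "s2 \<in> {s1..s2}" "s1 \<le> s2" using s1 s2 by auto
  have "((\<lambda>n. ?low (\<lambda>e. s1 / (\<kappa> n + s1) * A e (\<kappa> n + s1)) (\<lambda>e. s1 / (\<kappa> n + s1) * W e (\<kappa> n + s1)) (\<lambda>v. s1 / (\<kappa> n + s1) * \<alpha> v)) \<longlongrightarrow>
      ?low (\<lambda>e. s1 * (cos (s1 * len e) / sin (s1 * len e))) (\<lambda>e. s1 / sin (s1 * len e)) (\<lambda>v. 0)) sequentially"
    by (rule tendsto_lowest_form_value[OF V]) (use lims e0(1) s12 in auto)
  then have ev1: "eventually (\<lambda>n. 0 < ?low (\<lambda>e. s1 / (\<kappa> n + s1) * A e (\<kappa> n + s1)) (\<lambda>e. s1 / (\<kappa> n + s1) * W e (\<kappa> n + s1)) (\<lambda>v. s1 / (\<kappa> n + s1) * \<alpha> v)) sequentially"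
    using low1 by (rule order_tendstoD(1))
  have "(\<lambda>n. (\<Sum>e\<in>incident_arcs G v0. 1 / (\<kappa> n + s2) * A e (\<kappa> n + s2)) - 1 / (\<kappa> n + s2) * \<alpha> v0) \<longlonglongrightarrow>
      (\<Sum>e\<in>incident_arcs G v0. 1 * (cos (s2 * len e) / sin (s2 * len e))) - 0"
    by (intro tendsto_intros lims[OF _ s12(2)] lims(3)[OF e0(1) s12(2)]) (auto simp: mem_incident_arcs)
  then have ev2: "eventually (\<lambda>n. (\<Sum>e\<in>incident_arcs G v0. 1 / (\<kappa> n + s2) * A e (\<kappa> n + s2)) - 1 / (\<kappa> n + s2) * \<alpha> v0 < 0) sequentially"
    by (rule order_tendstoD(2)) (use cot2 in simp)
  \<comment> \<open>Sines bounded below on the whole window give a tolerance that keeps the true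
    sines positive for every \<open>k\<close> in it, as continuity of the coefficients and
    positivity of \<open>W\<close> require.\<close>
  have "\<exists>\<rho>>0. \<forall>s\<in>{s1..s2}. \<rho> \<le> sin (s * len e)" if e: "e \<in> arcs G" for e
  proof -
    have "\<exists>s0\<in>{s1..s2}. \<forall>s\<in>{s1..s2}. sin (s0 * len e) \<le> sin (s * len e)"
      by (rule continuous_attains_inf) (use s12 in \<open>auto intro!: continuous_intros\<close>)
    then obtain s0 where s0: "s0 \<in> {s1..s2}" "\<forall>s\<in>{s1..s2}. sin (s0 * len e) \<le> sin (s * len e)" by blast
    moreover have "0 < sin (s0 * len e)" using range[OF e s0(1)] by (intro sin_gt_zero) auto
    ultimately show ?thesis by blast
  qed
  then obtain \<rho> where \<rho>: "\<And>e. e \<in> arcs G \<Longrightarrow> 0 < \<rho> e" "\<And>e s. e \<in> arcs G \<Longrightarrow> s \<in> {s1..s2} \<Longrightarrow> \<rho> e \<le> sin (s * len e)"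
    by metis
  define r where "r = Min (\<rho> ` arcs G)"
  have r: "0 < r" "\<And>e. e \<in> arcs G \<Longrightarrow> r \<le> \<rho> e"
    unfolding r_def using arcs_nonempty \<rho>(1) by (auto simp: Min_gr_iff intro: Min_le)
  have "eventually (\<lambda>n. max 1 T < \<kappa> n) sequentially"
    using \<kappa> unfolding filterlim_at_top_dense by blast
  from eventually_conj[OF eventually_conj[OF this win[OF r(1), of s1 s2 q]] eventually_conj[OF ev1 ev2]]
  obtain n where n: "max 1 T < \<kappa> n" "\<forall>e\<in>arcs G. \<forall>s\<in>{s1..s2}. low_phase_approx len q r (\<kappa> n + s) s e"
    and n1: "0 < ?low (\<lambda>e. s1 / (\<kappa> n + s1) * A e (\<kappa> n + s1)) (\<lambda>e. s1 / (\<kappa> n + s1) * W e (\<kappa> n + s1)) (\<lambda>v. s1 / (\<kappa> n + s1) * \<alpha> v)"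
    and n2: "(\<Sum>e\<in>incident_arcs G v0. 1 / (\<kappa> n + s2) * A e (\<kappa> n + s2)) - 1 / (\<kappa> n + s2) * \<alpha> v0 < 0"
    by (auto simp: eventually_sequentially)
  define k1 where "k1 = \<kappa> n + s1"
  define k2 where "k2 = \<kappa> n + s2"
  have k12: "1 < k1" "T < k1" "k1 \<le> k2" "0 < k2" using n(1) s1 s12 by (auto simp: k1_def k2_def)
  have appr: "low_phase_approx len q r k (k - \<kappa> n) e" "k - \<kappa> n \<in> {s1..s2}" if "e \<in> arcs G" "k \<in> {k1..k2}" for e k
  proof -
    show "k - \<kappa> n \<in> {s1..s2}" using that by (auto simp: k1_def k2_def)
    then show "low_phase_approx len q r k (k - \<kappa> n) e" using n(2) that(1) by fastforce
  qed
  have sinpos: "0 < sin (edge_freq q e k * len e)" if "e \<in> arcs G" "k \<in> {k1..k2}" for e k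
    using appr(1)[OF that] \<rho>(2)[OF that(1) appr(2)[OF that]] r(2)[OF that(1)]
    by (auto simp: low_phase_approx_def abs_less_iff)
  have mu: "0 < edge_freq q e k \<and> (edge_freq q e k)\<^sup>2 = k\<^sup>2 - q e" if "e \<in> arcs G" "k \<in> {k1..k2}" for e k
    using appr(1)[OF that] by (intro edge_freq_pos) (simp add: low_phase_approx_def)
  have pos: "0 < ?low (\<lambda>e. A e k1) (\<lambda>e. W e k1) \<alpha>"
  proof -
    have r: "0 < s1 / k1" using s1 k12 by simp
    show ?thesis
      using n1 r unfolding k1_def[symmetric] lowest_form_value_scale[OF V r] by (rule zero_less_mult_pos)
  qed
  have neg: "?low (\<lambda>e. A e k2) (\<lambda>e. W e k2) \<alpha> \<le> 0"
  proof -
    define \<delta> where "\<delta> w = (if w = v0 then 1 else 0 :: real)" for w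
    have "\<delta> \<in> unit_vectors V"
      using v0V V by (auto simp: unit_vectors_def \<delta>_def if_distrib[where f="\<lambda>x. x\<^sup>2"] cong: if_cong)
    then have "?low (\<lambda>e. A e k2) (\<lambda>e. W e k2) \<alpha> \<le> graph_form G V (\<lambda>e. A e k2) (\<lambda>e. W e k2) \<alpha> \<delta>"
      by (rule lowest_form_value_attained(2)[OF V])
    \<comment> \<open>Writing the unit vector as a perturbation of zero makes
      \<open>graph_form_perturb_vertex\<close> return its diagonal entry.\<close>
    also have "\<delta> = (\<lambda>w. 0)(v0 := 0 + 1)" by (auto simp: \<delta>_def)
    also have "graph_form G V (\<lambda>e. A e k2) (\<lambda>e. W e k2) \<alpha> ((\<lambda>w. 0)(v0 := 0 + 1)) =
        (\<Sum>e\<in>incident_arcs G v0. A e k2) - \<alpha> v0"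
      using graph_form_perturb_vertex[OF V v0V, of "\<lambda>e. A e k2" "\<lambda>e. W e k2" \<alpha> "\<lambda>w. 0" 1]
      by (simp add: graph_form_def)
    also have "\<dots> \<le> 0"
    proof -
      have "1 / k2 * ((\<Sum>e\<in>incident_arcs G v0. A e k2) - \<alpha> v0) < 0"
        using n2 unfolding k2_def[symmetric] by (simp add: right_diff_distrib sum_distrib_left)
      then show ?thesis using k12(4) by (simp add: mult_less_0_iff divide_less_0_iff)
    qed
    finally show ?thesis .
  qed
  have "continuous_on {k1..k2} (\<lambda>k. ?low (\<lambda>e. A e k) (\<lambda>e. W e k) \<alpha>)"
    unfolding continuous_on_def
  proof (intro ballI tendsto_lowest_form_value[OF V] tendsto_const)
    fix k e assume k: "k \<in> {k1..k2}" and e: "e \<in> arcs G"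
    have nz: "\<forall>k\<in>{k1..k2}. sin (edge_freq q e k * len e) \<noteq> 0" using sinpos[OF e] by force
    have "continuous_on {k1..k2} (A e)" "continuous_on {k1..k2} (W e)"
      unfolding A_def W_def by (intro continuous_intros continuous_on_edge_freq nz)+
    then show "((\<lambda>k. A e k) \<longlongrightarrow> A e k) (at k within {k1..k2})" "((\<lambda>k. W e k) \<longlongrightarrow> W e k) (at k within {k1..k2})"
      using k by (auto simp: continuous_on_def)
  qed
  then have "\<exists>k\<ge>k1. k \<le> k2 \<and> ?low (\<lambda>e. A e k) (\<lambda>e. W e k) \<alpha> = 0"
    using pos neg k12(3) by (intro IVT2') auto
  then obtain k where k: "k \<in> {k1..k2}" and low: "?low (\<lambda>e. A e k) (\<lambda>e. W e k) \<alpha> = 0"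
    by auto
  have "0 < W e k" if "e \<in> arcs G" for e
    using sinpos[OF that k] mu[OF that k] by (simp add: W_def)
  then obtain \<phi> where \<phi>: "\<And>v. v \<in> V \<Longrightarrow> 0 < \<phi> v" "\<And>v. v \<notin> V \<Longrightarrow> \<phi> v = 0"
    "\<And>v. v \<in> V \<Longrightarrow> (\<Sum>e\<in>incident_arcs G v. A e k * \<phi> v - W e k * \<phi> (other_end G e v)) = \<alpha> v * \<phi> v"
    using positive_null_vector[OF con VD(1) deg V(2)[unfolded V_def] low[unfolded V_def]]
    unfolding V_def by blast
  let ?m = "\<lambda>e. edge_freq q e k"
  define D where "D e v = complex_of_real (?m e * cos (?m e * len e) / sin (?m e * len e) * \<phi> v
      - ?m e / sin (?m e * len e) * \<phi> (other_end G e v))" for e v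
  have mode: "discrete_mode G len VD \<alpha> ?m (\<lambda>v. of_real (\<phi> v)) D"
    unfolding D_def
    by (rule null_vector_mode) (use sinpos k \<phi> in \<open>force simp: V_def A_def W_def\<close>)+
  let ?\<psi> = "mode_wave G len ?m (\<lambda>v. of_real (\<phi> v)) D"
  have supp: "\<exists>x\<in>{0..len e}. ?\<psi> e x \<noteq> 0" if e: "e \<in> arcs G" for e
  proof -
    obtain v where v: "v \<in> V" "e \<in> incident_arcs G v"
      using free[OF e] e tail_in_verts[OF e] head_in_verts[OF e]
      unfolding mem_incident_arcs V_def by blast
    have "end_value G len ?\<psi> e v = of_real (\<phi> v)"
      by (rule mode_wave_ends(1)[OF mode _ v(2)]) (use mu k in blast)
    then have "end_value G len ?\<psi> e v \<noteq> 0" using \<phi>(1)[OF v(1)] by simp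
    then have "?\<psi> e 0 \<noteq> 0 \<or> ?\<psi> e (len e) \<noteq> 0" by (auto simp: end_value_def split: if_splits)
    then show ?thesis using len_pos[OF e] by force
  qed
  have "?\<psi> \<noteq> 0" using supp[OF e0(1)] by auto
  moreover have "?\<psi> \<in> eigenspace G len VD \<alpha> q (of_real (k\<^sup>2))"
    by (rule mode_wave_eigenspace[OF mode VD(1)]) (use mu k in blast)
  moreover have "T < k\<^sup>2"
  proof -
    have "1 < k" "T < k" using k k12 by auto
    moreover from this have "k * 1 < k * k" by (intro mult_strict_left_mono) auto
    ultimately show ?thesis unfolding power2_eq_square by linarith
  qed
  ultimately show ?thesis using supp unfolding eigenfunction_def by blast
qed

text \<open>Both ends of \<open>e1\<close> have degree one, so by connectedness \<open>e1\<close> is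
  the whole graph and the Dirichlet interval has the eigenfunctions \<open>sin (m x)\<close>,
  \<open>m = N pi / l\<close>.\<close>

lemma dirichlet_interval_eigenfunction:
  assumes con: "Digraph_Component.connected G" and VD: "VD \<subseteq> verts G"
    and deg: "\<And>v. v \<in> VD \<Longrightarrow> vertex_degree G v = 1"
    and e1: "e1 \<in> arcs G" "tail G e1 \<in> VD" "head G e1 \<in> VD"
  shows "\<exists>z>T. \<exists>\<psi>. eigenfunction G len VD \<alpha> q (of_real z) \<psi> \<and> (\<forall>e\<in>arcs G. \<exists>x\<in>{0..len e}. \<psi> e x \<noteq> 0)"
proof -
  define S where "S = {tail G e1, head G e1}"
  have only: "e = e1" if "v \<in> S" "e \<in> incident_arcs G v" for v e
  proof -
    have "card (incident_arcs G v) = 1" using that(1) deg e1 by (auto simp: S_def vertex_degree_def)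
    moreover have "e1 \<in> incident_arcs G v" using that(1) e1(1) by (auto simp: S_def mem_incident_arcs)
    ultimately show ?thesis using that(2) by (metis card_1_singletonE singletonD)
  qed
  have SV: "S = verts G"
  proof (rule ccontr)
    assume "S \<noteq> verts G"
    moreover have "S \<subseteq> verts G" "S \<noteq> {}" using e1(1) by (auto simp: S_def)
    ultimately obtain e where e: "e \<in> arcs G" "(tail G e \<in> S) \<noteq> (head G e \<in> S)"
      using connected_crossing_arc[OF con] by blast
    then have "e = e1" using only by (auto simp: mem_incident_arcs)
    then show False using e(2) by (simp add: S_def)
  qed
  have "e = e1" if "e \<in> arcs G" for e
    using only[of "tail G e" e] that SV by (simp add: mem_incident_arcs)
  then have arcs: "arcs G = {e1}"
    using e1(1) by blast
  have VDV: "verts G - VD = {}" unfolding SV[symmetric] S_def using e1 by blast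
  let ?l = "len e1"
  have l: "0 < ?l" by (rule len_pos[OF e1(1)])
  \<comment> \<open>Makes \<open>m\<close> exceed
    \<open>\<bar>T\<bar> + \<bar>q e1\<bar> + 1\<close>, so that \<open>m\<^sup>2 > m\<close> gives
    \<open>m\<^sup>2 + q e1 > T\<close>.\<close>
  obtain N :: nat where N: "max 1 ((\<bar>T\<bar> + \<bar>q e1\<bar> + 1) * ?l) < real N" using reals_Archimedean2 by blast
  define m where "m = real N * pi / ?l"
  have m: "\<bar>T\<bar> + \<bar>q e1\<bar> + 1 < m"
  proof -
    have "(\<bar>T\<bar> + \<bar>q e1\<bar> + 1) * ?l < real N * 1" using N by simp
    also have "\<dots> \<le> real N * pi" using pi_gt3 by (intro mult_left_mono) auto
    finally show ?thesis using l by (simp add: m_def pos_less_divide_eq)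
  qed
  have m0: "0 < m" using m by linarith
  have "m * 1 < m * m" using m by (intro mult_strict_left_mono) auto
  then have T: "T < m\<^sup>2 + q e1" using m unfolding power2_eq_square by linarith
  have ml: "m * ?l = real N * pi" using l by (simp add: m_def)
  \<comment> \<open>The entry \<open>- m\<close> at the tail makes the sine coefficient of the wave
    equal to 1.\<close>
  define D where "D e v = (if v = tail G e then - complex_of_real m else of_real (m * cos (m * ?l)))" for e :: 'e and v
  have mode: "discrete_mode G len VD \<alpha> (\<lambda>e. m) (\<lambda>v. 0) D"
    using no_loops[OF e1(1)] VDV ml unfolding discrete_mode_def arcs by (auto simp: edge_transfer_def D_def)
  let ?\<psi> = "mode_wave G len (\<lambda>e. m) (\<lambda>v. 0) D"
  have supp: "\<exists>x\<in>{0..len e}. ?\<psi> e x \<noteq> 0" if "e \<in> arcs G" for e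
  proof -
    have e: "e = e1" using that arcs by simp
    \<comment> \<open>The first maximum of the sine, which lies on the edge because
      \<open>m * ?l\<close> is a positive multiple of \<open>pi\<close>.\<close>
    define x where "x = pi / (2 * m)"
    have "pi * 1 \<le> pi * (2 * real N)" using N by (intro mult_left_mono) auto
    moreover have "?l * (2 * m) = pi * (2 * real N)" using ml by (simp add: mult_ac)
    moreover have "x * (2 * m) = pi" using m0 by (simp add: x_def)
    ultimately have "x * (2 * m) \<le> ?l * (2 * m)" by (simp only: mult_1_right)
    then have "x \<le> ?l" by (rule mult_right_le_imp_le) (use m0 in simp)
    moreover have "0 \<le> x" using m0 by (simp add: x_def)
    ultimately have x: "x \<in> {0..?l}" by simp
    have "m * x = pi / 2" using m0 by (simp add: x_def)
    then have "sin (m * x) = 1" by (simp only: sin_pi_half)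
    then have "?\<psi> e1 x \<noteq> 0" using x e1(1) m0 by (simp add: mode_wave_def edge_wave_def D_def)
    then show ?thesis using x e by blast
  qed
  have "?\<psi> \<in> eigenspace G len VD \<alpha> q (of_real (m\<^sup>2 + q e1))"
    by (rule mode_wave_eigenspace[OF mode VD]) (use m0 arcs in auto)
  moreover have "?\<psi> \<noteq> 0" using supp[OF e1(1)] by auto
  ultimately show ?thesis using supp T unfolding eigenfunction_def by blast
qed

end

lemma unbounded_imp_strict_mono_sequence:
  fixes P :: "real \<Rightarrow> 'a \<Rightarrow> bool"
  assumes "\<And>T. \<exists>z>T. \<exists>\<psi>. P z \<psi>"
  shows "\<exists>lam \<psi>. strict_mono lam \<and> (\<forall>k :: nat. P (lam k) (\<psi> k))"
proof -
  have "\<exists>f. \<forall>n :: nat. (\<exists>\<psi>. P (f n) \<psi>) \<and> f n < f (Suc n)"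
    by (rule dependent_nat_choice) (use assms in blast)+
  then obtain f where f: "\<And>n. \<exists>\<psi>. P (f n) \<psi>" "\<And>n. f n < f (Suc n)" by blast
  then have "strict_mono f" by (simp add: strict_mono_Suc_iff)
  then show ?thesis using f(1) by metis
qed

theorem theorem4:
  fixes G :: "('v, 'e) pre_digraph"
    and len :: "'e \<Rightarrow> real"
    and VD :: "'v set"
    and \<alpha> :: "'v \<Rightarrow> real"
    and q :: "'e \<Rightarrow> real"
  assumes "compact_metric_graph G len"
    and "Digraph_Component.connected G"
    and "VD \<subseteq> verts G"
    and "\<And>v. v \<in> VD \<Longrightarrow> vertex_degree G v = 1"
  shows "(undirected_tree G \<and> VD = {} \<longrightarrow>
            (\<exists>(lam :: nat \<Rightarrow> real) (\<psi> :: nat \<Rightarrow> 'e \<Rightarrow> real \<Rightarrow> complex).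
               strict_mono lam \<and>
               (\<forall>k. eigenvalue G len VD \<alpha> q (complex_of_real (lam k)) \<and>
                    eigenvalue_multiplicity G len VD \<alpha> q (complex_of_real (lam k)) = 1 \<and>
                    eigenfunction G len VD \<alpha> q (complex_of_real (lam k)) (\<psi> k) \<and>
                    (\<forall>v\<in>verts G. \<not> vanishes_at G len (\<psi> k) v))))
       \<and> (VD \<noteq> {} \<longrightarrow>
            (\<exists>(lam :: nat \<Rightarrow> real) (\<psi> :: nat \<Rightarrow> 'e \<Rightarrow> real \<Rightarrow> complex).
               strict_mono lam \<and>
               (\<forall>k. eigenvalue G len VD \<alpha> q (complex_of_real (lam k)) \<and>
                    eigenfunction G len VD \<alpha> q (complex_of_real (lam k)) (\<psi> k) \<and>
                    (\<forall>e\<in>arcs G. \<exists>x\<in>{0..len e}. \<psi> k e x \<noteq> 0))))"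
proof (intro conjI impI)
  interpret compact_metric_graph G len by fact
  assume "undirected_tree G \<and> VD = {}"
  then show "\<exists>(lam :: nat \<Rightarrow> real) (\<psi> :: nat \<Rightarrow> 'e \<Rightarrow> real \<Rightarrow> complex).
               strict_mono lam \<and>
               (\<forall>k. eigenvalue G len VD \<alpha> q (complex_of_real (lam k)) \<and>
                    eigenvalue_multiplicity G len VD \<alpha> q (complex_of_real (lam k)) = 1 \<and>
                    eigenfunction G len VD \<alpha> q (complex_of_real (lam k)) (\<psi> k) \<and>
                    (\<forall>v\<in>verts G. \<not> vanishes_at G len (\<psi> k) v))"
    using tree_generic_eigenfunction[of _ \<alpha> q]
    by (intro unbounded_imp_strict_mono_sequence) (auto simp: eigenvalue_def, metis)
next
  interpret compact_metric_graph G len by fact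
  assume ne: "VD \<noteq> {}"
  have "\<exists>z>T. \<exists>\<psi>. eigenfunction G len VD \<alpha> q (of_real z) \<psi> \<and> (\<forall>e\<in>arcs G. \<exists>x\<in>{0..len e}. \<psi> e x \<noteq> 0)" for T
    \<comment> \<open>The two lemmas cover the cases without and with an edge joining two Dirichlet
      vertices.\<close>
    using full_support_eigenfunction[OF assms(2,3) ne assms(4)] dirichlet_interval_eigenfunction[OF assms(2-4)]
    by blast
  then show "\<exists>(lam :: nat \<Rightarrow> real) (\<psi> :: nat \<Rightarrow> 'e \<Rightarrow> real \<Rightarrow> complex).
               strict_mono lam \<and>
               (\<forall>k. eigenvalue G len VD \<alpha> q (complex_of_real (lam k)) \<and>
                    eigenfunction G len VD \<alpha> q (complex_of_real (lam k)) (\<psi> k) \<and>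
                    (\<forall>e\<in>arcs G. \<exists>x\<in>{0..len e}. \<psi> k e x \<noteq> 0))"
    by (intro unbounded_imp_strict_mono_sequence) (auto simp: eigenvalue_def, metis)
qed

end
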